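(* Let $N\ge 1$ be an integer and $p\ge 1$. Let $(\mathbf{Z}_t)_{t\ge 0}$ be the simple random walk on $\mathbb{Z}^N$ started at $\mathbf{0}$, and let $|\cdot|$ denote the $L^\infty$ norm on $\mathbb{R}^N$. For integers $r\ge 1$ and $t\ge 1$ let $$\widetilde T_{N,r}=\min\{t:\ \mathbf{Z}_t\notin \mathcal{B}_r\},\qquad \mathcal{B}_r=\{\mathbf{z}\in\mathbb{Z}^N:\ |\mathbf{z}|\le r\},\qquad \widetilde M_{N,t}=\max_{1\le s\le t}|\mathbf{Z}_s|.$$ Let $(\widehat{\mathbf{W}}_s)_{s\ge 0}$ be $N$-dimensional Brownian motion started at $\mathbf{0}$ with covariance matrix $\frac1N I$, and let $$\widehat T_N=\inf\{s:\ \widehat{\mathbf{W}}_s\notin \mathbf{B}_1\},\qquad \mathbf{B}_1=\{\mathbf{x}\in\mathbb{R}^N:\ |\mathbf{x}|\le 1\},\qquad \widehat M_N=\sup_{0\le s\le 1}|\widehat{\mathbf{W}}_s|.$$ Then $$\frac{1}{r^{2p}}\,\mathbb{E}\big(\widetilde T_{N,r}^{\,p}\big)\longrightarrow \mathbb{E}\big(\widehat T_N^{\,p}\big)\quad\text{as } r\to\infty,$$ and $$\frac{1}{t^{p/2}}\,\mathbb{E}\big(\widetilde M_{N,t}^{\,p}\big)\longrightarrow \mathbb{E}\big(\widehat M_N^{\,p}\big)\quad\text{as } t\to\infty.$$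
   Context: The simple random walk on $\mathbb{Z}^N$ is $\mathbf{Z}_t=\sum_{s=1}^t\boldsymbol{\omega}_s$, $\mathbf{Z}_0=\mathbf{0}$, where $(\boldsymbol{\omega}_s)_{s\ge1}$ are i.i.d. with $\mathbb{P}(\boldsymbol{\omega}_s=\pm\mathbf{e}_i)=\frac{1}{2N}$ for $i=1,\dots,N$, and $\mathbf{e}_1,\dots,\mathbf{e}_N$ is the standard basis of $\mathbb{R}^N$. The $L^\infty$ norm is $|\mathbf{z}|=\max\{|z_1|,\dots,|z_N|\}$. Brownian motion with covariance matrix $\Sigma$ is the continuous process with independent increments, started at $\mathbf{0}$, whose increments over an interval of length $h$ are centered Gaussian vectors with covariance matrix $h\Sigma$. *)

theory Defs
  imports "HOL-Probability.Probability"
begin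

(* The step probabilities sum to 1 over the 2N atoms, so they determine the common law of the
   steps; measurability of the steps is part of indep_vars. The walk is viewed in R^N. *)
locale simple_random_walk = prob_space M
  for M :: "'a measure" +
  fixes \<omega> :: "nat \<Rightarrow> 'a \<Rightarrow> real ^ 'n"
  assumes indep_steps: "indep_vars (\<lambda>_. borel) \<omega> {1..}"
    and step_pos: "\<And>s i. 1 \<le> s \<Longrightarrow>
      prob {x \<in> space M. \<omega> s x = axis i 1} = 1 / (2 * real CARD('n))"
    and step_neg: "\<And>s i. 1 \<le> s \<Longrightarrow>
      prob {x \<in> space M. \<omega> s x = - axis i 1} = 1 / (2 * real CARD('n))"

definition walk :: "(nat \<Rightarrow> 'a \<Rightarrow> real ^ 'n) \<Rightarrow> nat \<Rightarrow> 'a \<Rightarrow> real ^ 'n" where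
  "walk \<omega> t x = (\<Sum>s = 1..t. \<omega> s x)"

definition lattice_ball :: "nat \<Rightarrow> (real ^ 'n) set" where
  "lattice_ball r = {z. (\<forall>i. z $ i \<in> \<int>) \<and> infnorm z \<le> real r}"

(* Exit times are extended-valued: they are infinite on paths that never exit. *)
definition walk_exit_time :: "(nat \<Rightarrow> 'a \<Rightarrow> real ^ 'n) \<Rightarrow> nat \<Rightarrow> 'a \<Rightarrow> ennreal" where
  "walk_exit_time \<omega> r x = Inf {of_nat t | t. walk \<omega> t x \<notin> lattice_ball r}"

(* Only meaningful for t \<ge> 1. *)
definition walk_max :: "(nat \<Rightarrow> 'a \<Rightarrow> real ^ 'n) \<Rightarrow> nat \<Rightarrow> 'a \<Rightarrow> real" where
  "walk_max \<omega> t x = Max ((\<lambda>s. infnorm (walk \<omega> s x)) ` {1..t})"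

(* Normal law on the line with mean 0, the point mass at 0 (standard deviation 0) included. *)
definition (in prob_space) centered_normal :: "('a \<Rightarrow> real) \<Rightarrow> bool" where
  "centered_normal Y \<longleftrightarrow> random_variable borel Y \<and>
     ((AE x in M. Y x = 0) \<or> (\<exists>\<sigma>>0. distributed M lborel Y (normal_density 0 \<sigma>)))"

(* As the vector is centered, its covariances are the mixed second moments. *)
definition (in prob_space) centered_gaussian_vector ::
    "('a \<Rightarrow> real ^ 'n) \<Rightarrow> real ^ 'n ^ 'n \<Rightarrow> bool" where
  "centered_gaussian_vector X \<Sigma> \<longleftrightarrow> random_variable borel X \<and>
     (\<forall>u. centered_normal (\<lambda>x. u \<bullet> X x)) \<and>
     (\<forall>i j. expectation (\<lambda>x. X x $ i * X x $ j) = \<Sigma> $ i $ j)"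

(* Time ranges over the nonnegative reals; values of W at negative times are irrelevant. *)
locale brownian_motion = prob_space P
  for P :: "'b measure" +
  fixes W :: "real \<Rightarrow> 'b \<Rightarrow> real ^ 'n"
    and \<Sigma> :: "real ^ 'n ^ 'n"
  assumes measurable_W: "\<And>s. 0 \<le> s \<Longrightarrow> random_variable borel (W s)"
    and start: "AE x in P. W 0 x = 0"
    and continuous_paths: "AE x in P. continuous_on {0..} (\<lambda>s. W s x)"
    and indep_increments: "\<And>(t :: nat \<Rightarrow> real) k. 0 \<le> t 0 \<Longrightarrow> (\<And>i. i < k \<Longrightarrow> t i < t (Suc i)) \<Longrightarrow>
      indep_vars (\<lambda>_. borel) (\<lambda>i x. W (t (Suc i)) x - W (t i) x) {..<k}"
    and gaussian_increments: "\<And>s h. 0 \<le> s \<Longrightarrow> 0 \<le> h \<Longrightarrow>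
      centered_gaussian_vector (\<lambda>x. W (s + h) x - W s x) (h *\<^sub>R \<Sigma>)"

definition unit_box :: "(real ^ 'n) set" where
  "unit_box = {z. infnorm z \<le> 1}"

definition process_exit_time :: "(real \<Rightarrow> 'b \<Rightarrow> real ^ 'n) \<Rightarrow> 'b \<Rightarrow> ennreal" where
  "process_exit_time W x = Inf {ennreal s | s. 0 \<le> s \<and> W s x \<notin> unit_box}"

definition process_max :: "(real \<Rightarrow> 'b \<Rightarrow> real ^ 'n) \<Rightarrow> 'b \<Rightarrow> ennreal" where
  "process_max W x = (SUP s\<in>{0..1}. ennreal (infnorm (W s x)))"

(* For exponents p > 0. *)
definition ennreal_powr :: "ennreal \<Rightarrow> real \<Rightarrow> ennreal" where
  "ennreal_powr a p = (if a = \<infinity> then \<infinity> else ennreal (enn2real a powr p))"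

end

theory Submission
  imports Defs
begin

text \<open>
  Both limits are statements about one distribution function.  Let \<open>F\<^sub>n a\<close> be the probability that
  the walk stays in the box of radius \<open>a * sqrt n\<close> up to time \<open>n\<close>, and \<open>F a\<close> the probability that
  the Brownian motion stays in the box of radius \<open>a\<close> up to time \<open>1\<close>.  The rescaled maximum of the
  walk exceeds \<open>u\<close> with probability \<open>1 - F\<^sub>n u\<close>.  The exit time from the box of radius \<open>r\<close> exceeds
  \<open>u * r\<^sup>2\<close> exactly if the walk stays in this box up to time \<open>n = \<lfloor>u * r\<^sup>2\<rfloor>\<close>, which has probability
  \<open>F\<^sub>n (r / sqrt n)\<close>, where \<open>r / sqrt n\<close> tends to \<open>1 / sqrt u\<close>.  Since the \<open>p\<close>-th moment of \<open>X\<close> is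
  the integral of \<open>p * u powr (p - 1) * P (X > u)\<close> over \<open>u > 0\<close>, both claims follow by dominated
  convergence (\<open>tail_integrals_converge\<close>) from three facts: \<open>F\<^sub>n\<close> converges to \<open>F\<close> at the continuity
  points of \<open>F\<close>, the tails have an exponential bound that is uniform in the parameter, and the exit
  time of the Brownian motion exceeds \<open>u\<close> with probability \<open>F (1 / sqrt u)\<close> for almost all \<open>u\<close>.

  The convergence of \<open>F\<^sub>n\<close> to \<open>F\<close> (\<open>walk_cdf_le_sup_cdf\<close>, \<open>sup_cdf_le_walk_cdf\<close>) is obtained from
  a coarse time grid.  For the Brownian motion, the maximum over a dyadic grid increases to the supremum
  of the path.  For the walk, time is cut into \<open>m\<close> blocks, and the oscillation within the blocks is
  controlled by Hoeffding's inequality in a maximal form (\<open>hoeffding_max_partial_sums\<close>); with a union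
  bound over the blocks it is negligible for large \<open>m\<close>.  On the grid, finitely many
  vectors have to be compared.  Their joint characteristic functions converge because the increments
  are independent (\<open>char_partial_sums\<close>) and a power of an average of cosines tends to a Gaussian
  (\<open>cos_average_power_tendsto\<close>).  Up to a tail event, the indicator of a box is squeezed between products of functions
  of \<open>cos (y / K)\<close>; by the Weierstrass theorem these are uniform limits of trigonometric sums, whose
  expectations converge (\<open>box_prob_sandwich\<close>).

  The law of the Brownian exit time comes for free.  A rescaled Brownian motion is again a Brownian
  motion with the same covariance, so its running maximum is the limit of the same \<open>F\<^sub>n\<close> and has the
  same law (\<open>sup_cdf_universal\<close>).  The exponential bound for the exit time of the walk is the
  usual geometric one: a walk confined to the box of radius \<open>r\<close> has an increment of norm at most
  \<open>2 * r\<close> over each of the disjoint blocks of length \<open>c * r\<^sup>2\<close>, and for a suitable constant \<open>c\<close> this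
  has a probability bounded away from \<open>1\<close> (\<open>walk_leaves_box_in_each_block\<close>).
\<close>

section \<open>Moments as tail integrals\<close>

lemma ennreal_powr_divide:
  assumes "0 < c"
  shows "ennreal_powr (a / ennreal c) p = ennreal_powr a p / ennreal (c powr p)"
proof (cases a)
  case (real x)
  then show ?thesis using assms by (simp add: divide_ennreal ennreal_powr_def powr_divide)
next
  case top
  then show ?thesis using assms by (simp add: ennreal_powr_def ennreal_top_divide)
qed

lemma ennreal_powr_layer_cake:
  fixes p :: real
  assumes p: "0 < p"
  shows "ennreal_powr a p =
    (\<integral>\<^sup>+u. ennreal (p * u powr (p - 1)) * indicator {u. 0 < u \<and> ennreal u < a} u \<partial>lborel)"
proof -
  have fin: "(\<integral>\<^sup>+u. ennreal (p * u powr (p - 1)) * indicator {u. 0 < u \<and> ennreal u < ennreal c} u \<partial>lborel)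
      = ennreal (c powr p)" if c: "0 \<le> c" for c
  proof -
    have "((\<lambda>u. p * u powr (p - 1)) has_integral (p * (c powr (p - 1 + 1) / (p - 1 + 1)))) {0..c}"
      using p c by (intro has_integral_mult_right has_integral_powr_from_0) auto
    then have "((\<lambda>u. p * u powr (p - 1)) has_integral (c powr p)) {0..c}"
      using p by simp
    then have "(\<integral>\<^sup>+u. ennreal (p * u powr (p - 1)) * indicator {0..c} u \<partial>lborel) = ennreal (c powr p)"
      using p by (intro nn_integral_has_integral_lebesgue') auto
    moreover have ae: "AE u in lborel. ennreal (p * u powr (p - 1)) * indicator {0..c} u =
       ennreal (p * u powr (p - 1)) * indicator {u. 0 < u \<and> ennreal u < ennreal c} u"
      using AE_lborel_singleton[of 0] AE_lborel_singleton[of c]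
      by eventually_elim (auto simp: indicator_def ennreal_less_iff)
    ultimately show ?thesis
      using nn_integral_cong_AE[OF ae] by simp
  qed
  show ?thesis
  proof (cases a)
    case (real c)
    then show ?thesis using fin[of c] by (simp add: ennreal_powr_def)
  next
    case top
    have "ennreal (real n) \<le>
      (\<integral>\<^sup>+u. ennreal (p * u powr (p - 1)) * indicator {u. 0 < u \<and> ennreal u < a} u \<partial>lborel)" for n
    proof -
      have "ennreal (real n) = ennreal ((real n powr (1 / p)) powr p)"
        using p by (simp add: powr_powr)
      also have "\<dots> = (\<integral>\<^sup>+u. ennreal (p * u powr (p - 1)) *
          indicator {u. 0 < u \<and> ennreal u < ennreal (real n powr (1 / p))} u \<partial>lborel)"
        by (rule fin[symmetric]) simp
      also have "\<dots> \<le> (\<integral>\<^sup>+u. ennreal (p * u powr (p - 1)) * indicator {u. 0 < u \<and> ennreal u < a} u \<partial>lborel)"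
        by (intro nn_integral_mono mult_left_mono) (auto simp: indicator_def top)
      finally show ?thesis .
    qed
    then have "(\<integral>\<^sup>+u. ennreal (p * u powr (p - 1)) * indicator {u. 0 < u \<and> ennreal u < a} u \<partial>lborel) = top"
      by (metis ennreal_Ex_less_of_nat ennreal_of_nat_eq_real_of_nat linorder_not_less top.not_eq_extremum)
    then show ?thesis by (simp add: ennreal_powr_def top)
  qed
qed

text \<open>
  Fubini applied to the pointwise formula.  The variable is extended-valued because
  an exit time may be infinite.
\<close>

lemma (in prob_space) nn_integral_powr_layer_cake:
  fixes X :: "'a \<Rightarrow> ennreal" and p :: real
  assumes X[measurable]: "X \<in> borel_measurable M" and p: "0 < p"
  shows "(\<integral>\<^sup>+x. ennreal_powr (X x) p \<partial>M) =
    (\<integral>\<^sup>+u. ennreal (p * u powr (p - 1) * indicator {0<..} u * prob {x\<in>space M. ennreal u < X x}) \<partial>lborel)"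
proof -
  interpret pair_sigma_finite M lborel ..
  have "(\<integral>\<^sup>+x. ennreal_powr (X x) p \<partial>M) =
     (\<integral>\<^sup>+x. \<integral>\<^sup>+u. ennreal (p * u powr (p - 1)) * indicator {u. 0 < u \<and> ennreal u < X x} u \<partial>lborel \<partial>M)"
    by (simp add: ennreal_powr_layer_cake[OF p])
  also have "\<dots> =
     (\<integral>\<^sup>+u. \<integral>\<^sup>+x. ennreal (p * u powr (p - 1)) * indicator {u. 0 < u \<and> ennreal u < X x} u \<partial>M \<partial>lborel)"
    by (rule Fubini'[symmetric]) measurable
  also have "\<dots> = (\<integral>\<^sup>+u. ennreal (p * u powr (p - 1) * indicator {0<..} u * prob {x\<in>space M. ennreal u < X x}) \<partial>lborel)"
  proof (rule nn_integral_cong)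
    fix u :: real
    have "(\<integral>\<^sup>+x. ennreal (p * u powr (p - 1)) * indicator {u. 0 < u \<and> ennreal u < X x} u \<partial>M) =
      (\<integral>\<^sup>+x. ennreal (p * u powr (p - 1) * indicator {0<..} u) * indicator {x\<in>space M. ennreal u < X x} x \<partial>M)"
      by (intro nn_integral_cong) (auto simp: indicator_def)
    also have "\<dots> = ennreal (p * u powr (p - 1) * indicator {0<..} u) * emeasure M {x\<in>space M. ennreal u < X x}"
      by (subst nn_integral_cmult_indicator) auto
    also have "\<dots> = ennreal (p * u powr (p - 1) * indicator {0<..} u * prob {x\<in>space M. ennreal u < X x})"
      using p by (simp add: emeasure_eq_measure ennreal_mult)
    finally show "(\<integral>\<^sup>+x. ennreal (p * u powr (p - 1)) * indicator {u. 0 < u \<and> ennreal u < X x} u \<partial>M) =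
      ennreal (p * u powr (p - 1) * indicator {0<..} u * prob {x\<in>space M. ennreal u < X x})" .
  qed
  finally show ?thesis .
qed

lemma powr_exp_integral_finite:
  fixes p b :: real
  assumes p: "0 < p" and b: "0 < b"
  shows "(\<integral>\<^sup>+u. ennreal (p * u powr (p - 1) * indicator {0<..} u * (C * exp (- b * u))) \<partial>lborel) < \<infinity>"
proof -
  have "((\<lambda>t. t powr (p - 1) / exp t) has_integral Gamma p) {0..}"
    by (rule Gamma_integral_real[OF p])
  then have "(\<integral>\<^sup>+t. ennreal (t powr (p - 1) / exp t) * indicator {0..} t \<partial>lborel) = ennreal (Gamma p)"
    by (intro nn_integral_has_integral_lebesgue') auto
  moreover have "(\<integral>\<^sup>+t. ennreal (t powr (p - 1) / exp t) * indicator {0..} t \<partial>lborel) =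
     ennreal \<bar>b\<bar> * (\<integral>\<^sup>+u. ennreal ((0 + b * u) powr (p - 1) / exp (0 + b * u)) * indicator {0..} (0 + b * u) \<partial>lborel)"
    using b by (intro nn_integral_real_affine) auto
  ultimately have fin: "(\<integral>\<^sup>+u. ennreal ((b * u) powr (p - 1) / exp (b * u)) * indicator {0..} (b * u) \<partial>lborel) < \<infinity>"
    using b by (cases "\<integral>\<^sup>+u. ennreal ((b * u) powr (p - 1) / exp (b * u)) * indicator {0..} (b * u) \<partial>lborel")
      (simp_all add: ennreal_mult_top)
  have "(\<integral>\<^sup>+u. ennreal (p * u powr (p - 1) * indicator {0<..} u * (C * exp (- b * u))) \<partial>lborel) \<le>
    (\<integral>\<^sup>+u. ennreal (p * \<bar>C\<bar> / b powr (p - 1)) * (ennreal ((b * u) powr (p - 1) / exp (b * u)) * indicator {0..} (b * u)) \<partial>lborel)"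
  proof (intro nn_integral_mono)
    fix u :: real
    show "ennreal (p * u powr (p - 1) * indicator {0<..} u * (C * exp (- b * u))) \<le>
      ennreal (p * \<bar>C\<bar> / b powr (p - 1)) * (ennreal ((b * u) powr (p - 1) / exp (b * u)) * indicator {0..} (b * u))"
    proof (cases "0 < u")
      case True
      have "p * u powr (p - 1) * (C * exp (- b * u)) \<le> p * u powr (p - 1) * (\<bar>C\<bar> * exp (- b * u))"
        using p by (intro mult_left_mono mult_right_mono) auto
      also have "\<dots> = (p * \<bar>C\<bar> / b powr (p - 1)) * ((b * u) powr (p - 1) / exp (b * u))"
        using b True by (simp add: powr_mult exp_minus field_simps)
      finally show ?thesis
        using True b p by (simp add: ennreal_mult[symmetric] ennreal_leI)
    qed simp
  qed
  also have "\<dots> = ennreal (p * \<bar>C\<bar> / b powr (p - 1)) * (\<integral>\<^sup>+u. ennreal ((b * u) powr (p - 1) / exp (b * u)) * indicator {0..} (b * u) \<partial>lborel)"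
    by (rule nn_integral_cmult) simp
  also have "\<dots> < \<infinity>"
    using fin by (simp add: ennreal_mult_less_top)
  finally show ?thesis .
qed

text \<open>
  The exponential bound on the tails is assumed only from some index on, because for small boxes the
  walk has not yet come close to its limit.  By passing to the limit the bound also holds for \<open>g'\<close>,
  which makes the limiting moment finite.
\<close>

lemma tail_integrals_converge:
  fixes p b C :: real and g :: "nat \<Rightarrow> real \<Rightarrow> real" and g' :: "real \<Rightarrow> real"
  assumes p: "0 < p" and b: "0 < b"
    and meas[measurable]: "\<And>n. g n \<in> borel_measurable borel" "g' \<in> borel_measurable borel"
    and dom: "\<forall>\<^sub>F n in sequentially. \<forall>u>0. g n u \<le> C * exp (- b * u)"
    and lim: "AE u in lborel. 0 < u \<longrightarrow> (\<lambda>n. g n u) \<longlonglongrightarrow> g' u"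
  shows "(\<lambda>n. \<integral>\<^sup>+u. ennreal (p * u powr (p - 1) * indicator {0<..} u * g n u) \<partial>lborel)
      \<longlonglongrightarrow> (\<integral>\<^sup>+u. ennreal (p * u powr (p - 1) * indicator {0<..} u * g' u) \<partial>lborel)"
    and "(\<integral>\<^sup>+u. ennreal (p * u powr (p - 1) * indicator {0<..} u * g' u) \<partial>lborel) < \<infinity>"
proof -
  obtain n0 where n0: "\<And>n u. n0 \<le> n \<Longrightarrow> 0 < u \<Longrightarrow> g n u \<le> C * exp (- b * u)"
    using dom unfolding eventually_sequentially by auto
  have "(\<lambda>n. \<integral>\<^sup>+u. ennreal (p * u powr (p - 1) * indicator {0<..} u * g (n + n0) u) \<partial>lborel)
      \<longlonglongrightarrow> (\<integral>\<^sup>+u. ennreal (p * u powr (p - 1) * indicator {0<..} u * g' u) \<partial>lborel)"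
  proof (rule nn_integral_dominated_convergence[where w = "\<lambda>u. ennreal (p * u powr (p - 1) * indicator {0<..} u * (C * exp (- b * u)))"])
    show "AE u in lborel. ennreal (p * u powr (p - 1) * indicator {0<..} u * g (n + n0) u)
       \<le> ennreal (p * u powr (p - 1) * indicator {0<..} u * (C * exp (- b * u)))" for n
      using n0 p by (intro AE_I2 ennreal_leI) (auto simp: indicator_def intro!: mult_left_mono)
    show "AE u in lborel. (\<lambda>n. ennreal (p * u powr (p - 1) * indicator {0<..} u * g (n + n0) u))
      \<longlonglongrightarrow> ennreal (p * u powr (p - 1) * indicator {0<..} u * g' u)"
      using lim
    proof eventually_elim
      case (elim u)
      show ?case
      proof (cases "0 < u")
        case True
        with elim have "(\<lambda>n. g (n + n0) u) \<longlonglongrightarrow> g' u"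
          using LIMSEQ_ignore_initial_segment by blast
        then show ?thesis by (intro tendsto_ennrealI tendsto_intros)
      qed simp
    qed
  qed (use powr_exp_integral_finite[OF p b] in \<open>simp_all\<close>)
  then show "(\<lambda>n. \<integral>\<^sup>+u. ennreal (p * u powr (p - 1) * indicator {0<..} u * g n u) \<partial>lborel)
      \<longlonglongrightarrow> (\<integral>\<^sup>+u. ennreal (p * u powr (p - 1) * indicator {0<..} u * g' u) \<partial>lborel)"
    by (rule LIMSEQ_offset)
  have "AE u in lborel. ennreal (p * u powr (p - 1) * indicator {0<..} u * g' u)
       \<le> ennreal (p * u powr (p - 1) * indicator {0<..} u * (C * exp (- b * u)))"
    using lim
  proof eventually_elim
    case (elim u)
    show ?case
    proof (cases "0 < u")
      case True
      with elim have "(\<lambda>n. g n u) \<longlonglongrightarrow> g' u" by blast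
      then have "g' u \<le> C * exp (- b * u)"
        using n0 True by (intro LIMSEQ_le_const2) blast+
      then show ?thesis
        using p True by (intro ennreal_leI mult_left_mono) auto
    qed simp
  qed
  then show "(\<integral>\<^sup>+u. ennreal (p * u powr (p - 1) * indicator {0<..} u * g' u) \<partial>lborel) < \<infinity>"
    by (rule order_le_less_trans[OF nn_integral_mono_AE powr_exp_integral_finite[OF p b]])
qed

section \<open>Maxima of partial sums\<close>

text \<open>
  Ottaviani's inequality.  Stop at the first \<open>k\<close> with \<open>\<bar>S k\<bar> \<ge> 2 * a\<close>.  Either the final sum still has
  modulus at least \<open>a\<close>, or the remaining increment has; the latter is independent of what happened
  until time \<open>k\<close>, so that each of the two alternatives costs at most \<open>\<beta>\<close>.
\<close>

lemma (in prob_space) prob_max_partial_sums_le: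
  fixes X :: "nat \<Rightarrow> 'a \<Rightarrow> real" and a \<beta> :: real
  assumes indep: "indep_vars (\<lambda>_. borel) X {m<..n}"
    and tail: "\<And>k. m \<le> k \<Longrightarrow> k \<le> n \<Longrightarrow> prob {x\<in>space M. a \<le> \<bar>\<Sum>s\<in>{k<..n}. X s x\<bar>} \<le> \<beta>"
    and \<beta>: "0 \<le> \<beta>" and mn: "m \<le> n"
  shows "prob {x\<in>space M. \<exists>k\<in>{m<..n}. 2 * a \<le> \<bar>\<Sum>s\<in>{m<..k}. X s x\<bar>} \<le> 2 * \<beta>"
proof -
  have [measurable]: "X s \<in> borel_measurable M" if "s \<in> {m<..n}" for s
    using indep that unfolding indep_vars_def by auto
  define S where "S k x = (\<Sum>s\<in>{m<..k}. X s x)" for k x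
  have S_meas: "S k \<in> borel_measurable M" if "k \<le> n" for k
    unfolding S_def using that by (intro borel_measurable_sum) auto
  define A where "A k = {x\<in>space M. 2 * a \<le> \<bar>S k x\<bar> \<and> (\<forall>j\<in>{m<..<k}. \<bar>S j x\<bar> < 2 * a)}" for k
  define R where "R k = {x\<in>space M. a \<le> \<bar>\<Sum>s\<in>{k<..n}. X s x\<bar>}" for k
  define E where "E = {x\<in>space M. \<exists>k\<in>{m<..n}. 2 * a \<le> \<bar>S k x\<bar>}"
  have R_sets: "R k \<in> events" if "m \<le> k" for k
  proof -
    have [measurable]: "(\<lambda>x. \<Sum>s\<in>{k<..n}. X s x) \<in> borel_measurable M"
      using that by (intro borel_measurable_sum) auto
    show ?thesis unfolding R_def by measurable
  qed
  have A_sets: "A k \<in> events" if "k \<in> {m<..n}" for k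
  proof -
    have [measurable]: "S k \<in> borel_measurable M" "\<And>j. j \<in> {m<..<k} \<Longrightarrow> S j \<in> borel_measurable M"
      using that S_meas by auto
    show ?thesis unfolding A_def by measurable
  qed
  have indep_AR: "prob (A k \<inter> R k) = prob (A k) * prob (R k)" if k: "k \<in> {m<..n}" for k
  proof -
    let ?B = "PiM {m<..k} (\<lambda>_. borel :: real measure)" and ?C = "PiM {k<..n} (\<lambda>_. borel :: real measure)"
    let ?f = "\<lambda>x. restrict (\<lambda>i. X i x) {m<..k}" and ?g = "\<lambda>x. restrict (\<lambda>i. X i x) {k<..n}"
    have iv: "indep_var ?B ?f ?C ?g"
      using k by (intro indep_var_restrict[OF indep]) auto
    define U where "U = {f\<in>space ?B. 2 * a \<le> \<bar>\<Sum>s\<in>{m<..k}. f s\<bar> \<and> (\<forall>j\<in>{m<..<k}. \<bar>\<Sum>s\<in>{m<..j}. f s\<bar> < 2 * a)}"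
    define V where "V = {f\<in>space ?C. a \<le> \<bar>\<Sum>s\<in>{k<..n}. f s\<bar>}"
    have partial: "(\<lambda>f. \<Sum>s\<in>{m<..j}. f s) \<in> borel_measurable ?B" if "j \<le> k" for j
      using that by (intro borel_measurable_sum measurable_component_singleton) auto
    have U: "U \<in> sets ?B"
    proof -
      have [measurable]: "(\<lambda>f. \<Sum>s\<in>{m<..k}. f s) \<in> borel_measurable ?B"
        "\<And>j. j \<in> {m<..<k} \<Longrightarrow> (\<lambda>f. \<Sum>s\<in>{m<..j}. f s) \<in> borel_measurable ?B"
        using partial by auto
      show ?thesis unfolding U_def by measurable
    qed
    have V: "V \<in> sets ?C"
    proof -
      have [measurable]: "(\<lambda>f. \<Sum>s\<in>{k<..n}. f s) \<in> borel_measurable ?C"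
        by (intro borel_measurable_sum measurable_component_singleton) auto
      show ?thesis unfolding V_def by measurable
    qed
    have [simp]: "(\<Sum>s\<in>{k<..n}. ?g x s) = (\<Sum>s\<in>{k<..n}. X s x)" for x
      by (intro sum.cong) auto
    have fU: "?f -` U \<inter> space M = A k"
      unfolding U_def A_def S_def by (auto simp: space_PiM)
    have gV: "?g -` V \<inter> space M = R k"
      unfolding V_def R_def by (auto simp: space_PiM)
    have "(\<lambda>x. (?f x, ?g x)) -` (U \<times> V) \<inter> space M = A k \<inter> R k"
      using fU gV by blast
    then show ?thesis
      using indep_varD[OF iv U V] fU gV by simp
  qed
  have sub: "E \<subseteq> R m \<union> (\<Union>k\<in>{m<..n}. A k \<inter> R k)"
  proof
    fix x assume "x \<in> E"
    then obtain k where k: "k \<in> {m<..n}" "2 * a \<le> \<bar>S k x\<bar>" and x: "x \<in> space M"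
      unfolding E_def by auto
    define k0 where "k0 = (LEAST k. k \<in> {m<..n} \<and> 2 * a \<le> \<bar>S k x\<bar>)"
    have k0: "k0 \<in> {m<..n} \<and> 2 * a \<le> \<bar>S k0 x\<bar>"
      unfolding k0_def by (rule LeastI[of "\<lambda>k. k \<in> {m<..n} \<and> 2 * a \<le> \<bar>S k x\<bar>" k]) (use k in simp)
    have least: "\<bar>S j x\<bar> < 2 * a" if "j \<in> {m<..<k0}" for j
    proof -
      have "\<not> (j \<in> {m<..n} \<and> 2 * a \<le> \<bar>S j x\<bar>)"
        using that unfolding k0_def by (intro not_less_Least) auto
      then show ?thesis using that k0 by auto
    qed
    have xA: "x \<in> A k0" unfolding A_def using k0 least x by auto
    show "x \<in> R m \<union> (\<Union>k\<in>{m<..n}. A k \<inter> R k)"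
    proof (cases "x \<in> R m")
      case False
      then have "\<bar>S n x\<bar> < a" unfolding R_def S_def using x by auto
      moreover have "S n x = S k0 x + (\<Sum>s\<in>{k0<..n}. X s x)"
      proof -
        have "{m<..n} = {m<..k0} \<union> {k0<..n}" using k0 by auto
        then show ?thesis unfolding S_def by (simp add: sum.union_disjoint)
      qed
      ultimately have "x \<in> R k0" unfolding R_def using x k0 by auto
      then show ?thesis using xA k0 by blast
    qed simp
  qed
  have "prob E \<le> prob (R m \<union> (\<Union>k\<in>{m<..n}. A k \<inter> R k))"
    using sub A_sets R_sets by (intro finite_measure_mono) auto
  also have "\<dots> \<le> prob (R m) + prob (\<Union>k\<in>{m<..n}. A k \<inter> R k)"
    using A_sets R_sets by (intro measure_Un_le) auto
  also have "prob (\<Union>k\<in>{m<..n}. A k \<inter> R k) \<le> (\<Sum>k\<in>{m<..n}. prob (A k \<inter> R k))"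
    using A_sets R_sets by (intro measure_UNION_le) auto
  also have "\<dots> \<le> (\<Sum>k\<in>{m<..n}. prob (A k) * \<beta>)"
    using tail[folded R_def] by (intro sum_mono) (auto simp: indep_AR intro!: mult_left_mono)
  also have "\<dots> = prob (\<Union>k\<in>{m<..n}. A k) * \<beta>"
  proof -
    have later: "x \<notin> A j" if "i \<in> {m<..n}" "i < j" "x \<in> A i" for i j x
    proof
      assume "x \<in> A j"
      moreover have "i \<in> {m<..<j}" using that by auto
      ultimately have "\<bar>S i x\<bar> < 2 * a" unfolding A_def by blast
      then show False using that(3) unfolding A_def by auto
    qed
    have "disjoint_family_on A {m<..n}"
      unfolding disjoint_family_on_def
    proof (intro ballI impI)
      fix i j assume ij: "i \<in> {m<..n}" "j \<in> {m<..n}" "i \<noteq> j"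
      then consider "i < j" | "j < i" by linarith
      then show "A i \<inter> A j = {}"
        by cases (use later ij in blast)+
    qed
    then have "prob (\<Union>k\<in>{m<..n}. A k) = (\<Sum>k\<in>{m<..n}. prob (A k))"
      using A_sets by (intro finite_measure_finite_Union) auto
    then show ?thesis by (simp add: sum_distrib_right)
  qed
  also have "\<dots> \<le> 1 * \<beta>"
    using \<beta> by (intro mult_right_mono) auto
  also have "prob (R m) \<le> \<beta>"
    using tail[of m] mn by (simp add: R_def)
  finally show ?thesis unfolding E_def S_def by simp
qed

lemma (in prob_space) hoeffding_partial_sums:
  fixes X :: "nat \<Rightarrow> 'a \<Rightarrow> real" and a :: real
  assumes indep: "indep_vars (\<lambda>_. borel) X {m<..n}"
    and bound: "\<And>s. s \<in> {m<..n} \<Longrightarrow> AE x in M. \<bar>X s x\<bar> \<le> 1"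
    and mean: "\<And>s. s \<in> {m<..n} \<Longrightarrow> expectation (X s) = 0"
    and len: "n \<le> m + L" and a: "0 < a"
  shows "prob {x\<in>space M. a \<le> \<bar>\<Sum>s\<in>{m<..n}. X s x\<bar>} \<le> 2 * exp (- (a\<^sup>2 / (2 * real L)))"
proof (cases "m < n")
  case True
  interpret H: Hoeffding_ineq M "{m<..n}" X "\<lambda>_. -1" "\<lambda>_. 1" "\<Sum>i\<in>{m<..n}. expectation (X i)"
  proof unfold_locales
    show "AE x in M. X i x \<in> {-1..1}" if "i \<in> {m<..n}" for i
      using bound[OF that] by eventually_elim auto
  qed (simp_all add: indep)
  have "prob {x\<in>space M. a \<le> \<bar>(\<Sum>s\<in>{m<..n}. X s x) - (\<Sum>i\<in>{m<..n}. expectation (X i))\<bar>}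
      \<le> 2 * exp (- 2 * a\<^sup>2 / (\<Sum>i\<in>{m<..n}. (1 - (-1))\<^sup>2))"
    using True a by (intro H.Hoeffding_ineq_abs_ge) auto
  then have "prob {x\<in>space M. a \<le> \<bar>\<Sum>s\<in>{m<..n}. X s x\<bar>} \<le> 2 * exp (- (a\<^sup>2 / (2 * real (n - m))))"
    by (simp add: mean)
  also have "\<dots> \<le> 2 * exp (- (a\<^sup>2 / (2 * real L)))"
    using True len by (intro mult_left_mono) (auto intro!: divide_left_mono)
  finally show ?thesis .
next
  case False
  then show ?thesis using a by simp
qed

lemma (in prob_space) hoeffding_max_partial_sums:
  fixes X :: "nat \<Rightarrow> 'a \<Rightarrow> real" and a :: real
  assumes indep: "indep_vars (\<lambda>_. borel) X {m<..n}"
    and bound: "\<And>s. s \<in> {m<..n} \<Longrightarrow> AE x in M. \<bar>X s x\<bar> \<le> 1"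
    and mean: "\<And>s. s \<in> {m<..n} \<Longrightarrow> expectation (X s) = 0"
    and mn: "m \<le> n" and len: "n \<le> m + L" and a: "0 < a"
  shows "prob {x\<in>space M. \<exists>k\<in>{m<..n}. 2 * a \<le> \<bar>\<Sum>s\<in>{m<..k}. X s x\<bar>} \<le> 4 * exp (- (a\<^sup>2 / (2 * real L)))"
proof -
  have "prob {x\<in>space M. \<exists>k\<in>{m<..n}. 2 * a \<le> \<bar>\<Sum>s\<in>{m<..k}. X s x\<bar>} \<le> 2 * (2 * exp (- (a\<^sup>2 / (2 * real L))))"
  proof (rule prob_max_partial_sums_le[OF indep])
    fix k assume k: "m \<le> k" "k \<le> n"
    show "prob {x\<in>space M. a \<le> \<bar>\<Sum>s\<in>{k<..n}. X s x\<bar>} \<le> 2 * exp (- (a\<^sup>2 / (2 * real L)))"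
    proof (rule hoeffding_partial_sums)
      show "indep_vars (\<lambda>_. borel) X {k<..n}"
        using k by (intro indep_vars_subset[OF indep]) auto
    qed (use k len a bound mean in auto)
  qed (simp_all add: mn)
  then show ?thesis by simp
qed

section \<open>From characteristic functions to probabilities of boxes\<close>

lemma infnorm_le_iff_components:
  fixes y :: "real ^ 'n"
  shows "infnorm y \<le> a \<longleftrightarrow> (\<forall>i. \<bar>y $ i\<bar> \<le> a)"
proof -
  have *: "{\<bar>y $ i\<bar> |i. i \<in> UNIV} = range (\<lambda>i. \<bar>y $ i\<bar>)" by auto
  have "infnorm y = Max (range (\<lambda>i. \<bar>y $ i\<bar>))"
    unfolding infnorm_cart * by (intro cSup_eq_Max) auto
  then show ?thesis by simp
qed

lemma borel_measurable_infnorm [measurable]: "(infnorm :: real ^ 'n \<Rightarrow> real) \<in> borel_measurable borel"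
  by (intro borel_measurable_continuous_onI continuous_on_infnorm continuous_on_id)

lemma borel_measurable_component [measurable]: "(\<lambda>y :: real ^ 'n. y $ i) \<in> borel_measurable borel"
  by (intro borel_measurable_continuous_onI continuous_intros)

text \<open>
  Finite linear combinations of characters on finite families of vectors.  Their expectations are
  determined by joint characteristic functions, and they form an algebra.
\<close>

inductive trig_sum :: "nat set \<Rightarrow> ((nat \<Rightarrow> real ^ 'n) \<Rightarrow> complex) \<Rightarrow> bool" for J where
  monomial: "trig_sum J (\<lambda>y. iexp (\<Sum>j\<in>J. \<theta> j \<bullet> y j))"
| add: "trig_sum J f \<Longrightarrow> trig_sum J g \<Longrightarrow> trig_sum J (\<lambda>y. f y + g y)"
| scale: "trig_sum J f \<Longrightarrow> trig_sum J (\<lambda>y. c * f y)"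

lemma trig_sum_const: "trig_sum J (\<lambda>y. c)"
  using trig_sum.scale[OF trig_sum.monomial[of J "\<lambda>_. 0"], of c] by simp

text \<open>
  Products of characters are characters, so it suffices to expand both factors.
\<close>

lemma trig_sum_mult:
  assumes "trig_sum J f" "trig_sum J g"
  shows "trig_sum J (\<lambda>y. f y * g y)"
  using assms(1)
proof induction
  case (monomial \<theta>)
  show ?case
    using assms(2)
  proof induction
    case (monomial \<theta>')
    have "(\<lambda>y :: nat \<Rightarrow> real ^ 'a. iexp (\<Sum>j\<in>J. \<theta> j \<bullet> y j) * iexp (\<Sum>j\<in>J. \<theta>' j \<bullet> y j)) =
        (\<lambda>y. iexp (\<Sum>j\<in>J. (\<theta> j + \<theta>' j) \<bullet> y j))"
      by (simp add: exp_add[symmetric] inner_add_left sum.distrib distrib_left)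
    then show ?case using trig_sum.monomial[of J "\<lambda>j. \<theta> j + \<theta>' j"] by simp
  next
    case (add f g)
    then show ?case using trig_sum.add by (simp add: distrib_left)
  next
    case (scale f c)
    then show ?case using trig_sum.scale[OF scale.IH, of c] by (simp add: mult.left_commute)
  qed
next
  case (add f g)
  then show ?case using trig_sum.add by (simp add: distrib_right)
next
  case (scale f c)
  then show ?case using trig_sum.scale[OF scale.IH, of c] by (simp add: mult.assoc)
qed

lemma trig_sum_prod:
  assumes "\<And>k. k \<in> K \<Longrightarrow> trig_sum J (f k)"
  shows "trig_sum J (\<lambda>y. \<Prod>k\<in>K. f k y)"
  using assms by (induction K rule: infinite_finite_induct) (auto intro: trig_sum_const trig_sum_mult)

lemma trig_sum_sum:
  assumes "\<And>k. k \<in> K \<Longrightarrow> trig_sum J (f k)"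
  shows "trig_sum J (\<lambda>y. \<Sum>k\<in>K. f k y)"
  using assms by (induction K rule: infinite_finite_induct) (auto intro: trig_sum_const trig_sum.add)

lemma trig_sum_cos:
  assumes J: "finite J" "j \<in> J"
  shows "trig_sum J (\<lambda>y :: nat \<Rightarrow> real ^ 'n. complex_of_real (cos (y j $ i / R)))"
proof -
  define \<theta> :: "nat \<Rightarrow> real ^ 'n" where "\<theta> k = (if k = j then axis i (1 / R) else 0)" for k
  have \<theta>: "(\<Sum>k\<in>J. \<theta> k \<bullet> y k) = y j $ i / R" "(\<Sum>k\<in>J. - \<theta> k \<bullet> y k) = - (y j $ i / R)" for y
  proof -
    have "(\<Sum>k\<in>J. \<theta> k \<bullet> y k) = (\<Sum>k\<in>J. if k = j then y j $ i / R else 0)"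
      by (intro sum.cong) (auto simp: \<theta>_def inner_axis' )
    then show "(\<Sum>k\<in>J. \<theta> k \<bullet> y k) = y j $ i / R" using J by simp
    then show "(\<Sum>k\<in>J. - \<theta> k \<bullet> y k) = - (y j $ i / R)" by (simp add: sum_negf)
  qed
  have "trig_sum J (\<lambda>y. 1/2 * (iexp (\<Sum>k\<in>J. \<theta> k \<bullet> y k) + iexp (\<Sum>k\<in>J. - \<theta> k \<bullet> y k)))"
    by (intro trig_sum.scale trig_sum.add trig_sum.monomial)
  also have "(\<lambda>y. 1/2 * (iexp (\<Sum>k\<in>J. \<theta> k \<bullet> y k) + iexp (\<Sum>k\<in>J. - \<theta> k \<bullet> y k))) =
     (\<lambda>y. complex_of_real (cos (y j $ i / R)))"
    unfolding \<theta> by (simp add: fun_eq_iff cos_exp_eq cos_of_real[symmetric] field_simps)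
  finally show ?thesis .
qed

lemma trig_sum_power: "trig_sum J f \<Longrightarrow> trig_sum J (\<lambda>y. f y ^ k)"
  by (induction k) (auto intro: trig_sum_const trig_sum_mult)

lemma prod_cos_measurable:
  fixes Z :: "nat \<Rightarrow> 'a \<Rightarrow> real ^ 'n" and h :: "real \<Rightarrow> real"
  assumes [measurable]: "h \<in> borel_measurable borel" and Z: "\<And>j. j \<in> J \<Longrightarrow> Z j \<in> borel_measurable N"
  shows "(\<lambda>x. \<Prod>(j, i)\<in>J \<times> UNIV. h (cos (Z j x $ i / R))) \<in> borel_measurable N"
  unfolding case_prod_unfold
proof (rule borel_measurable_prod)
  fix k :: "nat \<times> 'n" assume "k \<in> J \<times> UNIV"
  then have [measurable]: "Z (fst k) \<in> borel_measurable N" using Z by auto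
  show "(\<lambda>x. h (cos (Z (fst k) x $ snd k / R))) \<in> borel_measurable N" by measurable
qed

lemma (in prob_space) integral_diff_le:
  fixes f g :: "'a \<Rightarrow> real"
  assumes meas: "f \<in> borel_measurable M" "g \<in> borel_measurable M"
    and bounds: "\<And>x. \<bar>f x\<bar> \<le> B" "\<And>x. \<bar>g x\<bar> \<le> B" and diff: "\<And>x. \<bar>f x - g x\<bar> \<le> c"
  shows "\<bar>(\<integral>x. f x \<partial>M) - (\<integral>x. g x \<partial>M)\<bar> \<le> c"
proof -
  have int: "integrable M f" "integrable M g"
    using meas bounds by (auto intro!: integrable_const_bound[where B = B])
  then have "\<bar>(\<integral>x. f x \<partial>M) - (\<integral>x. g x \<partial>M)\<bar> = \<bar>\<integral>x. f x - g x \<partial>M\<bar>" by simp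
  also have "\<dots> \<le> (\<integral>x. \<bar>f x - g x\<bar> \<partial>M)" by (rule integral_abs_bound)
  also have "\<dots> \<le> (\<integral>x. c \<partial>M)" using int diff by (intro integral_mono) auto
  finally show ?thesis by (simp add: prob_space)
qed

lemma (in prob_space) prob_le_integral:
  fixes f :: "'a \<Rightarrow> real"
  assumes f: "f \<in> borel_measurable M" "\<And>x. 0 \<le> f x" "\<And>x. f x \<le> 1"
    and A: "A \<in> events" and one: "\<And>x. x \<in> A \<Longrightarrow> f x = 1"
  shows "prob A \<le> (\<integral>x. f x \<partial>M)"
proof -
  have "prob A = (\<integral>x. indicator A x \<partial>M)" using A by simp
  also have "\<dots> \<le> (\<integral>x. f x \<partial>M)"
    using f A one by (intro integral_mono integrable_const_bound[where B = 1]) (auto simp: indicator_def)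
  finally show ?thesis .
qed

lemma (in prob_space) integral_le_prob_add:
  fixes f :: "'a \<Rightarrow> real"
  assumes f: "f \<in> borel_measurable M" "\<And>x. 0 \<le> f x" "\<And>x. f x \<le> 1"
    and AB: "A \<in> events" "B \<in> events" and zero: "\<And>x. x \<in> space M \<Longrightarrow> x \<notin> B \<Longrightarrow> f x \<noteq> 0 \<Longrightarrow> x \<in> A"
  shows "(\<integral>x. f x \<partial>M) \<le> prob A + prob B"
proof -
  have "f x \<le> indicator (A \<union> B) x" if "x \<in> space M" for x
    using zero[OF that] f(3)[of x] by (cases "f x = 0") (auto simp: indicator_def)
  then have "(\<integral>x. f x \<partial>M) \<le> (\<integral>x. indicator (A \<union> B) x \<partial>M)"
    using f AB by (intro integral_mono integrable_const_bound[where B = 1]) auto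
  also have "\<dots> = prob (A \<union> B)" using AB by simp
  also have "\<dots> \<le> prob A + prob B" using AB by (rule measure_Un_le)
  finally show ?thesis .
qed

text \<open>
  Finite families of random vectors \<open>Yn n\<close>, indexed by \<open>J\<close>, whose joint characteristic functions
  converge to that of \<open>Y\<close>.  The limit lives on a probability space of its own.
\<close>

locale converging_char_functions = M: prob_space M + P: prob_space P
  for M :: "'a measure" and P :: "'b measure" +
  fixes J :: "nat set" and Yn :: "nat \<Rightarrow> nat \<Rightarrow> 'a \<Rightarrow> real ^ 'n" and Y :: "nat \<Rightarrow> 'b \<Rightarrow> real ^ 'n"
  assumes J: "finite J"
    and Yn_meas[measurable]: "\<And>n j. j \<in> J \<Longrightarrow> Yn n j \<in> borel_measurable M"
    and Y_meas[measurable]: "\<And>j. j \<in> J \<Longrightarrow> Y j \<in> borel_measurable P"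
    and char_tendsto: "\<And>\<theta>. (\<lambda>n. \<integral>x. iexp (\<Sum>j\<in>J. \<theta> j \<bullet> Yn n j x) \<partial>M)
      \<longlonglongrightarrow> (\<integral>x. iexp (\<Sum>j\<in>J. \<theta> j \<bullet> Y j x) \<partial>P)"
begin

lemma trig_sum_tendsto:
  assumes "trig_sum J f"
  shows "(\<forall>n. integrable M (\<lambda>x. f (\<lambda>j. Yn n j x))) \<and> integrable P (\<lambda>x. f (\<lambda>j. Y j x)) \<and>
    (\<lambda>n. \<integral>x. f (\<lambda>j. Yn n j x) \<partial>M) \<longlonglongrightarrow> (\<integral>x. f (\<lambda>j. Y j x) \<partial>P)"
  using assms
proof induction
  case (monomial \<theta>)
  have [measurable]: "(\<lambda>x. \<Sum>j\<in>J. \<theta> j \<bullet> Yn n j x) \<in> borel_measurable M" for n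
    by (intro borel_measurable_sum borel_measurable_inner) auto
  have [measurable]: "(\<lambda>x. \<Sum>j\<in>J. \<theta> j \<bullet> Y j x) \<in> borel_measurable P"
    by (intro borel_measurable_sum borel_measurable_inner) auto
  show ?case
    using char_tendsto[of \<theta>] by (auto intro!: M.integrable_iexp P.integrable_iexp)
next
  case (add f g)
  then show ?case by (auto intro!: tendsto_add)
next
  case (scale f c)
  then show ?case by (auto intro!: tendsto_mult)
qed

lemma cos_polynomial_tendsto:
  fixes q :: "real \<Rightarrow> real"
  assumes "real_polynomial_function q"
  shows "(\<lambda>n. \<integral>x. (\<Prod>(j, i)\<in>J \<times> UNIV. q (cos (Yn n j x $ i / R))) \<partial>M)
    \<longlonglongrightarrow> (\<integral>x. (\<Prod>(j, i)\<in>J \<times> UNIV. q (cos (Y j x $ i / R))) \<partial>P)"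
proof -
  obtain c d where q: "q = (\<lambda>u. \<Sum>k\<le>d. c k * u ^ k)"
    using assms real_polynomial_function_iff_sum by blast
  have "trig_sum J (\<lambda>y :: nat \<Rightarrow> real ^ 'n. \<Prod>(j, i)\<in>J \<times> UNIV.
      (\<Sum>k\<le>d. complex_of_real (c k) * complex_of_real (cos (y j $ i / R)) ^ k))"
    by (intro trig_sum_prod) (auto intro!: trig_sum_sum trig_sum.scale trig_sum_power trig_sum_cos J)
  also have "(\<lambda>y :: nat \<Rightarrow> real ^ 'n. \<Prod>(j, i)\<in>J \<times> UNIV.
      (\<Sum>k\<le>d. complex_of_real (c k) * complex_of_real (cos (y j $ i / R)) ^ k)) =
      (\<lambda>y. complex_of_real (\<Prod>(j, i)\<in>J \<times> UNIV. q (cos (y j $ i / R))))"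
    by (simp add: q case_prod_unfold)
  finally have "(\<lambda>n. \<integral>x. complex_of_real (\<Prod>(j, i)\<in>J \<times> UNIV. q (cos (Yn n j x $ i / R))) \<partial>M)
    \<longlonglongrightarrow> (\<integral>x. complex_of_real (\<Prod>(j, i)\<in>J \<times> UNIV. q (cos (Y j x $ i / R))) \<partial>P)"
    using trig_sum_tendsto by blast
  then show ?thesis by (simp only: integral_complex_of_real tendsto_of_real_iff)
qed

text \<open>
  Uniform approximation of \<open>h\<close> on \<open>{-1..1}\<close> by polynomials reduces this to the preceding lemma.
\<close>

lemma cos_continuous_tendsto:
  fixes h :: "real \<Rightarrow> real"
  assumes h: "continuous_on UNIV h" and h01: "\<And>u. h u \<in> {0..1}"
  shows "(\<lambda>n. \<integral>x. (\<Prod>(j, i)\<in>J \<times> UNIV. h (cos (Yn n j x $ i / R))) \<partial>M)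
    \<longlonglongrightarrow> (\<integral>x. (\<Prod>(j, i)\<in>J \<times> UNIV. h (cos (Y j x $ i / R))) \<partial>P)"
proof (rule LIMSEQ_I)
  fix e :: real assume e: "0 < e"
  define m where "m = real (card (J \<times> (UNIV :: 'n set)))"
  define \<delta> where "\<delta> = min 1 (e / (6 * (m + 1)))"
  have m: "0 \<le> m" unfolding m_def by simp
  then have \<delta>: "0 < \<delta>" "\<delta> \<le> 1" "\<delta> \<le> e / (6 * (m + 1))"
    using e unfolding \<delta>_def by auto
  have "m * (2 * \<delta>) \<le> m * (2 * (e / (6 * (m + 1))))"
    using m \<delta>(3) by (intro mult_left_mono) auto
  also have "m * (2 * (e / (6 * (m + 1)))) < e / 3" using m e by (simp add: field_simps)
  finally have small: "m * (2 * \<delta>) < e / 3" .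
  have [measurable]: "h \<in> borel_measurable borel" using h by (rule borel_measurable_continuous_onI)
  \<comment> \<open>Approximating \<open>(1 - \<delta>) * h\<close> instead of \<open>h\<close> keeps the polynomial bounded by \<open>1\<close>, as required by \<open>norm_prod_diff\<close>.\<close>
  have "continuous_on {-1..1} (\<lambda>u. (1 - \<delta>) * h u)"
    by (intro continuous_intros continuous_on_subset[OF h]) auto
  then obtain q where q: "real_polynomial_function q" "\<And>u. u \<in> {-1..1} \<Longrightarrow> \<bar>(1 - \<delta>) * h u - q u\<bar> < \<delta>"
    using Stone_Weierstrass_real_polynomial_function[of "{-1..1}" "\<lambda>u. (1 - \<delta>) * h u" \<delta>] \<delta> by auto
  have q_cont: "continuous_on UNIV q"
    using q(1) continuous_on_polymonial_function real_polynomial_function_eq by blast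
  then have [measurable]: "q \<in> borel_measurable borel" by (rule borel_measurable_continuous_onI)
  define H where "H g y = (\<Prod>(j, i)\<in>J \<times> UNIV. g (cos (y j $ i / R)))" for g :: "real \<Rightarrow> real" and y :: "nat \<Rightarrow> real ^ 'n"
  have q1: "\<bar>q u\<bar> \<le> 1" and hq: "\<bar>h u - q u\<bar> \<le> 2 * \<delta>" if u: "u \<in> {-1..1}" for u
  proof -
    have b: "0 \<le> \<delta> * h u" "\<delta> * h u \<le> \<delta>" "0 \<le> h u" "h u \<le> 1"
      using h01[of u] \<delta> by (auto simp: mult_left_le)
    have c: "0 \<le> (1 - \<delta>) * h u" "(1 - \<delta>) * h u \<le> (1 - \<delta>) * 1"
      using b \<delta> by (intro mult_nonneg_nonneg mult_left_mono; simp)+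
    show "\<bar>q u\<bar> \<le> 1" using q(2)[OF u] c \<delta> by (simp add: abs_le_iff abs_less_iff)
    have "h u - q u = ((1 - \<delta>) * h u - q u) + \<delta> * h u" by (simp add: algebra_simps)
    then show "\<bar>h u - q u\<bar> \<le> 2 * \<delta>" using q(2)[OF u] b by linarith
  qed
  have H_diff: "\<bar>H h y - H q y\<bar> \<le> m * (2 * \<delta>)" for y
  proof -
    have "\<bar>H h y - H q y\<bar> \<le> (\<Sum>(j, i)\<in>J \<times> UNIV. \<bar>h (cos (y j $ i / R)) - q (cos (y j $ i / R))\<bar>)"
      unfolding H_def using norm_prod_diff[of "J \<times> UNIV" "\<lambda>(j, i). h (cos (y j $ i / R))" "\<lambda>(j, i). q (cos (y j $ i / R))"]
        h01 q1 by (auto simp: case_prod_unfold)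
    also have "\<dots> \<le> (\<Sum>(j, i)\<in>J \<times> (UNIV :: 'n set). 2 * \<delta>)"
      using hq by (intro sum_mono) auto
    finally show ?thesis unfolding m_def by (simp add: case_prod_unfold)
  qed
  have H_bound: "\<bar>H g y\<bar> \<le> 1" if "\<And>u. u \<in> {-1..1} \<Longrightarrow> \<bar>g u\<bar> \<le> 1" for g y
    unfolding H_def abs_prod using that by (intro prod_le_1) auto
  have h1: "\<bar>h u\<bar> \<le> 1" for u using h01[of u] by auto
  have [measurable]: "(\<lambda>x. H g (\<lambda>j. Yn n j x)) \<in> borel_measurable M" "(\<lambda>x. H g (\<lambda>j. Y j x)) \<in> borel_measurable P"
    if "g \<in> borel_measurable borel" for g n
    unfolding H_def using that Yn_meas Y_meas by (auto intro!: prod_cos_measurable)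
  have diff_M: "\<bar>(\<integral>x. H h (\<lambda>j. Yn n j x) \<partial>M) - (\<integral>x. H q (\<lambda>j. Yn n j x) \<partial>M)\<bar> \<le> m * (2 * \<delta>)" for n
    by (intro M.integral_diff_le[where B = 1] H_diff H_bound h1 q1) auto
  have diff_P: "\<bar>(\<integral>x. H h (\<lambda>j. Y j x) \<partial>P) - (\<integral>x. H q (\<lambda>j. Y j x) \<partial>P)\<bar> \<le> m * (2 * \<delta>)"
    by (intro P.integral_diff_le[where B = 1] H_diff H_bound h1 q1) auto
  have "(\<lambda>n. \<integral>x. H q (\<lambda>j. Yn n j x) \<partial>M) \<longlonglongrightarrow> (\<integral>x. H q (\<lambda>j. Y j x) \<partial>P)"
    unfolding H_def by (rule cos_polynomial_tendsto[OF q(1)])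
  then obtain no where no: "\<And>n. no \<le> n \<Longrightarrow> \<bar>(\<integral>x. H q (\<lambda>j. Yn n j x) \<partial>M) - (\<integral>x. H q (\<lambda>j. Y j x) \<partial>P)\<bar> < e / 3"
    using LIMSEQ_D[of _ _ "e / 3"] e by (metis real_norm_def zero_less_divide_iff zero_less_numeral)
  have "norm ((\<integral>x. H h (\<lambda>j. Yn n j x) \<partial>M) - (\<integral>x. H h (\<lambda>j. Y j x) \<partial>P)) < e" if "no \<le> n" for n
    using no[OF that] diff_M[of n] diff_P small unfolding real_norm_def by linarith
  then show "\<exists>no. \<forall>n\<ge>no. norm ((\<integral>x. (\<Prod>(j, i)\<in>J \<times> UNIV. h (cos (Yn n j x $ i / R))) \<partial>M) -
        (\<integral>x. (\<Prod>(j, i)\<in>J \<times> UNIV. h (cos (Y j x $ i / R))) \<partial>P)) < e"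
    unfolding H_def by blast
qed

text \<open>
  A continuous \<open>h\<close> with \<open>h (cos (v / K)) = 1\<close> for \<open>\<bar>v\<bar> \<le> a\<close> and \<open>h (cos (v / K)) = 0\<close> for
  \<open>b \<le> \<bar>v\<bar> \<le> K\<close> exists because \<open>cos\<close> is strictly decreasing on \<open>{0..pi}\<close>.  The periodic function
  \<open>v \<mapsto> h (cos (v / K))\<close> is a substitute for the indicator of an interval up to the tail event beyond
  \<open>K\<close>, which is where tightness enters.  The gap between \<open>a\<close> and \<open>b\<close> absorbs atoms of the limit.
\<close>

lemma box_prob_sandwich:
  assumes ab: "0 \<le> a" "a < b" and \<delta>: "0 < \<delta>"
    and tight: "\<And>d. 0 < d \<Longrightarrow> \<exists>K. \<forall>\<^sub>F n in sequentially. M.prob {x\<in>space M. \<exists>j\<in>J. K < infnorm (Yn n j x)} \<le> d"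
  shows "\<forall>\<^sub>F n in sequentially.
      M.prob {x\<in>space M. \<forall>j\<in>J. infnorm (Yn n j x) \<le> a} \<le> P.prob {x\<in>space P. \<forall>j\<in>J. infnorm (Y j x) \<le> b} + \<delta>"
    and "\<forall>\<^sub>F n in sequentially.
      P.prob {x\<in>space P. \<forall>j\<in>J. infnorm (Y j x) \<le> a} - \<delta> \<le> M.prob {x\<in>space M. \<forall>j\<in>J. infnorm (Yn n j x) \<le> b}"
proof -
  obtain K1 where K1: "\<forall>\<^sub>F n in sequentially. M.prob {x\<in>space M. \<exists>j\<in>J. K1 < infnorm (Yn n j x)} \<le> \<delta> / 2"
    using tight[of "\<delta> / 2"] \<delta> by auto
  obtain K2 where K2: "P.prob {x\<in>space P. \<exists>j\<in>J. K2 < infnorm (Y j x)} \<le> \<delta> / 2"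
  proof -
    let ?T = "\<lambda>k :: nat. {x\<in>space P. \<exists>j\<in>J. real k < infnorm (Y j x)}"
    have "(\<lambda>k. P.prob (?T k)) \<longlonglongrightarrow> P.prob (\<Inter>k. ?T k)"
    proof (rule P.finite_Lim_measure_decseq)
      show "range ?T \<subseteq> P.events" using J by (auto intro!: sets.sets_Collect_finite_Ex)
      show "decseq ?T" by (auto simp: decseq_def intro!: bexI intro: order_le_less_trans[rotated])
    qed
    moreover have "(\<Inter>k. ?T k) = {}"
    proof -
      have "x \<notin> (\<Inter>k. ?T k)" for x
      proof
        assume x: "x \<in> (\<Inter>k. ?T k)"
        obtain k where k: "(\<Sum>j\<in>J. infnorm (Y j x)) \<le> real k" using real_arch_simple by blast
        obtain j where j: "j \<in> J" "real k < infnorm (Y j x)" using x by blast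
        have "infnorm (Y j x) \<le> (\<Sum>j\<in>J. infnorm (Y j x))"
          using j J by (intro member_le_sum) (auto simp: infnorm_pos_le)
        then show False using j k by linarith
      qed
      then show ?thesis by blast
    qed
    ultimately have "(\<lambda>k. P.prob (?T k)) \<longlonglongrightarrow> 0" by simp
    then have "\<forall>\<^sub>F k in sequentially. P.prob (?T k) < \<delta> / 2" using \<delta> by (intro order_tendstoD) auto
    then obtain k where "P.prob (?T k) < \<delta> / 2" by (meson eventually_sequentially order_refl)
    then show ?thesis using that[of "real k"] by simp
  qed
  define K where "K = max b (max K1 K2)"
  have K: "b \<le> K" "K1 \<le> K" "K2 \<le> K" "0 < K" unfolding K_def using ab by auto
  define c0 c1 where "c0 = cos (a / K)" and "c1 = cos (b / K)"
  have "b / K \<le> 1" using K by simp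
  then have pi: "b / K \<le> pi" using pi_gt3 by linarith
  have c: "c1 < c0"
    unfolding c0_def c1_def using ab K pi by (intro cos_monotone_0_pi) (auto simp: divide_simps)
  define h where "h u = min 1 (max 0 ((u - c1) / (c0 - c1)))" for u
  have h_cont: "continuous_on UNIV h" unfolding h_def using c by (intro continuous_intros) auto
  have h01: "h u \<in> {0..1}" for u unfolding h_def by auto
  have h_in: "h (cos (v / K)) = 1" if v: "\<bar>v\<bar> \<le> a" for v
  proof -
    have "c0 \<le> cos (\<bar>v\<bar> / K)"
      unfolding c0_def using v ab K pi by (intro cos_monotone_0_pi_le) (auto simp: divide_simps)
    moreover have "cos (\<bar>v\<bar> / K) = cos (v / K)" by (cases "0 \<le> v") auto
    ultimately show ?thesis using c unfolding h_def by (simp add: divide_simps)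
  qed
  have h_out: "h (cos (v / K)) = 0" if v: "b \<le> \<bar>v\<bar>" "\<bar>v\<bar> \<le> K" for v
  proof -
    have "\<bar>v\<bar> / K \<le> 1" using v K by simp
    then have "\<bar>v\<bar> / K \<le> pi" using pi_gt3 by linarith
    then have "cos (\<bar>v\<bar> / K) \<le> c1"
      unfolding c1_def using v ab K by (intro cos_monotone_0_pi_le) (auto simp: divide_right_mono)
    moreover have "cos (\<bar>v\<bar> / K) = cos (v / K)" by (cases "0 \<le> v") auto
    ultimately show ?thesis using c unfolding h_def by (simp add: divide_simps)
  qed
  define H where "H y = (\<Prod>(j, i)\<in>J \<times> UNIV. h (cos (y j $ i / K)))" for y :: "nat \<Rightarrow> real ^ 'n"
  have H01: "0 \<le> H y" "H y \<le> 1" for y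
    unfolding H_def using h01 by (auto intro!: prod_nonneg prod_le_1)
  have H_in: "H y = 1" if "\<forall>j\<in>J. infnorm (y j) \<le> a" for y
    unfolding H_def using that h_in by (intro prod.neutral) (auto simp: infnorm_le_iff_components)
  have H_out: "\<forall>j\<in>J. infnorm (y j) \<le> b" if y: "H y \<noteq> 0" "\<forall>j\<in>J. infnorm (y j) \<le> K" for y
  proof (rule ballI, rule ccontr)
    fix j assume j: "j \<in> J" "\<not> infnorm (y j) \<le> b"
    then obtain i where i: "b \<le> \<bar>y j $ i\<bar>" by (metis infnorm_le_iff_components linorder_le_cases)
    have "\<bar>y j $ i\<bar> \<le> K" using y(2) j by (auto simp: infnorm_le_iff_components)
    then have "h (cos (y j $ i / K)) = 0" using h_out i by blast
    then have "H y = 0" unfolding H_def using j(1) J by (auto intro!: prod_zero bexI[of _ "(j, i)"])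
    then show False using y(1) by simp
  qed
  have [measurable]: "h \<in> borel_measurable borel" using h_cont by (rule borel_measurable_continuous_onI)
  have H_meas: "(\<lambda>x. H (\<lambda>j. Yn n j x)) \<in> borel_measurable M" "(\<lambda>x. H (\<lambda>j. Y j x)) \<in> borel_measurable P" for n
    unfolding H_def using Yn_meas Y_meas by (auto intro!: prod_cos_measurable)
  have lim: "(\<lambda>n. \<integral>x. H (\<lambda>j. Yn n j x) \<partial>M) \<longlonglongrightarrow> (\<integral>x. H (\<lambda>j. Y j x) \<partial>P)"
    unfolding H_def by (rule cos_continuous_tendsto[OF h_cont h01])
  have J_events: "{x\<in>space M. \<forall>j\<in>J. infnorm (Yn n j x) \<le> r} \<in> M.events" "{x\<in>space M. \<exists>j\<in>J. r < infnorm (Yn n j x)} \<in> M.events"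
     "{x\<in>space P. \<forall>j\<in>J. infnorm (Y j x) \<le> r} \<in> P.events" "{x\<in>space P. \<exists>j\<in>J. r < infnorm (Y j x)} \<in> P.events" for n r
    using J by (auto intro!: sets.sets_Collect_finite_Ex sets.sets_Collect_finite_All)
  have lower_M: "M.prob {x\<in>space M. \<forall>j\<in>J. infnorm (Yn n j x) \<le> a} \<le> (\<integral>x. H (\<lambda>j. Yn n j x) \<partial>M)" for n
    using J_events H_meas H01 H_in by (intro M.prob_le_integral) auto
  have lower_P: "P.prob {x\<in>space P. \<forall>j\<in>J. infnorm (Y j x) \<le> a} \<le> (\<integral>x. H (\<lambda>j. Y j x) \<partial>P)"
    using J_events H_meas H01 H_in by (intro P.prob_le_integral) auto
  have upper_M: "(\<integral>x. H (\<lambda>j. Yn n j x) \<partial>M) \<le> M.prob {x\<in>space M. \<forall>j\<in>J. infnorm (Yn n j x) \<le> b}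
      + M.prob {x\<in>space M. \<exists>j\<in>J. K < infnorm (Yn n j x)}" for n
  proof (rule M.integral_le_prob_add[OF H_meas(1) H01 J_events(1,2)])
    fix x assume "x \<in> space M" "x \<notin> {x\<in>space M. \<exists>j\<in>J. K < infnorm (Yn n j x)}" "H (\<lambda>j. Yn n j x) \<noteq> 0"
    then show "x \<in> {x\<in>space M. \<forall>j\<in>J. infnorm (Yn n j x) \<le> b}"
      using H_out[of "\<lambda>j. Yn n j x"] by (simp add: not_less)
  qed
  have upper_P: "(\<integral>x. H (\<lambda>j. Y j x) \<partial>P) \<le> P.prob {x\<in>space P. \<forall>j\<in>J. infnorm (Y j x) \<le> b}
      + P.prob {x\<in>space P. \<exists>j\<in>J. K < infnorm (Y j x)}"
  proof (rule P.integral_le_prob_add[OF H_meas(2) H01 J_events(3,4)])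
    fix x assume "x \<in> space P" "x \<notin> {x\<in>space P. \<exists>j\<in>J. K < infnorm (Y j x)}" "H (\<lambda>j. Y j x) \<noteq> 0"
    then show "x \<in> {x\<in>space P. \<forall>j\<in>J. infnorm (Y j x) \<le> b}"
      using H_out[of "\<lambda>j. Y j x"] by (simp add: not_less)
  qed
  have tail_P: "P.prob {x\<in>space P. \<exists>j\<in>J. K < infnorm (Y j x)} \<le> \<delta> / 2"
    by (rule order_trans[OF P.finite_measure_mono K2]) (use J_events K in \<open>auto intro: order_le_less_trans\<close>)
  have tail_M: "\<forall>\<^sub>F n in sequentially. M.prob {x\<in>space M. \<exists>j\<in>J. K < infnorm (Yn n j x)} \<le> \<delta> / 2"
    using K1
  proof eventually_elim
    case (elim n)
    show ?case
      by (rule order_trans[OF M.finite_measure_mono elim]) (use J_events K in \<open>auto intro: order_le_less_trans\<close>)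
  qed
  have "\<forall>\<^sub>F n in sequentially. \<bar>(\<integral>x. H (\<lambda>j. Yn n j x) \<partial>M) - (\<integral>x. H (\<lambda>j. Y j x) \<partial>P)\<bar> < \<delta> / 2"
    using tendstoD[OF lim, of "\<delta> / 2"] \<delta> by (simp add: dist_real_def)
  note close = this
  show "\<forall>\<^sub>F n in sequentially.
      M.prob {x\<in>space M. \<forall>j\<in>J. infnorm (Yn n j x) \<le> a} \<le> P.prob {x\<in>space P. \<forall>j\<in>J. infnorm (Y j x) \<le> b} + \<delta>"
    using close
  proof eventually_elim
    case (elim n)
    then show ?case using lower_M[of n] upper_P tail_P by linarith
  qed
  show "\<forall>\<^sub>F n in sequentially.
      P.prob {x\<in>space P. \<forall>j\<in>J. infnorm (Y j x) \<le> a} - \<delta> \<le> M.prob {x\<in>space M. \<forall>j\<in>J. infnorm (Yn n j x) \<le> b}"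
    using close tail_M
  proof eventually_elim
    case (elim n)
    then show ?case using lower_P upper_M[of n] by linarith
  qed
qed

end

section \<open>The simple random walk\<close>

context simple_random_walk
begin

lemma step_measurable [measurable]: "1 \<le> s \<Longrightarrow> \<omega> s \<in> borel_measurable M"
  using indep_steps unfolding indep_vars_def by auto

text \<open>
  The support of the law of a step.  It is finite, so that expectations of functions of a step are
  finite sums.
\<close>

definition steps :: "(real ^ 'n) set" where
  "steps = range (\<lambda>i. axis i 1) \<union> range (\<lambda>i. - axis i 1)"

lemma sum_steps:
  fixes f :: "real ^ 'n \<Rightarrow> 'c :: comm_monoid_add"
  shows "sum f steps = (\<Sum>i\<in>UNIV. f (axis i 1)) + (\<Sum>i\<in>UNIV. f (- axis i 1))"
proof -
  have inj: "inj (\<lambda>i. axis i (1 :: real) :: real ^ 'n)" "inj (\<lambda>i. - axis i (1 :: real) :: real ^ 'n)"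
    by (auto simp: inj_def axis_eq_axis)
  have "axis i (1 :: real) \<noteq> - axis j 1" for i j :: 'n
  proof
    assume "axis i (1 :: real) = - axis j 1"
    then have "axis i (1 :: real) $ i = (- axis j 1) $ i" by simp
    then show False by (simp add: axis_def split: if_splits)
  qed
  then have disj: "range (\<lambda>i. axis i (1 :: real) :: real ^ 'n) \<inter> range (\<lambda>i. - axis i (1 :: real)) = {}"
    by auto
  show ?thesis
    unfolding steps_def by (simp add: sum.union_disjoint[OF _ _ disj] sum.reindex[OF inj(1)] sum.reindex[OF inj(2)])
qed

lemma finite_steps: "finite steps"
  unfolding steps_def by simp

lemma prob_step: "1 \<le> s \<Longrightarrow> a \<in> steps \<Longrightarrow> prob {x\<in>space M. \<omega> s x = a} = 1 / (2 * real CARD('n))"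
  using step_pos step_neg unfolding steps_def by auto

lemma AE_step:
  assumes s: "1 \<le> s"
  shows "AE x in M. \<omega> s x \<in> steps"
proof -
  note [measurable] = step_measurable[OF s]
  have "prob {x\<in>space M. \<omega> s x \<in> steps} = prob (\<Union>a\<in>steps. {x\<in>space M. \<omega> s x = a})"
    by (rule arg_cong[where f = prob]) auto
  also have "\<dots> = (\<Sum>a\<in>steps. prob {x\<in>space M. \<omega> s x = a})"
    by (rule finite_measure_finite_Union) (auto simp: finite_steps disjoint_family_on_def)
  also have "\<dots> = (\<Sum>a\<in>steps. 1 / (2 * real CARD('n)))"
    using prob_step[OF s] by simp
  also have "\<dots> = 1" unfolding sum_steps by (simp add: field_simps)
  finally have one: "prob {x\<in>space M. \<omega> s x \<in> steps} = 1" .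
  have [measurable]: "steps \<in> sets borel"
    using finite_steps by (intro borel_closed finite_imp_closed)
  have "{x\<in>space M. \<omega> s x \<in> steps} \<in> events"
    by measurable
  then have "AE x in M. x \<in> {x\<in>space M. \<omega> s x \<in> steps}"
    using one AE_in_set_eq_1 by blast
  then show ?thesis by eventually_elim simp
qed

lemma expectation_step:
  fixes g :: "real ^ 'n \<Rightarrow> 'c :: {banach, second_countable_topology}"
  assumes s: "1 \<le> s" and [measurable]: "g \<in> borel_measurable borel"
  shows "(\<integral>x. g (\<omega> s x) \<partial>M) =
    (1 / (2 * real CARD('n))) *\<^sub>R ((\<Sum>i\<in>UNIV. g (axis i 1)) + (\<Sum>i\<in>UNIV. g (- axis i 1)))"
proof -
  note [measurable] = step_measurable[OF s]
  have "(\<integral>x. g (\<omega> s x) \<partial>M) = (\<integral>x. (\<Sum>a\<in>steps. indicator {x\<in>space M. \<omega> s x = a} x *\<^sub>R g a) \<partial>M)"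
  proof (rule integral_cong_AE)
    show "AE x in M. g (\<omega> s x) = (\<Sum>a\<in>steps. indicator {x\<in>space M. \<omega> s x = a} x *\<^sub>R g a)"
      using AE_step[OF s] AE_space
    proof eventually_elim
      case (elim x)
      have "(\<Sum>a\<in>steps. indicator {x\<in>space M. \<omega> s x = a} x *\<^sub>R g a) = (\<Sum>a\<in>steps. if a = \<omega> s x then g a else 0)"
        using elim by (intro sum.cong) auto
      then show ?case using elim finite_steps by simp
    qed
  qed measurable
  also have "\<dots> = (\<Sum>a\<in>steps. \<integral>x. indicator {x\<in>space M. \<omega> s x = a} x *\<^sub>R g a \<partial>M)"
    by (rule Bochner_Integration.integral_sum) (auto simp: emeasure_eq_measure intro!: integrable_scaleR_left integrable_real_indicator)
  also have "\<dots> = (\<Sum>a\<in>steps. (1 / (2 * real CARD('n))) *\<^sub>R g a)"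
  proof (rule sum.cong)
    fix a assume "a \<in> steps"
    have "(\<integral>x. indicator {x\<in>space M. \<omega> s x = a} x *\<^sub>R g a \<partial>M) = (\<integral>x. indicator {x\<in>space M. \<omega> s x = a} x \<partial>M) *\<^sub>R g a"
      by (rule integral_scaleR_left) (auto simp: emeasure_eq_measure intro!: integrable_real_indicator)
    also have "(\<integral>x. indicator {x\<in>space M. \<omega> s x = a} x \<partial>M) = prob {x\<in>space M. \<omega> s x = a}"
      by simp
    finally show "(\<integral>x. indicator {x\<in>space M. \<omega> s x = a} x *\<^sub>R g a \<partial>M) = (1 / (2 * real CARD('n))) *\<^sub>R g a"
      by (simp only: prob_step[OF s \<open>a \<in> steps\<close>])
  qed simp
  finally show ?thesis by (simp add: sum_steps scaleR_sum_right scaleR_add_right)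
qed

lemma AE_step_component:
  assumes "1 \<le> s"
  shows "AE x in M. \<bar>\<omega> s x $ i\<bar> \<le> 1"
  using AE_step[OF assms] by eventually_elim (auto simp: steps_def axis_def)

lemma expectation_step_component: "1 \<le> s \<Longrightarrow> expectation (\<lambda>x. \<omega> s x $ i) = 0"
  by (subst expectation_step) (auto simp: sum_negf)

lemma char_step:
  assumes s: "1 \<le> s"
  shows "(\<integral>x. iexp (\<theta> \<bullet> \<omega> s x) \<partial>M) = complex_of_real ((\<Sum>i\<in>UNIV. cos (\<theta> $ i)) / real CARD('n))"
proof -
  have "(\<integral>x. iexp (\<theta> \<bullet> \<omega> s x) \<partial>M) =
    (1 / (2 * real CARD('n))) *\<^sub>R ((\<Sum>i\<in>UNIV. iexp (\<theta> \<bullet> axis i 1)) + (\<Sum>i\<in>UNIV. iexp (\<theta> \<bullet> (- axis i 1))))"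
    by (rule expectation_step[OF s]) measurable
  also have "\<dots> = (1 / (2 * real CARD('n))) *\<^sub>R (\<Sum>i\<in>UNIV. iexp (\<theta> $ i) + iexp (- \<theta> $ i))"
    by (simp add: inner_axis sum.distrib)
  also have "(\<lambda>i. iexp (\<theta> $ i) + iexp (- \<theta> $ i)) = (\<lambda>i. 2 * complex_of_real (cos (\<theta> $ i)))"
    by (simp add: fun_eq_iff cos_of_real[symmetric] cos_exp_eq)
  finally show ?thesis
    by (simp add: sum_distrib_left[symmetric] scaleR_conv_of_real field_simps)
qed

lemma walk_measurable [measurable]: "walk \<omega> t \<in> borel_measurable M"
  unfolding walk_def by (intro borel_measurable_sum) auto

lemma walk_diff: "k \<le> l \<Longrightarrow> walk \<omega> l x - walk \<omega> k x = (\<Sum>s\<in>{k<..l}. \<omega> s x)"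
proof -
  assume "k \<le> l"
  then have *: "{1..l} = {1..k} \<union> {k<..l}" by auto
  have "(\<Sum>s\<in>{1..l}. \<omega> s x) = (\<Sum>s\<in>{1..k}. \<omega> s x) + (\<Sum>s\<in>{k<..l}. \<omega> s x)"
    unfolding * by (rule sum.union_disjoint) auto
  then show ?thesis unfolding walk_def by simp
qed

lemma indep_step_components: "indep_vars (\<lambda>_. borel) (\<lambda>s x. \<omega> s x $ i) {k<..l}"
  by (rule indep_vars_compose2[OF indep_vars_subset[OF indep_steps]]) auto

text \<open>
  The maximal Hoeffding bound for each coordinate, and a union bound over the coordinates.
\<close>

lemma walk_max_increment_tail:
  assumes "k \<le> l" "l \<le> k + L" "0 < a"
  shows "prob {x\<in>space M. \<exists>j\<in>{k<..l}. 2 * a < infnorm (walk \<omega> j x - walk \<omega> k x)} \<le> 4 * real CARD('n) * exp (- (a\<^sup>2 / (2 * real L)))"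
proof -
  let ?E = "\<lambda>i. {x\<in>space M. \<exists>j\<in>{k<..l}. 2 * a \<le> \<bar>\<Sum>s\<in>{k<..j}. \<omega> s x $ i\<bar>}"
  have E_events: "?E i \<in> events" for i
  proof (intro sets.sets_Collect_finite_Ex)
    fix j assume "j \<in> {k<..l}"
    have [measurable]: "(\<lambda>x. \<Sum>s\<in>{k<..j}. \<omega> s x $ i) \<in> borel_measurable M"
      by (intro borel_measurable_sum measurable_compose[OF step_measurable borel_measurable_component]) auto
    show "{x\<in>space M. 2 * a \<le> \<bar>\<Sum>s\<in>{k<..j}. \<omega> s x $ i\<bar>} \<in> events" by measurable
  qed simp
  have "prob {x\<in>space M. \<exists>j\<in>{k<..l}. 2 * a < infnorm (walk \<omega> j x - walk \<omega> k x)} \<le> prob (\<Union>i. ?E i)"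
  proof (rule finite_measure_mono)
    show "{x\<in>space M. \<exists>j\<in>{k<..l}. 2 * a < infnorm (walk \<omega> j x - walk \<omega> k x)} \<subseteq> (\<Union>i. ?E i)"
    proof safe
      fix x j assume x: "x \<in> space M" and j: "j \<in> {k<..l}" and big: "2 * a < infnorm (walk \<omega> j x - walk \<omega> k x)"
      then obtain i where "2 * a < \<bar>(walk \<omega> j x - walk \<omega> k x) $ i\<bar>"
        by (metis infnorm_le_iff_components linorder_not_le)
      then have "2 * a \<le> \<bar>\<Sum>s\<in>{k<..j}. \<omega> s x $ i\<bar>"
        using j by (simp add: walk_diff del: vector_minus_component)
      then show "x \<in> (\<Union>i. ?E i)" using x j by blast
    qed
  qed (use E_events in auto)
  also have "\<dots> \<le> (\<Sum>i\<in>UNIV. prob (?E i))"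
    using E_events by (intro measure_UNION_le) auto
  also have "\<dots> \<le> (\<Sum>i\<in>(UNIV :: 'n set). 4 * exp (- (a\<^sup>2 / (2 * real L))))"
    using assms by (intro sum_mono hoeffding_max_partial_sums[OF indep_step_components] AE_step_component expectation_step_component) auto
  finally show ?thesis by simp
qed

lemma walk_max_tail:
  assumes "0 < a" "1 \<le> t"
  shows "prob {x\<in>space M. \<exists>k\<in>{1..t}. a * sqrt (real t) < infnorm (walk \<omega> k x)} \<le> 4 * real CARD('n) * exp (- (a\<^sup>2 / 8))"
proof -
  have *: "walk \<omega> 0 x = 0" "{1..t} = {0<..t}" for x by (auto simp: walk_def)
  have "prob {x\<in>space M. \<exists>k\<in>{0<..t}. 2 * (a * sqrt (real t) / 2) < infnorm (walk \<omega> k x - walk \<omega> 0 x)}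
      \<le> 4 * real CARD('n) * exp (- ((a * sqrt (real t) / 2)\<^sup>2 / (2 * real t)))"
    using assms by (intro walk_max_increment_tail) auto
  also have "(a * sqrt (real t) / 2)\<^sup>2 / (2 * real t) = a\<^sup>2 / 8"
    using assms by (simp add: power_divide power_mult_distrib)
  finally show ?thesis unfolding *(2) by (simp add: *(1))
qed

text \<open>
  The right-hand side depends on \<open>k\<close> and \<open>l\<close> only through \<open>l - k\<close>; this is the form in which the
  stationarity of the increments is used below.
\<close>

lemma char_walk_increment:
  assumes "k \<le> l"
  shows "(\<integral>x. iexp (\<theta> \<bullet> (walk \<omega> l x - walk \<omega> k x)) \<partial>M) =
    complex_of_real (((\<Sum>i\<in>UNIV. cos (\<theta> $ i)) / real CARD('n)) ^ (l - k))"
proof -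
  have "indep_vars (\<lambda>_. borel) (\<lambda>s x. iexp (\<theta> \<bullet> \<omega> s x)) {k<..l}"
    by (rule indep_vars_compose2[OF indep_vars_subset[OF indep_steps]]) auto
  then have "(\<integral>x. (\<Prod>s\<in>{k<..l}. iexp (\<theta> \<bullet> \<omega> s x)) \<partial>M) = (\<Prod>s\<in>{k<..l}. \<integral>x. iexp (\<theta> \<bullet> \<omega> s x) \<partial>M)"
    by (intro indep_vars_lebesgue_integral integrable_iexp) auto
  also have "\<dots> = (\<Prod>s\<in>{k<..l}. complex_of_real ((\<Sum>i\<in>UNIV. cos (\<theta> $ i)) / real CARD('n)))"
    by (intro prod.cong char_step) auto
  also have "(\<lambda>x. \<Prod>s\<in>{k<..l}. iexp (\<theta> \<bullet> \<omega> s x)) = (\<lambda>x. iexp (\<theta> \<bullet> (walk \<omega> l x - walk \<omega> k x)))"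
    unfolding walk_diff[OF assms] by (simp add: exp_sum[symmetric] inner_sum_right sum_distrib_left[symmetric])
  finally show ?thesis by simp
qed

end

section \<open>Gaussian characteristic functions\<close>

text \<open>
  With \<open>u n\<close> the average of the cosines minus \<open>1\<close>, the product \<open>n * u n\<close> tends to
  \<open>- (\<theta> \<bullet> \<theta>) / (2 * CARD('n))\<close> since \<open>cos x - 1 = - 2 * (sin (x / 2))\<^sup>2\<close>.  The exponent \<open>k n\<close> is left
  general, because the blocks below have length \<open>n div m\<close> or a multiple of a square.
\<close>

lemma cos_average_power_tendsto:
  fixes \<theta> :: "real ^ 'n" and k :: "nat \<Rightarrow> nat"
  assumes k: "(\<lambda>n. real (k n) / real n) \<longlonglongrightarrow> h"
  shows "(\<lambda>n. ((\<Sum>i\<in>UNIV. cos (\<theta> $ i / sqrt (real n))) / real CARD('n)) ^ k n)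
    \<longlonglongrightarrow> exp (- (h * (\<theta> \<bullet> \<theta>) / (2 * real CARD('n))))"
proof -
  define N where "N = real CARD('n)"
  have N: "0 < N" unfolding N_def by simp
  define u where "u n = (\<Sum>i\<in>UNIV. cos (\<theta> $ i / sqrt (real n))) / N - 1" for n
  have inv: "filterlim (\<lambda>n. 1 / sqrt (real n)) (at 0) sequentially"
  proof (rule filterlim_atI)
    have "(\<lambda>n. inverse (sqrt (real n))) \<longlonglongrightarrow> 0"
      by (intro tendsto_inverse_0_at_top filterlim_compose[OF sqrt_at_top filterlim_real_sequentially])
    then show "(\<lambda>n. 1 / sqrt (real n)) \<longlonglongrightarrow> 0" by (simp add: inverse_eq_divide)
    show "\<forall>\<^sub>F n in sequentially. 1 / sqrt (real n) \<noteq> 0"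
      using eventually_gt_at_top[of 0] by eventually_elim auto
  qed
  have single: "(\<lambda>n. real n * (cos (c / sqrt (real n)) - 1)) \<longlonglongrightarrow> - (c\<^sup>2 / 2)" for c :: real
  proof -
    have "((\<lambda>y. sin (c / 2 * y)) has_real_derivative (cos (c / 2 * 0) * (c / 2))) (at 0)"
      by (auto intro!: derivative_eq_intros)
    then have "((\<lambda>y. sin (c / 2 * y) / y) \<longlongrightarrow> c / 2) (at 0)"
      by (simp add: DERIV_def)
    from filterlim_compose[OF this inv]
    have "(\<lambda>n. sin (c / 2 * (1 / sqrt (real n))) / (1 / sqrt (real n))) \<longlonglongrightarrow> c / 2" .
    then have "(\<lambda>n. - 2 * (sin (c / 2 * (1 / sqrt (real n))) / (1 / sqrt (real n)))\<^sup>2) \<longlonglongrightarrow> - 2 * (c / 2)\<^sup>2"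
      by (intro tendsto_mult tendsto_const tendsto_power)
    also have "(\<lambda>n. - 2 * (sin (c / 2 * (1 / sqrt (real n))) / (1 / sqrt (real n)))\<^sup>2) =
        (\<lambda>n. real n * (cos (c / sqrt (real n)) - 1))"
    proof
      fix n :: nat
      have "cos (2 * (c / 2 * (1 / sqrt (real n)))) = 1 - 2 * (sin (c / 2 * (1 / sqrt (real n))))\<^sup>2"
        by (rule cos_double_sin)
      then have "cos (c / sqrt (real n)) - 1 = - 2 * (sin (c / 2 * (1 / sqrt (real n))))\<^sup>2" by simp
      then show "- 2 * (sin (c / 2 * (1 / sqrt (real n))) / (1 / sqrt (real n)))\<^sup>2 = real n * (cos (c / sqrt (real n)) - 1)"
        by (simp add: power_mult_distrib power_divide)
    qed
    finally show ?thesis by (simp add: power2_eq_square)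
  qed
  have nu: "(\<lambda>n. real n * u n) \<longlonglongrightarrow> - ((\<theta> \<bullet> \<theta>) / (2 * N))"
  proof -
    have "(\<lambda>n. (\<Sum>i\<in>UNIV. real n * (cos (\<theta> $ i / sqrt (real n)) - 1)) / N) \<longlonglongrightarrow> (\<Sum>i\<in>UNIV. - ((\<theta> $ i)\<^sup>2 / 2)) / N"
      using N by (intro tendsto_intros single) auto
    also have "(\<lambda>n. (\<Sum>i\<in>UNIV. real n * (cos (\<theta> $ i / sqrt (real n)) - 1)) / N) = (\<lambda>n. real n * u n)"
      using N by (simp add: fun_eq_iff u_def sum_distrib_left[symmetric] sum_subtractf N_def[symmetric] field_simps)
    also have "(\<Sum>i\<in>UNIV. - ((\<theta> $ i)\<^sup>2 / 2)) / N = - ((\<theta> \<bullet> \<theta>) / (2 * N))"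
      by (simp add: inner_vec_def power2_eq_square sum_negf sum_divide_distrib[symmetric])
    finally show ?thesis .
  qed
  have u0: "u \<longlonglongrightarrow> 0"
  proof -
    have "(\<lambda>n. (real n * u n) * inverse (real n)) \<longlonglongrightarrow> - ((\<theta> \<bullet> \<theta>) / (2 * N)) * 0"
      by (intro tendsto_mult nu lim_inverse_n)
    then have "(\<lambda>n. (real n * u n) * inverse (real n)) \<longlonglongrightarrow> 0" by simp
    then show ?thesis
      by (rule Lim_transform_eventually) (use eventually_gt_at_top[of 0] in \<open>eventually_elim; simp\<close>)
  qed
  have small: "\<forall>\<^sub>F n in sequentially. \<bar>u n\<bar> < 1 / 2"
    using tendstoD[OF u0, of "1 / 2"] by simp
  have main: "(\<lambda>n. real (k n) / real n * (real n * u n)) \<longlonglongrightarrow> h * (- ((\<theta> \<bullet> \<theta>) / (2 * N)))"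
    by (intro tendsto_mult k nu)
  have err: "(\<lambda>n. real (k n) * (ln (1 + u n) - u n)) \<longlonglongrightarrow> 0"
  proof (rule tendsto_rabs_zero_cancel, rule tendsto_sandwich[OF _ _ tendsto_const])
    show "(\<lambda>n. 2 * \<bar>real (k n) / real n * (real n * u n)\<bar> * \<bar>u n\<bar>) \<longlonglongrightarrow> 0"
      using tendsto_mult[OF tendsto_mult[OF tendsto_const[of 2] tendsto_rabs[OF main]] tendsto_rabs[OF u0]] by simp
    show "\<forall>\<^sub>F n in sequentially. \<bar>real (k n) * (ln (1 + u n) - u n)\<bar> \<le> 2 * \<bar>real (k n) / real n * (real n * u n)\<bar> * \<bar>u n\<bar>"
      using small eventually_gt_at_top[of 0]
    proof eventually_elim
      case (elim n)
      have "\<bar>ln (1 + u n) - u n\<bar> \<le> 2 * (u n)\<^sup>2"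
        by (rule abs_ln_one_plus_x_minus_x_bound) (use elim in simp)
      then have "real (k n) * \<bar>ln (1 + u n) - u n\<bar> \<le> real (k n) * (2 * (u n)\<^sup>2)"
        by (intro mult_left_mono) auto
      then show ?case using elim by (simp add: abs_mult power2_eq_square)
    qed
  qed (use always_eventually in auto)
  have "(\<lambda>n. exp (real (k n) / real n * (real n * u n) + real (k n) * (ln (1 + u n) - u n)))
      \<longlonglongrightarrow> exp (h * (- ((\<theta> \<bullet> \<theta>) / (2 * N))) + 0)"
    by (intro tendsto_exp tendsto_add main err)
  then have "(\<lambda>n. (1 + u n) ^ k n) \<longlonglongrightarrow> exp (h * (- ((\<theta> \<bullet> \<theta>) / (2 * N))) + 0)"
  proof (rule Lim_transform_eventually)
    show "\<forall>\<^sub>F n in sequentially. exp (real (k n) / real n * (real n * u n) + real (k n) * (ln (1 + u n) - u n)) = (1 + u n) ^ k n"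
      using small eventually_gt_at_top[of 0]
    proof eventually_elim
      case (elim n)
      have pos: "0 < 1 + u n" using elim by (simp add: abs_less_iff)
      have "exp (real (k n) / real n * (real n * u n) + real (k n) * (ln (1 + u n) - u n)) = exp (real (k n) * ln (1 + u n))"
        using elim by (simp add: algebra_simps)
      also have "\<dots> = (1 + u n) ^ k n" using pos by (simp add: exp_of_nat_mult)
      finally show ?case .
    qed
  qed
  then show ?thesis by (simp add: u_def N_def)
qed

text \<open>
  Summation by parts turns a linear functional of the partial sums into one of the independent
  increments: the increment number \<open>l\<close> is paired with all \<open>\<theta> j\<close> with \<open>j > l\<close>.
\<close>

lemma (in prob_space) char_partial_sums:
  fixes S :: "nat \<Rightarrow> 'a \<Rightarrow> real ^ 'n"
  assumes indep: "indep_vars (\<lambda>_. borel) (\<lambda>l x. S (Suc l) x - S l x) {..<m}"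
    and start: "AE x in M. S 0 x = 0" and meas: "\<And>j. j \<le> m \<Longrightarrow> S j \<in> borel_measurable M"
  shows "(\<integral>x. iexp (\<Sum>j\<in>{1..m}. \<theta> j \<bullet> S j x) \<partial>M) =
    (\<Prod>l<m. \<integral>x. iexp ((\<Sum>j\<in>{l<..m}. \<theta> j) \<bullet> (S (Suc l) x - S l x)) \<partial>M)"
proof -
  have abel: "(\<Sum>j\<in>{1..k}. \<theta> j \<bullet> S j x) = (\<Sum>l<k. (\<Sum>j\<in>{l<..k}. \<theta> j) \<bullet> (S (Suc l) x - S l x))"
    if "S 0 x = 0" for x k
  proof (induction k)
    case (Suc k)
    have tele: "(\<Sum>l<Suc k. S (Suc l) x - S l x) = S (Suc k) x"
      using sum_lessThan_telescope[of "\<lambda>l. S l x" "Suc k"] that by simp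
    have "(\<Sum>l<Suc k. (\<Sum>j\<in>{l<..Suc k}. \<theta> j) \<bullet> (S (Suc l) x - S l x)) =
      (\<Sum>l<Suc k. (\<Sum>j\<in>{l<..k}. \<theta> j) \<bullet> (S (Suc l) x - S l x) + \<theta> (Suc k) \<bullet> (S (Suc l) x - S l x))"
    proof (intro sum.cong refl)
      fix l assume "l \<in> {..<Suc k}"
      then have "{l<..Suc k} = insert (Suc k) {l<..k}" by auto
      then show "(\<Sum>j\<in>{l<..Suc k}. \<theta> j) \<bullet> (S (Suc l) x - S l x) =
        (\<Sum>j\<in>{l<..k}. \<theta> j) \<bullet> (S (Suc l) x - S l x) + \<theta> (Suc k) \<bullet> (S (Suc l) x - S l x)"
        by (simp add: inner_add_left)
    qed
    also have "\<dots> = (\<Sum>l<k. (\<Sum>j\<in>{l<..k}. \<theta> j) \<bullet> (S (Suc l) x - S l x)) + \<theta> (Suc k) \<bullet> S (Suc k) x"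
      unfolding sum.distrib inner_sum_right[symmetric] tele by simp
    finally show ?case using Suc.IH by simp
  qed simp
  have D: "(\<lambda>x. S (Suc l) x - S l x) \<in> borel_measurable M" if "l < m" for l
    using that meas by auto
  have "(\<integral>x. iexp (\<Sum>j\<in>{1..m}. \<theta> j \<bullet> S j x) \<partial>M) =
    (\<integral>x. (\<Prod>l<m. iexp ((\<Sum>j\<in>{l<..m}. \<theta> j) \<bullet> (S (Suc l) x - S l x))) \<partial>M)"
  proof (rule integral_cong_AE)
    have [measurable]: "(\<lambda>x. \<Sum>j\<in>{1..m}. \<theta> j \<bullet> S j x) \<in> borel_measurable M"
      using meas by (intro borel_measurable_sum borel_measurable_inner) auto
    show "(\<lambda>x. iexp (\<Sum>j\<in>{1..m}. \<theta> j \<bullet> S j x)) \<in> borel_measurable M" by measurable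
    show "(\<lambda>x. \<Prod>l<m. iexp ((\<Sum>j\<in>{l<..m}. \<theta> j) \<bullet> (S (Suc l) x - S l x))) \<in> borel_measurable M"
    proof (intro borel_measurable_prod)
      fix l assume "l \<in> {..<m}"
      then have [measurable]: "(\<lambda>x. S (Suc l) x - S l x) \<in> borel_measurable M" using D by simp
      show "(\<lambda>x. iexp ((\<Sum>j\<in>{l<..m}. \<theta> j) \<bullet> (S (Suc l) x - S l x))) \<in> borel_measurable M" by measurable
    qed
    show "AE x in M. iexp (\<Sum>j\<in>{1..m}. \<theta> j \<bullet> S j x) = (\<Prod>l<m. iexp ((\<Sum>j\<in>{l<..m}. \<theta> j) \<bullet> (S (Suc l) x - S l x)))"
      using start by eventually_elim (simp only: abel exp_sum[symmetric] finite_lessThan sum_distrib_left of_real_sum)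
  qed
  also have "\<dots> = (\<Prod>l<m. \<integral>x. iexp ((\<Sum>j\<in>{l<..m}. \<theta> j) \<bullet> (S (Suc l) x - S l x)) \<partial>M)"
  proof (rule indep_vars_lebesgue_integral)
    show "indep_vars (\<lambda>_. borel) (\<lambda>l x. iexp ((\<Sum>j\<in>{l<..m}. \<theta> j) \<bullet> (S (Suc l) x - S l x))) {..<m}"
      by (rule indep_vars_compose2[OF indep]) auto
    show "integrable M (\<lambda>x. iexp ((\<Sum>j\<in>{l<..m}. \<theta> j) \<bullet> (S (Suc l) x - S l x)))" if "l \<in> {..<m}" for l
      using that D by (intro integrable_iexp borel_measurable_inner) auto
  qed simp
  finally show ?thesis .
qed

text \<open>
  In both cases of the definition the characteristic function is a function of the second moment
  alone, which for a Gaussian vector can be read off the covariance matrix.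
\<close>

lemma (in prob_space) centered_normal_moments:
  assumes "centered_normal Y"
  shows "integrable M (\<lambda>x. (Y x)\<^sup>2)"
    and "(\<integral>x. iexp (Y x) \<partial>M) = complex_of_real (exp (- (expectation (\<lambda>x. (Y x)\<^sup>2) / 2)))"
proof -
  have [measurable]: "Y \<in> borel_measurable M" using assms unfolding centered_normal_def by auto
  consider "AE x in M. Y x = 0" | \<sigma> where "0 < \<sigma>" "distributed M lborel Y (normal_density 0 \<sigma>)"
    using assms unfolding centered_normal_def by auto
  then have "integrable M (\<lambda>x. (Y x)\<^sup>2) \<and>
    (\<integral>x. iexp (Y x) \<partial>M) = complex_of_real (exp (- (expectation (\<lambda>x. (Y x)\<^sup>2) / 2)))"
  proof cases
    case 1
    have "integrable M (\<lambda>x. (Y x)\<^sup>2) \<longleftrightarrow> integrable M (\<lambda>x. 0 :: real)"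
      by (rule integrable_cong_AE) (use 1 in \<open>auto\<close>)
    moreover have "expectation (\<lambda>x. (Y x)\<^sup>2) = expectation (\<lambda>x. 0)"
      by (rule integral_cong_AE) (use 1 in \<open>auto\<close>)
    moreover have "(\<integral>x. iexp (Y x) \<partial>M) = (\<integral>x. 1 \<partial>M)"
      by (rule integral_cong_AE) (use 1 in \<open>auto\<close>)
    ultimately show ?thesis by (simp add: prob_space)
  next
    case 2
    have dist: "distributed M lborel (\<lambda>x. Y x / \<sigma>) std_normal_density"
      using normal_standard_normal_convert[of \<sigma> Y 0] 2 by simp
    have var: "expectation (\<lambda>x. (Y x)\<^sup>2) = \<sigma>\<^sup>2"
      using normal_distributed_variance[OF 2] normal_distributed_expectation[OF 2] by simp
    have "integrable lborel (\<lambda>x. normal_density 0 \<sigma> x * (x - 0) ^ 2)"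
      using integrable_normal_moment[of \<sigma> 0 2] 2(1) by simp
    then have "integrable M (\<lambda>x. (Y x)\<^sup>2)"
      using distributed_integrable[OF 2(2), of "\<lambda>x. x\<^sup>2"] by simp
    moreover have "(\<integral>x. iexp (Y x) \<partial>M) = complex_of_real (exp (- (\<sigma>\<^sup>2 / 2)))"
    proof -
      have "(\<integral>x. iexp (Y x) \<partial>M) = (\<integral>x. iexp (\<sigma> * (Y x / \<sigma>)) \<partial>M)" using 2 by simp
      also have "\<dots> = (\<integral>z. iexp (\<sigma> * z) \<partial>distr M borel (\<lambda>x. Y x / \<sigma>))"
        by (subst integral_distr) auto
      also have "distr M borel (\<lambda>x. Y x / \<sigma>) = std_normal_distribution"
        using distributed_distr_eq_density[OF dist] by (metis distr_cong sets_lborel)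
      also have "(\<integral>z. iexp (\<sigma> * z) \<partial>std_normal_distribution) = char std_normal_distribution \<sigma>"
        by (simp add: char_def)
      finally show ?thesis by (simp add: char_std_normal_distribution)
    qed
    ultimately show ?thesis using var by simp
  qed
  then show "integrable M (\<lambda>x. (Y x)\<^sup>2)"
    and "(\<integral>x. iexp (Y x) \<partial>M) = complex_of_real (exp (- (expectation (\<lambda>x. (Y x)\<^sup>2) / 2)))" by auto
qed

text \<open>
  The covariances are Bochner integrals, which are meaningful here because the coordinates are square
  integrable.  They give the second moment \<open>c * (\<theta> \<bullet> \<theta>)\<close> of \<open>\<theta> \<bullet> X\<close>.
\<close>

lemma (in prob_space) char_centered_gaussian_vector:
  fixes X :: "'a \<Rightarrow> real ^ 'n"
  assumes X: "centered_gaussian_vector X (c *\<^sub>R mat 1)"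
  shows "(\<integral>x. iexp (\<theta> \<bullet> X x) \<partial>M) = complex_of_real (exp (- (c * (\<theta> \<bullet> \<theta>) / 2)))"
proof -
  have [measurable]: "X \<in> borel_measurable M" and normal: "\<And>u. centered_normal (\<lambda>x. u \<bullet> X x)"
    and cov: "\<And>i j. expectation (\<lambda>x. X x $ i * X x $ j) = (c *\<^sub>R mat 1) $ i $ j"
    using X unfolding centered_gaussian_vector_def by auto
  have sq: "integrable M (\<lambda>x. (X x $ i)\<^sup>2)" for i
    using centered_normal_moments(1)[OF normal[of "axis i 1"]] by (simp add: inner_axis')
  have int: "integrable M (\<lambda>x. X x $ i * X x $ j)" for i j
  proof (rule Bochner_Integration.integrable_bound)
    show "integrable M (\<lambda>x. (X x $ i)\<^sup>2 + (X x $ j)\<^sup>2)" using sq by simp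
    show "AE x in M. norm (X x $ i * X x $ j) \<le> norm ((X x $ i)\<^sup>2 + (X x $ j)\<^sup>2)"
    proof (rule AE_I2)
      fix x
      have "2 * \<bar>X x $ i\<bar> * \<bar>X x $ j\<bar> \<le> \<bar>X x $ i\<bar>\<^sup>2 + \<bar>X x $ j\<bar>\<^sup>2" by (rule sum_squares_bound)
      moreover have "0 \<le> \<bar>X x $ i\<bar> * \<bar>X x $ j\<bar>" by simp
      ultimately have "\<bar>X x $ i\<bar> * \<bar>X x $ j\<bar> \<le> (X x $ i)\<^sup>2 + (X x $ j)\<^sup>2"
        by (simp only: power2_abs mult.assoc)
      then show "norm (X x $ i * X x $ j) \<le> norm ((X x $ i)\<^sup>2 + (X x $ j)\<^sup>2)"
        by (simp add: abs_mult)
    qed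
  qed measurable
  have "expectation (\<lambda>x. (\<theta> \<bullet> X x)\<^sup>2) = expectation (\<lambda>x. \<Sum>i\<in>UNIV. \<Sum>j\<in>UNIV. (\<theta> $ i * \<theta> $ j) * (X x $ i * X x $ j))"
    by (simp add: inner_vec_def power2_eq_square sum_product mult_ac)
  also have "\<dots> = (\<Sum>i\<in>UNIV. \<Sum>j\<in>UNIV. (\<theta> $ i * \<theta> $ j) * expectation (\<lambda>x. X x $ i * X x $ j))"
    using int by simp
  also have "\<dots> = (\<Sum>i\<in>UNIV. \<Sum>j\<in>UNIV. if j = i then c * (\<theta> $ i * \<theta> $ i) else 0)"
    unfolding cov by (intro sum.cong) (auto simp: mat_def)
  also have "\<dots> = c * (\<theta> \<bullet> \<theta>)"
    by (simp add: inner_vec_def sum_distrib_left)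
  finally show ?thesis
    using centered_normal_moments(2)[OF normal[of \<theta>]] by simp
qed

section \<open>The walk along a coarse time grid\<close>

lemma gaussian_tail_small:
  fixes C s d :: real
  assumes "0 < C" "0 < s" "0 < d"
  obtains K :: real where "0 < K" "C * exp (- (K\<^sup>2 / s)) < d"
proof
  have y: "0 < C / d" using assms by simp
  then show "0 < sqrt (s * (C / d))" using assms by simp
  have "C / d < exp (C / d)" using exp_ge_add_one_self[of "C / d"] by linarith
  then have "C * exp (- (C / d)) < d" using assms by (simp add: exp_minus field_simps)
  then show "C * exp (- ((sqrt (s * (C / d)))\<^sup>2 / s)) < d" using assms y by simp
qed

context simple_random_walk
begin

definition walk_cdf :: "nat \<Rightarrow> real \<Rightarrow> real" where
  "walk_cdf n a = prob {x\<in>space M. \<forall>k\<in>{1..n}. infnorm (walk \<omega> k x) \<le> a * sqrt (real n)}"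

text \<open>
  Each increment is a function of its own block of \<open>k\<close> steps.  The factor \<open>c\<close> is \<open>1 / sqrt n\<close> in the
  limit theorem and \<open>1\<close> in the geometric tail bound.
\<close>

lemma indep_block_increments:
  "indep_vars (\<lambda>_. borel) (\<lambda>l x. c *\<^sub>R walk \<omega> (Suc l * k) x - c *\<^sub>R walk \<omega> (l * k) x) {..<m}"
proof -
  let ?K = "\<lambda>l. {l * k<..Suc l * k}"
  have "disjoint_family_on ?K {..<m}"
    unfolding disjoint_family_on_def
  proof (intro ballI impI)
    have "?K i \<inter> ?K j = {}" if "i < j" for i j
    proof -
      have "Suc i * k \<le> j * k" using that by (intro mult_le_mono1) auto
      then show ?thesis by auto
    qed
    then show "?K i \<inter> ?K j = {}" if "i \<noteq> j" for i j
      using that by (metis inf_commute linorder_neqE_nat)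
  qed
  then have "indep_vars (\<lambda>l. PiM (?K l) (\<lambda>_. borel)) (\<lambda>l x. restrict (\<lambda>s. \<omega> s x) (?K l)) {..<m}"
    by (intro indep_vars_restrict[OF indep_steps]) auto
  then have "indep_vars (\<lambda>_. borel) (\<lambda>l x. c *\<^sub>R (\<Sum>s\<in>?K l. restrict (\<lambda>s. \<omega> s x) (?K l) s)) {..<m}"
    by (rule indep_vars_compose2)
      (intro borel_measurable_scaleR borel_measurable_const borel_measurable_sum measurable_component_singleton)
  also have "(\<lambda>l x. c *\<^sub>R (\<Sum>s\<in>?K l. restrict (\<lambda>s. \<omega> s x) (?K l) s)) =
     (\<lambda>l x. c *\<^sub>R walk \<omega> (Suc l * k) x - c *\<^sub>R walk \<omega> (l * k) x)"
  proof (intro ext)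
    fix l x
    have "walk \<omega> (Suc l * k) x - walk \<omega> (l * k) x = (\<Sum>s\<in>?K l. \<omega> s x)"
      by (rule walk_diff) simp
    then show "c *\<^sub>R (\<Sum>s\<in>?K l. restrict (\<lambda>s. \<omega> s x) (?K l) s) = c *\<^sub>R walk \<omega> (Suc l * k) x - c *\<^sub>R walk \<omega> (l * k) x"
      by (simp add: scaleR_right_diff_distrib[symmetric])
  qed
  finally show ?thesis .
qed

lemma char_walk_skeleton:
  "(\<integral>x. iexp (\<Sum>j\<in>{1..m}. \<theta> j \<bullet> ((1 / sqrt (real n)) *\<^sub>R walk \<omega> (j * k) x)) \<partial>M) =
    (\<Prod>l<m. complex_of_real (((\<Sum>i\<in>UNIV. cos ((\<Sum>j\<in>{l<..m}. \<theta> j) $ i / sqrt (real n))) / real CARD('n)) ^ k))"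
proof -
  let ?c = "1 / sqrt (real n)"
  have "(\<integral>x. iexp (\<Sum>j\<in>{1..m}. \<theta> j \<bullet> (?c *\<^sub>R walk \<omega> (j * k) x)) \<partial>M) =
    (\<Prod>l<m. \<integral>x. iexp ((\<Sum>j\<in>{l<..m}. \<theta> j) \<bullet> (?c *\<^sub>R walk \<omega> (Suc l * k) x - ?c *\<^sub>R walk \<omega> (l * k) x)) \<partial>M)"
    by (rule char_partial_sums[OF indep_block_increments]) (auto simp: walk_def[of _ 0])
  also have "\<dots> = (\<Prod>l<m. complex_of_real (((\<Sum>i\<in>UNIV. cos ((\<Sum>j\<in>{l<..m}. \<theta> j) $ i / sqrt (real n))) / real CARD('n)) ^ k))"
  proof (intro prod.cong refl)
    fix l
    let ?\<eta> = "\<Sum>j\<in>{l<..m}. \<theta> j"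
    have "(\<integral>x. iexp (?\<eta> \<bullet> (?c *\<^sub>R walk \<omega> (Suc l * k) x - ?c *\<^sub>R walk \<omega> (l * k) x)) \<partial>M) =
      (\<integral>x. iexp ((?c *\<^sub>R ?\<eta>) \<bullet> (walk \<omega> (Suc l * k) x - walk \<omega> (l * k) x)) \<partial>M)"
      by (simp add: inner_diff_right diff_divide_distrib)
    also have "\<dots> = complex_of_real (((\<Sum>i\<in>UNIV. cos ((?c *\<^sub>R ?\<eta>) $ i)) / real CARD('n)) ^ (Suc l * k - l * k))"
      by (rule char_walk_increment) simp
    finally show "(\<integral>x. iexp (?\<eta> \<bullet> (?c *\<^sub>R walk \<omega> (Suc l * k) x - ?c *\<^sub>R walk \<omega> (l * k) x)) \<partial>M) =
      complex_of_real (((\<Sum>i\<in>UNIV. cos (?\<eta> $ i / sqrt (real n))) / real CARD('n)) ^ k)"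
      by simp
  qed
  finally show ?thesis .
qed

lemma walk_events [measurable]:
  "{x\<in>space M. \<forall>k\<in>{1..n}. infnorm (walk \<omega> k x) \<le> r} \<in> events"
  "{x\<in>space M. \<exists>k\<in>{1..n}. r < infnorm (walk \<omega> k x)} \<in> events"
  by (auto intro!: sets.sets_Collect_finite_Ex sets.sets_Collect_finite_All)

lemma walk_skeleton_tight:
  assumes d: "0 < d"
  obtains K where "\<And>n m k. m * k \<le> n \<Longrightarrow>
    prob {x\<in>space M. \<exists>j\<in>{1..m}. K < infnorm ((1 / sqrt (real n)) *\<^sub>R walk \<omega> (j * k) x)} \<le> d"
proof -
  obtain K :: real where K: "0 < K" "4 * real CARD('n) * exp (- (K\<^sup>2 / 8)) < d"
    using gaussian_tail_small[OF _ _ d, of "4 * real CARD('n)" 8] by auto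
  have "prob {x\<in>space M. \<exists>j\<in>{1..m}. K < infnorm ((1 / sqrt (real n)) *\<^sub>R walk \<omega> (j * k) x)} \<le> d"
    if mk: "m * k \<le> n" for n m k
  proof -
    have "{x\<in>space M. \<exists>j\<in>{1..m}. K < infnorm ((1 / sqrt (real n)) *\<^sub>R walk \<omega> (j * k) x)} \<subseteq>
      {x\<in>space M. \<exists>t\<in>{1..n}. K * sqrt (real n) < infnorm (walk \<omega> t x)}"
    proof safe
      fix x j assume j: "j \<in> {1..m}" and big: "K < infnorm ((1 / sqrt (real n)) *\<^sub>R walk \<omega> (j * k) x)"
      have "j * k \<noteq> 0"
      proof
        assume "j * k = 0"
        then have "walk \<omega> (j * k) x = 0" by (simp add: walk_def)
        then show False using big K by (simp add: infnorm_0)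
      qed
      moreover have "j * k \<le> m * k" using j by simp
      then have "j * k \<le> n" using mk by (rule order_trans)
      ultimately have t: "j * k \<in> {1..n}" by simp
      then have n: "0 < n" by (cases n) auto
      have "K * sqrt (real n) < infnorm (walk \<omega> (j * k) x)"
        using big pos_less_divide_eq[of "sqrt (real n)" K] n by (simp add: infnorm_mul)
      then show "\<exists>t\<in>{1..n}. K * sqrt (real n) < infnorm (walk \<omega> t x)" using t by blast
    qed
    then have le: "prob {x\<in>space M. \<exists>j\<in>{1..m}. K < infnorm ((1 / sqrt (real n)) *\<^sub>R walk \<omega> (j * k) x)} \<le>
       prob {x\<in>space M. \<exists>t\<in>{1..n}. K * sqrt (real n) < infnorm (walk \<omega> t x)}"
      by (intro finite_measure_mono walk_events)
    show ?thesis
    proof (cases "1 \<le> n")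
      case True
      then show ?thesis using le walk_max_tail[OF K(1) True] K(2) by linarith
    next
      case False
      then have e: "{x\<in>space M. \<exists>t\<in>{1..n}. K * sqrt (real n) < infnorm (walk \<omega> t x)} = {}" by auto
      show ?thesis using le[unfolded e measure_empty] d by linarith
    qed
  qed
  then show ?thesis by (rule that)
qed

text \<open>
  A block of length \<open>k \<le> n / m\<close> moves the walk by more than \<open>2 * \<epsilon> * sqrt n\<close> only with a probability
  that is exponentially small in \<open>m\<close>, which beats the number of blocks.
\<close>

lemma walk_oscillation_tail:
  assumes "1 \<le> k" "1 \<le> m" "m * k \<le> n" "0 < \<epsilon>"
  shows "prob {x\<in>space M. \<exists>j\<in>{..m}. \<exists>t\<in>{j * k<..j * k + k}. 2 * (\<epsilon> * sqrt (real n)) < infnorm (walk \<omega> t x - walk \<omega> (j * k) x)}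
    \<le> real (m + 1) * (4 * real CARD('n) * exp (- (\<epsilon>\<^sup>2 * real m / 2)))"
proof -
  have "1 * 1 \<le> m * k" using assms by (intro mult_le_mono)
  then have False: "n \<noteq> 0" using assms(3) by linarith
  let ?E = "\<lambda>j. {x\<in>space M. \<exists>t\<in>{j * k<..j * k + k}. 2 * (\<epsilon> * sqrt (real n)) < infnorm (walk \<omega> t x - walk \<omega> (j * k) x)}"
  have E: "?E j \<in> events" for j by (auto intro!: sets.sets_Collect_finite_Ex)
  have "prob {x\<in>space M. \<exists>j\<in>{..m}. \<exists>t\<in>{j * k<..j * k + k}. 2 * (\<epsilon> * sqrt (real n)) < infnorm (walk \<omega> t x - walk \<omega> (j * k) x)}
    = prob (\<Union>j\<in>{..m}. ?E j)"
    by (rule arg_cong[where f = prob]) auto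
  also have "\<dots> \<le> (\<Sum>j\<in>{..m}. prob (?E j))"
    using E by (intro measure_UNION_le) auto
  also have "\<dots> \<le> (\<Sum>j\<in>{..m}. 4 * real CARD('n) * exp (- (\<epsilon>\<^sup>2 * real m / 2)))"
  proof (rule sum_mono)
    fix j
    have "prob (?E j) \<le> 4 * real CARD('n) * exp (- ((\<epsilon> * sqrt (real n))\<^sup>2 / (2 * real k)))"
      using assms False by (intro walk_max_increment_tail) auto
    also have "\<epsilon>\<^sup>2 * real m / 2 \<le> (\<epsilon> * sqrt (real n))\<^sup>2 / (2 * real k)"
    proof -
      have "real m * real k \<le> real n" using assms(3) by (metis of_nat_le_iff of_nat_mult)
      then have "\<epsilon>\<^sup>2 * (real m * real k) \<le> \<epsilon>\<^sup>2 * real n" by (intro mult_left_mono) auto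
      then show ?thesis using assms by (simp add: power_mult_distrib field_simps)
    qed
    then have "4 * real CARD('n) * exp (- ((\<epsilon> * sqrt (real n))\<^sup>2 / (2 * real k))) \<le> 4 * real CARD('n) * exp (- (\<epsilon>\<^sup>2 * real m / 2))"
      by (intro mult_left_mono) auto
    finally show "prob (?E j) \<le> 4 * real CARD('n) * exp (- (\<epsilon>\<^sup>2 * real m / 2))" .
  qed
  finally show ?thesis by simp
qed

lemma skeleton_and_oscillation_imp_walk_bound:
  assumes k: "n < m * k + k" "1 \<le> k" and a: "0 \<le> a"
    and skel: "\<And>j. j \<in> {1..m} \<Longrightarrow> infnorm (walk \<omega> (j * k) x) \<le> a"
    and osc: "\<And>j t. j \<le> m \<Longrightarrow> t \<in> {j * k<..j * k + k} \<Longrightarrow> infnorm (walk \<omega> t x - walk \<omega> (j * k) x) \<le> b"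
    and t: "t \<in> {1..n}"
  shows "infnorm (walk \<omega> t x) \<le> a + b"
proof -
  define j where "j = (t - 1) div k"
  have "j * k \<le> t - 1" unfolding j_def by simp
  moreover have "t - 1 < j * k + k"
    unfolding j_def using k(2) by (metis add.commute dividend_less_times_div mult.commute zero_less_one order_less_le_trans)
  ultimately have tj: "t \<in> {j * k<..j * k + k}" using t by auto
  have "j * k < Suc m * k" using tj k t by auto
  then have jm: "j \<le> m" by (metis less_Suc_eq_le mult_less_cancel2)
  have "infnorm (walk \<omega> (j * k) x) \<le> a"
  proof (cases "j = 0")
    case True then show ?thesis using a by (simp add: walk_def infnorm_0)
  next
    case False then show ?thesis using skel jm by auto
  qed
  moreover have "infnorm (walk \<omega> t x) \<le> infnorm (walk \<omega> t x - walk \<omega> (j * k) x) + infnorm (walk \<omega> (j * k) x)"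
    using infnorm_triangle[of "walk \<omega> t x - walk \<omega> (j * k) x" "walk \<omega> (j * k) x"] by simp
  ultimately show ?thesis using osc[OF jm tj] by linarith
qed

end

section \<open>Convergence along a coarse time grid\<close>

locale walk_and_brownian = simple_random_walk M \<omega> + BM: brownian_motion P W "(1 / real CARD('n)) *\<^sub>R mat 1"
  for M :: "'a measure" and \<omega> :: "nat \<Rightarrow> 'a \<Rightarrow> real ^ 'n" and P :: "'b measure" and W :: "real \<Rightarrow> 'b \<Rightarrow> real ^ 'n"
begin

lemma div_ratio_tendsto:
  assumes "1 \<le> m"
  shows "(\<lambda>n. real (n div m) / real n) \<longlonglongrightarrow> 1 / real m"
proof (rule tendsto_sandwich)
  show "\<forall>\<^sub>F n in sequentially. 1 / real m - inverse (real n) \<le> real (n div m) / real n"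
    using eventually_gt_at_top[of 0]
  proof eventually_elim
    case (elim n)
    have "real n < real m * (real (n div m) + 1)"
    proof -
      have "n < m * (n div m + 1)" using assms by (simp add: dividend_less_times_div)
      then show ?thesis by (metis of_nat_less_iff of_nat_mult of_nat_add of_nat_1)
    qed
    then have "real n / real m \<le> real (n div m) + 1"
      using assms by (simp add: field_simps)
    then have "real n / real m / real n \<le> (real (n div m) + 1) / real n"
      by (rule divide_right_mono) simp
    then show ?case using elim by (simp add: add_divide_distrib inverse_eq_divide)
  qed
  show "\<forall>\<^sub>F n in sequentially. real (n div m) / real n \<le> 1 / real m"
    using eventually_gt_at_top[of 0]
  proof eventually_elim
    case (elim n)
    have "real m * real (n div m) \<le> real n" by (metis of_nat_le_iff of_nat_mult times_div_less_eq_dividend)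
    then show ?case using assms elim by (simp add: field_simps)
  qed
  show "(\<lambda>n. 1 / real m - inverse (real n)) \<longlonglongrightarrow> 1 / real m"
    using tendsto_diff[OF tendsto_const lim_inverse_n, of "1 / real m"] by simp
qed simp

lemma char_brownian_skeleton:
  assumes "1 \<le> m"
  shows "(\<integral>x. iexp (\<Sum>j\<in>{1..m}. \<theta> j \<bullet> W (real j / real m) x) \<partial>P) =
    (\<Prod>l<m. complex_of_real (exp (- ((1 / real m) * ((\<Sum>j\<in>{l<..m}. \<theta> j) \<bullet> (\<Sum>j\<in>{l<..m}. \<theta> j)) / (2 * real CARD('n))))))"
proof -
  have "(\<integral>x. iexp (\<Sum>j\<in>{1..m}. \<theta> j \<bullet> W (real j / real m) x) \<partial>P) =
    (\<Prod>l<m. \<integral>x. iexp ((\<Sum>j\<in>{l<..m}. \<theta> j) \<bullet> (W (real (Suc l) / real m) x - W (real l / real m) x)) \<partial>P)"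
  proof (rule BM.char_partial_sums)
    show "BM.indep_vars (\<lambda>_. borel) (\<lambda>l x. W (real (Suc l) / real m) x - W (real l / real m) x) {..<m}"
      using assms by (intro BM.indep_increments) (auto simp: divide_strict_right_mono)
    show "AE x in P. W (real 0 / real m) x = 0" using BM.start by simp
  qed (auto intro: BM.measurable_W)
  also have "\<dots> = (\<Prod>l<m. complex_of_real (exp (- ((1 / real m) * ((\<Sum>j\<in>{l<..m}. \<theta> j) \<bullet> (\<Sum>j\<in>{l<..m}. \<theta> j)) / (2 * real CARD('n))))))"
  proof (intro prod.cong refl)
    fix l
    let ?\<eta> = "\<Sum>j\<in>{l<..m}. \<theta> j"
    have "BM.centered_gaussian_vector (\<lambda>x. W (real l / real m + 1 / real m) x - W (real l / real m) x)
        ((1 / real m) *\<^sub>R ((1 / real CARD('n)) *\<^sub>R mat 1))"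
      by (rule BM.gaussian_increments) auto
    then have "BM.centered_gaussian_vector (\<lambda>x. W (real (Suc l) / real m) x - W (real l / real m) x)
        ((1 / real m * (1 / real CARD('n))) *\<^sub>R mat 1)"
      by (simp add: add_divide_distrib[symmetric] add.commute)
    from BM.char_centered_gaussian_vector[OF this, of ?\<eta>]
    show "(\<integral>x. iexp (?\<eta> \<bullet> (W (real (Suc l) / real m) x - W (real l / real m) x)) \<partial>P) =
      complex_of_real (exp (- ((1 / real m) * (?\<eta> \<bullet> ?\<eta>) / (2 * real CARD('n)))))"
      by (simp add: mult_ac)
  qed
  finally show ?thesis .
qed

text \<open>
  Both characteristic functions are products over the increments of the grid, so that convergence can
  be checked for a single increment.  The limit holds for every fixed number \<open>m\<close> of blocks; the block
  length \<open>n div m\<close> grows with \<open>n\<close>.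
\<close>

lemma skeletons_converge:
  assumes m: "1 \<le> m"
  shows "converging_char_functions M P {1..m} (\<lambda>n j x. (1 / sqrt (real n)) *\<^sub>R walk \<omega> (j * (n div m)) x) (\<lambda>j. W (real j / real m))"
proof unfold_locales
  fix \<theta> :: "nat \<Rightarrow> real ^ 'n"
  show "(\<lambda>n. \<integral>x. iexp (\<Sum>j\<in>{1..m}. \<theta> j \<bullet> ((1 / sqrt (real n)) *\<^sub>R walk \<omega> (j * (n div m)) x)) \<partial>M)
      \<longlonglongrightarrow> (\<integral>x. iexp (\<Sum>j\<in>{1..m}. \<theta> j \<bullet> W (real j / real m) x) \<partial>P)"
    unfolding char_walk_skeleton char_brownian_skeleton[OF m]
    by (intro tendsto_prod tendsto_of_real cos_average_power_tendsto div_ratio_tendsto[OF m])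
qed (auto intro: BM.measurable_W)

end

section \<open>The limit law of the running maximum\<close>

text \<open>
  A measurable version of \<open>process_max\<close>.  Dyadic grids are nested, which turns the passage from the
  grid to the path into a monotone limit.
\<close>

definition dyadic_sup :: "(real \<Rightarrow> 'b \<Rightarrow> real ^ 'n) \<Rightarrow> 'b \<Rightarrow> ennreal" where
  "dyadic_sup W x = (SUP q. SUP j\<in>{..2 ^ q}. ennreal (infnorm (W (real j / 2 ^ q) x)))"

lemma dyadic_sup_le_iff:
  assumes "0 \<le> a"
  shows "dyadic_sup W x \<le> ennreal a \<longleftrightarrow> (\<forall>q. \<forall>j\<le>2 ^ q. infnorm (W (real j / 2 ^ q) x) \<le> a)"
  using assms by (auto simp: dyadic_sup_def SUP_le_iff ennreal_le_iff)

lemma dyadic_bound_imp_bound: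
  fixes f :: "real \<Rightarrow> real"
  assumes cont: "continuous_on {0..1} f" and bound: "\<And>q j. j \<le> 2 ^ q \<Longrightarrow> f (real j / 2 ^ q) \<le> a"
    and s: "s \<in> {0..1}"
  shows "f s \<le> a"
proof -
  define j where "j q = nat \<lfloor>2 ^ q * s\<rfloor>" for q :: nat
  have j: "real (j q) \<le> 2 ^ q * s" "2 ^ q * s < real (j q) + 1" for q
    unfolding j_def using s by (auto simp: of_nat_nat)
  have jq: "j q \<le> 2 ^ q" for q
  proof -
    have "2 ^ q * s \<le> 2 ^ q * 1" using s by (intro mult_left_mono) auto
    then have "real (j q) \<le> 2 ^ q" using j(1)[of q] by linarith
    then show ?thesis by (metis of_nat_le_iff of_nat_numeral of_nat_power)
  qed
  have lim: "(\<lambda>q. real (j q) / 2 ^ q) \<longlonglongrightarrow> s"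
  proof (rule tendsto_sandwich)
    show "\<forall>\<^sub>F q in sequentially. s - (1 / 2) ^ q \<le> real (j q) / 2 ^ q"
    proof (intro always_eventually allI)
      fix q
      have "s - (1 / 2) ^ q = (2 ^ q * s - 1) / 2 ^ q" by (simp add: diff_divide_distrib power_divide)
      also have "\<dots> \<le> real (j q) / 2 ^ q" using j(2)[of q] by (intro divide_right_mono) auto
      finally show "s - (1 / 2) ^ q \<le> real (j q) / 2 ^ q" .
    qed
    show "\<forall>\<^sub>F q in sequentially. real (j q) / 2 ^ q \<le> s"
      using j(1) by (intro always_eventually allI) (simp add: field_simps)
    show "(\<lambda>q. s - (1 / 2) ^ q) \<longlonglongrightarrow> s"
      using tendsto_diff[OF tendsto_const LIMSEQ_power_zero[of "1 / 2 :: real"], of s] by simp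
  qed simp
  have "(\<lambda>q. f (real (j q) / 2 ^ q)) \<longlonglongrightarrow> f s"
  proof (rule continuous_on_tendsto_compose[OF cont lim s])
    show "\<forall>\<^sub>F q in sequentially. real (j q) / 2 ^ q \<in> {0..1}"
    proof (intro always_eventually allI)
      fix q
      have "real (j q) \<le> 2 ^ q" using jq[of q] by (metis of_nat_le_iff of_nat_numeral of_nat_power)
      then show "real (j q) / 2 ^ q \<in> {0..1}" by simp
    qed
  qed
  then show ?thesis
    by (rule LIMSEQ_le_const2) (use bound jq in blast)
qed

lemma continuous_path_sup_eq_dyadic_sup:
  fixes W :: "real \<Rightarrow> 'b \<Rightarrow> real ^ 'n"
  assumes "continuous_on {0..} (\<lambda>s. W s x)"
  shows "process_max W x = dyadic_sup W x"
proof (rule antisym)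
  show "dyadic_sup W x \<le> process_max W x"
    unfolding dyadic_sup_def process_max_def
  proof (intro SUP_least)
    fix q j :: nat assume "j \<in> {..2 ^ q}"
    then have "real j \<le> 2 ^ q" by (metis atMost_iff of_nat_le_iff of_nat_numeral of_nat_power)
    then show "ennreal (infnorm (W (real j / 2 ^ q) x)) \<le> (SUP s\<in>{0..1}. ennreal (infnorm (W s x)))"
      by (intro SUP_upper) auto
  qed
  show "process_max W x \<le> dyadic_sup W x"
  proof (cases "dyadic_sup W x")
    case (real a)
    then have bound: "infnorm (W (real j / 2 ^ q) x) \<le> a" if "j \<le> 2 ^ q" for q j
      using dyadic_sup_le_iff[of a W x] that by auto
    have "continuous_on {0..1} (\<lambda>s. infnorm (W s x))"
      by (intro continuous_on_infnorm continuous_on_subset[OF assms]) auto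
    from dyadic_bound_imp_bound[OF this bound]
    show ?thesis unfolding process_max_def real by (intro SUP_least ennreal_leI) auto
  qed simp
qed

context walk_and_brownian
begin

lemma W_measurable [measurable]: "0 \<le> s \<Longrightarrow> W s \<in> borel_measurable P"
  by (rule BM.measurable_W)

lemma dyadic_sup_measurable [measurable]: "dyadic_sup W \<in> borel_measurable P"
  unfolding dyadic_sup_def by (intro borel_measurable_SUP measurable_compose[OF _ measurable_ennreal] measurable_compose[OF W_measurable borel_measurable_infnorm]) auto

text \<open>
  The limit law, as a distribution function on the nonnegative half line.
\<close>

definition sup_cdf :: "real \<Rightarrow> real" where
  "sup_cdf a = BM.prob {x\<in>space P. dyadic_sup W x \<le> ennreal a}"

lemma sup_cdf_mono: "a \<le> b \<Longrightarrow> sup_cdf a \<le> sup_cdf b"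
  unfolding sup_cdf_def by (intro BM.finite_measure_mono) (auto intro: order_trans ennreal_leI)

lemma skeleton_events: "{x\<in>space P. \<forall>j\<in>{1..m}. infnorm (W (real j / real m) x) \<le> a} \<in> BM.events"
  by (auto intro!: sets.sets_Collect_finite_All measurable_compose[OF W_measurable borel_measurable_infnorm])

lemma sup_cdf_le_skeleton:
  assumes "0 \<le> a"
  shows "sup_cdf a \<le> BM.prob {x\<in>space P. \<forall>j\<in>{1..2 ^ q}. infnorm (W (real j / real (2 ^ q)) x) \<le> a}"
  unfolding sup_cdf_def using assms skeleton_events[of "2 ^ q" a]
  by (intro BM.finite_measure_mono) (auto simp: dyadic_sup_le_iff)

text \<open>
  Continuity of the measure from above.  The point \<open>0\<close> of the grid may be added since the Brownian
  motion almost surely starts in \<open>0\<close>.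
\<close>

lemma skeleton_tendsto_sup_cdf:
  assumes a: "0 \<le> a"
  shows "(\<lambda>q. BM.prob {x\<in>space P. \<forall>j\<in>{1..2 ^ q}. infnorm (W (real j / real (2 ^ q)) x) \<le> a}) \<longlonglongrightarrow> sup_cdf a"
proof -
  let ?B = "\<lambda>q :: nat. {x\<in>space P. \<forall>j\<in>{1..2 ^ q}. infnorm (W (real j / real (2 ^ q)) x) \<le> a}"
  have "decseq ?B"
  proof (rule decseq_SucI, rule subsetI)
    fix q x assume x: "x \<in> ?B (Suc q)"
    have "infnorm (W (real j / real (2 ^ q)) x) \<le> a" if "j \<in> {1..2 ^ q}" for j
    proof -
      have "2 * j \<in> {1..2 ^ Suc q}" using that by auto
      then have "infnorm (W (real (2 * j) / real (2 ^ Suc q)) x) \<le> a" using x by blast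
      then show ?thesis by simp
    qed
    then show "x \<in> ?B q" using x by blast
  qed
  then have "(\<lambda>q. BM.prob (?B q)) \<longlonglongrightarrow> BM.prob (\<Inter>q. ?B q)"
    using skeleton_events[of "2 ^ _" a] by (intro BM.finite_Lim_measure_decseq) auto
  also have "BM.prob (\<Inter>q. ?B q) = sup_cdf a"
    unfolding sup_cdf_def
  proof (rule BM.finite_measure_eq_AE)
    show "AE x in P. (x \<in> (\<Inter>q. ?B q)) = (x \<in> {x\<in>space P. dyadic_sup W x \<le> ennreal a})"
      using BM.start AE_space
    proof eventually_elim
      case (elim x)
      have zero: "infnorm (W (real 0 / 2 ^ q) x) \<le> a" for q
        using elim a by (simp add: infnorm_0)
      have "(\<forall>j\<in>{1..2 ^ q}. infnorm (W (real j / 2 ^ q) x) \<le> a) \<longleftrightarrow> (\<forall>j\<le>2 ^ q. infnorm (W (real j / 2 ^ q) x) \<le> a)" for q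
      proof (intro iffI allI impI ballI)
        fix j :: nat assume "\<forall>j\<in>{1..2 ^ q}. infnorm (W (real j / 2 ^ q) x) \<le> a" "j \<le> 2 ^ q"
        then show "infnorm (W (real j / 2 ^ q) x) \<le> a"
          using zero[of q] by (cases "j = 0") auto
      qed auto
      moreover have "x \<in> (\<Inter>q. ?B q) \<longleftrightarrow> (\<forall>q. \<forall>j\<in>{1..2 ^ q}. infnorm (W (real j / 2 ^ q) x) \<le> a)"
        using elim by simp
      ultimately show ?case using elim by (simp only: dyadic_sup_le_iff[OF a] mem_Collect_eq simp_thms)
    qed
    show "(\<Inter>q. ?B q) \<in> BM.events" using skeleton_events[of "2 ^ _" a] by (intro sets.countable_INT) auto
  qed measurable
  finally show ?thesis .
qed

lemma skeleton_tight:
  assumes d: "0 < d"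
  shows "\<exists>K. \<forall>\<^sub>F n in sequentially. prob {x\<in>space M. \<exists>j\<in>{1..m}. K < infnorm ((1 / sqrt (real n)) *\<^sub>R walk \<omega> (j * (n div m)) x)} \<le> d"
proof -
  from walk_skeleton_tight[OF d] obtain K where K: "\<And>n m k. m * k \<le> n \<Longrightarrow>
    prob {x\<in>space M. \<exists>j\<in>{1..m}. K < infnorm ((1 / sqrt (real n)) *\<^sub>R walk \<omega> (j * k) x)} \<le> d" by blast
  show ?thesis by (intro exI[of _ K] always_eventually allI K) simp
qed

text \<open>
  Restricting the maximum to a grid only increases the probability of confinement of the walk, and on
  a fine dyadic grid the Brownian probability is close to its limit \<open>sup_cdf b\<close>.
\<close>

proposition walk_cdf_le_sup_cdf:
  assumes ab: "0 \<le> a" "a < b" and \<delta>: "0 < \<delta>"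
  shows "\<forall>\<^sub>F n in sequentially. walk_cdf n a \<le> sup_cdf b + \<delta>"
proof -
  have "\<forall>\<^sub>F q in sequentially. BM.prob {x\<in>space P. \<forall>j\<in>{1..2 ^ q}. infnorm (W (real j / real (2 ^ q)) x) \<le> b} < sup_cdf b + \<delta> / 2"
    using ab \<delta> by (intro order_tendstoD(2)[OF skeleton_tendsto_sup_cdf]) auto
  then obtain q where q: "BM.prob {x\<in>space P. \<forall>j\<in>{1..2 ^ q}. infnorm (W (real j / real (2 ^ q)) x) \<le> b} < sup_cdf b + \<delta> / 2"
    by (meson eventually_sequentially order_refl)
  define m :: nat where "m = 2 ^ q"
  have m: "1 \<le> m" unfolding m_def by simp
  interpret C: converging_char_functions M P "{1..m}" "\<lambda>n j x. (1 / sqrt (real n)) *\<^sub>R walk \<omega> (j * (n div m)) x" "\<lambda>j. W (real j / real m)"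
    by (rule skeletons_converge[OF m])
  have "\<forall>\<^sub>F n in sequentially. prob {x\<in>space M. \<forall>j\<in>{1..m}. infnorm ((1 / sqrt (real n)) *\<^sub>R walk \<omega> (j * (n div m)) x) \<le> a}
      \<le> BM.prob {x\<in>space P. \<forall>j\<in>{1..m}. infnorm (W (real j / real m) x) \<le> b} + \<delta> / 2"
    using \<delta> by (intro C.box_prob_sandwich(1) ab skeleton_tight) auto
  then show ?thesis
    using eventually_ge_at_top[of 1]
  proof eventually_elim
    case (elim n)
    have "walk_cdf n a \<le> prob {x\<in>space M. \<forall>j\<in>{1..m}. infnorm ((1 / sqrt (real n)) *\<^sub>R walk \<omega> (j * (n div m)) x) \<le> a}"
      unfolding walk_cdf_def
    proof (rule finite_measure_mono)
      show "{x\<in>space M. \<forall>k\<in>{1..n}. infnorm (walk \<omega> k x) \<le> a * sqrt (real n)} \<subseteq>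
        {x\<in>space M. \<forall>j\<in>{1..m}. infnorm ((1 / sqrt (real n)) *\<^sub>R walk \<omega> (j * (n div m)) x) \<le> a}"
      proof safe
        fix x j assume x: "\<forall>k\<in>{1..n}. infnorm (walk \<omega> k x) \<le> a * sqrt (real n)" and j: "j \<in> {1..m}"
        have "j * (n div m) \<le> m * (n div m)" using j by (intro mult_le_mono1) auto
        also have "\<dots> \<le> n" by simp
        finally have jn: "j * (n div m) \<le> n" .
        have "infnorm (walk \<omega> (j * (n div m)) x) \<le> a * sqrt (real n)"
        proof (cases "j * (n div m) = 0")
          case True
          then show ?thesis using ab by (simp add: walk_def infnorm_0)
        next
          case False
          then show ?thesis using x jn by auto
        qed
        then show "infnorm ((1 / sqrt (real n)) *\<^sub>R walk \<omega> (j * (n div m)) x) \<le> a"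
          using elim by (simp add: infnorm_mul pos_divide_le_eq)
      qed
      show "{x\<in>space M. \<forall>j\<in>{1..m}. infnorm ((1 / sqrt (real n)) *\<^sub>R walk \<omega> (j * (n div m)) x) \<le> a} \<in> events"
        by (auto intro!: sets.sets_Collect_finite_All)
    qed
    then show ?case using elim(1) q[folded m_def] by linarith
  qed
qed

lemma oscillation_bound_tendsto_0:
  assumes "0 < (c :: real)"
  shows "(\<lambda>q. real (2 ^ q + 1) * (C * exp (- (c * real (2 ^ q))))) \<longlonglongrightarrow> 0"
proof -
  have "((\<lambda>y :: real. y ^ 1 / exp y) \<longlongrightarrow> 0) at_top" by (rule tendsto_power_div_exp_0)
  moreover have at_top: "filterlim (\<lambda>q. c * 2 ^ q :: real) at_top sequentially"
  proof (rule filterlim_tendsto_pos_mult_at_top[OF tendsto_const assms])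
    show "filterlim (\<lambda>q. 2 ^ q :: real) at_top sequentially"
      by (rule filterlim_at_top_mono[OF filterlim_real_sequentially])
        (intro always_eventually allI less_imp_le of_nat_less_two_power)
  qed
  ultimately have 1: "(\<lambda>q. (c * 2 ^ q) ^ 1 / exp (c * 2 ^ q)) \<longlonglongrightarrow> 0"
    by (rule filterlim_compose)
  have 2: "(\<lambda>q. exp (- (c * 2 ^ q))) \<longlonglongrightarrow> 0"
    by (intro filterlim_compose[OF exp_at_bot] filterlim_compose[OF filterlim_uminus_at_bot_at_top] at_top)
  have "(\<lambda>q. C / c * ((c * 2 ^ q) ^ 1 / exp (c * 2 ^ q)) + C * exp (- (c * 2 ^ q))) \<longlonglongrightarrow> C / c * 0 + C * 0"
    by (intro tendsto_add tendsto_mult tendsto_const 1 2)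
  also have "(\<lambda>q. C / c * ((c * 2 ^ q) ^ 1 / exp (c * 2 ^ q)) + C * exp (- (c * 2 ^ q))) =
     (\<lambda>q. real (2 ^ q + 1) * (C * exp (- (c * real (2 ^ q)))))"
    using assms by (simp add: fun_eq_iff exp_minus field_simps)
  finally show ?thesis by simp
qed

text \<open>
  Half of the gap \<open>b - a\<close> is spent on the passage from the Brownian motion to the walk on the grid,
  the other half on the oscillation of the walk between the grid points.
\<close>

proposition sup_cdf_le_walk_cdf:
  assumes ab: "0 \<le> a" "a < b" and \<delta>: "0 < \<delta>"
  shows "\<forall>\<^sub>F n in sequentially. sup_cdf a - \<delta> \<le> walk_cdf n b"
proof -
  define \<epsilon> where "\<epsilon> = (b - a) / 4"
  have \<epsilon>: "0 < \<epsilon>" unfolding \<epsilon>_def using ab by simp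
  have "\<forall>\<^sub>F q in sequentially. real (2 ^ q + 1) * ((4 * real CARD('n)) * exp (- (\<epsilon>\<^sup>2 / 2 * real (2 ^ q)))) < \<delta> / 2"
    using \<epsilon> \<delta> by (intro order_tendstoD(2)[OF oscillation_bound_tendsto_0]) auto
  then obtain q where q: "real (2 ^ q + 1) * ((4 * real CARD('n)) * exp (- (\<epsilon>\<^sup>2 / 2 * real (2 ^ q)))) < \<delta> / 2"
    by (meson eventually_sequentially order_refl)
  define m :: nat where "m = 2 ^ q"
  have m: "1 \<le> m" unfolding m_def by simp
  interpret C: converging_char_functions M P "{1..m}" "\<lambda>n j x. (1 / sqrt (real n)) *\<^sub>R walk \<omega> (j * (n div m)) x" "\<lambda>j. W (real j / real m)"
    by (rule skeletons_converge[OF m])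
  have "\<forall>\<^sub>F n in sequentially. BM.prob {x\<in>space P. \<forall>j\<in>{1..m}. infnorm (W (real j / real m) x) \<le> a} - \<delta> / 2
     \<le> prob {x\<in>space M. \<forall>j\<in>{1..m}. infnorm ((1 / sqrt (real n)) *\<^sub>R walk \<omega> (j * (n div m)) x) \<le> a + 2 * \<epsilon>}"
    using \<delta> \<epsilon> by (intro C.box_prob_sandwich(2) ab skeleton_tight) auto
  then show ?thesis
    \<comment> \<open>For \<open>n \<ge> m * m\<close> the remainder \<open>n mod m < m\<close> fits into one more block of length \<open>n div m \<ge> m\<close>.\<close>
    using eventually_ge_at_top[of "m * m"]
  proof eventually_elim
    case (elim n)
    define k where "k = n div m"
    have k: "1 \<le> k" "m * k \<le> n" "n < m * k + k"
    proof -
      have "m * m div m \<le> n div m" using elim by (intro div_le_mono)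
      then have mk: "m \<le> k" unfolding k_def using m by simp
      then show "1 \<le> k" using m by linarith
      show "m * k \<le> n" unfolding k_def by simp
      have "n < m * k + m"
        unfolding k_def using m dividend_less_times_div[of m n] by simp
      then show "n < m * k + k" using mk by linarith
    qed
    let ?S = "{x\<in>space M. \<forall>j\<in>{1..m}. infnorm ((1 / sqrt (real n)) *\<^sub>R walk \<omega> (j * k) x) \<le> a + 2 * \<epsilon>}"
    let ?O = "{x\<in>space M. \<exists>j\<in>{..m}. \<exists>t\<in>{j * k<..j * k + k}. 2 * (\<epsilon> * sqrt (real n)) < infnorm (walk \<omega> t x - walk \<omega> (j * k) x)}"
    let ?T = "{x\<in>space M. \<forall>t\<in>{1..n}. infnorm (walk \<omega> t x) \<le> b * sqrt (real n)}"
    have O: "?O \<in> events" by (auto intro!: sets.sets_Collect_finite_Ex)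
    have "prob ?S \<le> prob (?T \<union> ?O)"
    proof (rule finite_measure_mono)
      show "?S \<subseteq> ?T \<union> ?O"
      proof
        fix x assume x: "x \<in> ?S"
        show "x \<in> ?T \<union> ?O"
        proof (cases "x \<in> ?O")
          case False
          have "infnorm (walk \<omega> t x) \<le> (a + 2 * \<epsilon>) * sqrt (real n) + 2 * (\<epsilon> * sqrt (real n))" if t: "t \<in> {1..n}" for t
          proof (rule skeleton_and_oscillation_imp_walk_bound[OF k(3,1) _ _ _ t])
            show "0 \<le> (a + 2 * \<epsilon>) * sqrt (real n)" using ab \<epsilon> by simp
            show "infnorm (walk \<omega> (j * k) x) \<le> (a + 2 * \<epsilon>) * sqrt (real n)" if "j \<in> {1..m}" for j
              using x that t by (auto simp: infnorm_mul pos_divide_le_eq)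
            show "infnorm (walk \<omega> t x - walk \<omega> (j * k) x) \<le> 2 * (\<epsilon> * sqrt (real n))"
              if "j \<le> m" "t \<in> {j * k<..j * k + k}" for j t
              using False x that by (auto simp: not_less)
          qed
          moreover have "(a + 2 * \<epsilon>) * sqrt (real n) + 2 * (\<epsilon> * sqrt (real n)) = b * sqrt (real n)"
            unfolding \<epsilon>_def by (simp add: field_simps)
          ultimately show ?thesis using x by auto
        qed simp
      qed
    qed (use O walk_events(1) in auto)
    also have "\<dots> \<le> prob ?T + prob ?O" using O walk_events(1) by (intro measure_Un_le) auto
    also have "prob ?O \<le> real (m + 1) * (4 * real CARD('n) * exp (- (\<epsilon>\<^sup>2 * real m / 2)))"
      by (rule walk_oscillation_tail[OF k(1) m k(2) \<epsilon>])
    also have "\<dots> < \<delta> / 2" using q by (simp add: m_def)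
    finally have "prob ?S < walk_cdf n b + \<delta> / 2" unfolding walk_cdf_def by simp
    moreover have "sup_cdf a \<le> BM.prob {x\<in>space P. \<forall>j\<in>{1..m}. infnorm (W (real j / real m) x) \<le> a}"
      unfolding m_def by (rule sup_cdf_le_skeleton[OF ab(1)])
    ultimately show ?case using elim(1) unfolding k_def by linarith
  qed
qed

end

section \<open>Brownian scaling and the moments of the maximum\<close>

lemma (in prob_space) centered_normal_scale:
  assumes Y: "centered_normal Y" and r: "(r :: real) \<noteq> 0"
  shows "centered_normal (\<lambda>x. r * Y x)"
proof -
  have "(AE x in M. Y x = 0) \<or> (\<exists>\<sigma>>0. distributed M lborel Y (normal_density 0 \<sigma>))"
    using Y unfolding centered_normal_def by simp
  then have "(AE x in M. r * Y x = 0) \<or> (\<exists>\<sigma>>0. distributed M lborel (\<lambda>x. r * Y x) (normal_density 0 \<sigma>))"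
  proof
    assume "\<exists>\<sigma>>0. distributed M lborel Y (normal_density 0 \<sigma>)"
    then obtain \<sigma> where "0 < \<sigma>" "distributed M lborel Y (normal_density 0 \<sigma>)" by blast
    then have "distributed M lborel (\<lambda>x. 0 + r * Y x) (normal_density (0 + r * 0) (\<bar>r\<bar> * \<sigma>))"
      using r by (intro normal_density_affine) auto
    then show ?thesis using r \<open>0 < \<sigma>\<close> by (intro disjI2 exI[of _ "\<bar>r\<bar> * \<sigma>"]) auto
  qed auto
  then show ?thesis using Y unfolding centered_normal_def by auto
qed

lemma (in prob_space) centered_gaussian_vector_scale:
  fixes X :: "'a \<Rightarrow> real ^ 'n"
  assumes X: "centered_gaussian_vector X \<Sigma>" and r: "r \<noteq> 0"
  shows "centered_gaussian_vector (\<lambda>x. r *\<^sub>R X x) (r\<^sup>2 *\<^sub>R \<Sigma>)"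
proof -
  have [measurable]: "X \<in> borel_measurable M" and normal: "\<And>u. centered_normal (\<lambda>x. u \<bullet> X x)"
    and cov: "\<And>i j. expectation (\<lambda>x. X x $ i * X x $ j) = \<Sigma> $ i $ j"
    using X unfolding centered_gaussian_vector_def by auto
  have "centered_normal (\<lambda>x. u \<bullet> (r *\<^sub>R X x))" for u
    using centered_normal_scale[OF normal[of u] r] by simp
  moreover have "expectation (\<lambda>x. (r *\<^sub>R X x) $ i * (r *\<^sub>R X x) $ j) = (r\<^sup>2 *\<^sub>R \<Sigma>) $ i $ j" for i j
  proof -
    have "(\<lambda>x. (r *\<^sub>R X x) $ i * (r *\<^sub>R X x) $ j) = (\<lambda>x. r\<^sup>2 * (X x $ i * X x $ j))"
      by (simp add: fun_eq_iff power2_eq_square)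
    then show ?thesis using cov by simp
  qed
  ultimately show ?thesis unfolding centered_gaussian_vector_def by auto
qed

lemma brownian_scaling:
  fixes W :: "real \<Rightarrow> 'b \<Rightarrow> real ^ 'n"
  assumes W: "brownian_motion P W \<Sigma>" and c: "0 < c"
  shows "brownian_motion P (\<lambda>s x. (1 / sqrt c) *\<^sub>R W (c * s) x) \<Sigma>"
proof -
  interpret brownian_motion P W \<Sigma> by fact
  show ?thesis
  proof unfold_locales
    show "random_variable borel (\<lambda>x. (1 / sqrt c) *\<^sub>R W (c * s) x)" if "0 \<le> s" for s
      using that c by (intro borel_measurable_scaleR borel_measurable_const measurable_W) auto
    show "AE x in P. (1 / sqrt c) *\<^sub>R W (c * 0) x = 0" using start by simp
    show "AE x in P. continuous_on {0..} (\<lambda>s. (1 / sqrt c) *\<^sub>R W (c * s) x)"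
      using continuous_paths
    proof eventually_elim
      case (elim x)
      have "continuous_on {0..} ((\<lambda>s. W s x) \<circ> (\<lambda>s. c * s))"
        using c by (intro continuous_on_compose continuous_intros continuous_on_subset[OF elim]) auto
      then show ?case by (auto simp: comp_def intro!: continuous_intros)
    qed
    show "indep_vars (\<lambda>_. borel) (\<lambda>i x. (1 / sqrt c) *\<^sub>R W (c * t (Suc i)) x - (1 / sqrt c) *\<^sub>R W (c * t i) x) {..<k}"
      if "0 \<le> t 0" "\<And>i. i < k \<Longrightarrow> t i < t (Suc i)" for t :: "nat \<Rightarrow> real" and k
    proof -
      have "indep_vars (\<lambda>_. borel) (\<lambda>i x. W (c * t (Suc i)) x - W (c * t i) x) {..<k}"
        using that c by (intro indep_increments) auto
      then have "indep_vars (\<lambda>_. borel) (\<lambda>i x. (1 / sqrt c) *\<^sub>R (W (c * t (Suc i)) x - W (c * t i) x)) {..<k}"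
        by (rule indep_vars_compose2) auto
      then show ?thesis by (simp only: scaleR_right_diff_distrib)
    qed
    show "centered_gaussian_vector (\<lambda>x. (1 / sqrt c) *\<^sub>R W (c * (s + h)) x - (1 / sqrt c) *\<^sub>R W (c * s) x) (h *\<^sub>R \<Sigma>)"
      if "0 \<le> s" "0 \<le> h" for s h
    proof -
      have "centered_gaussian_vector (\<lambda>x. W (c * s + c * h) x - W (c * s) x) ((c * h) *\<^sub>R \<Sigma>)"
        using that c by (intro gaussian_increments) auto
      then have "centered_gaussian_vector (\<lambda>x. (1 / sqrt c) *\<^sub>R (W (c * s + c * h) x - W (c * s) x))
          ((1 / sqrt c)\<^sup>2 *\<^sub>R ((c * h) *\<^sub>R \<Sigma>))"
        by (rule centered_gaussian_vector_scale) (use c in simp)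
      also have "(1 / sqrt c)\<^sup>2 *\<^sub>R ((c * h) *\<^sub>R \<Sigma>) = h *\<^sub>R \<Sigma>"
        using c by (simp add: power_divide)
      finally show ?thesis by (simp only: scaleR_right_diff_distrib distrib_left)
    qed
  qed
qed

text \<open>
  Both laws are limits of the same sequence \<open>walk_cdf\<close>, hence they interlace.
\<close>

lemma sup_cdf_universal:
  assumes "walk_and_brownian M \<omega> P W" "walk_and_brownian M \<omega> P' W'" and ab: "0 \<le> a" "a < b"
  shows "walk_and_brownian.sup_cdf P W a \<le> walk_and_brownian.sup_cdf P' W' b"
proof -
  interpret A: walk_and_brownian M \<omega> P W by fact
  interpret B: walk_and_brownian M \<omega> P' W' by fact
  show ?thesis
  proof (rule field_le_epsilon)
    fix e :: real assume e: "0 < e"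
    have "\<forall>\<^sub>F n in sequentially. A.sup_cdf a - e / 2 \<le> A.walk_cdf n ((a + b) / 2)"
      using ab e by (intro A.sup_cdf_le_walk_cdf) auto
    moreover have "\<forall>\<^sub>F n in sequentially. A.walk_cdf n ((a + b) / 2) \<le> B.sup_cdf b + e / 2"
      using ab e by (intro B.walk_cdf_le_sup_cdf) auto
    ultimately have "\<forall>\<^sub>F n in sequentially. A.sup_cdf a \<le> B.sup_cdf b + e"
      by eventually_elim linarith
    then show "A.sup_cdf a \<le> B.sup_cdf b + e" by simp
  qed
qed

context walk_and_brownian
begin

lemma walk_cdf_mono: "a \<le> b \<Longrightarrow> walk_cdf n a \<le> walk_cdf n b"
  unfolding walk_cdf_def using walk_events(1)[of n "b * sqrt (real n)"]
  by (intro finite_measure_mono) (auto intro: order_trans mult_right_mono)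

lemma borel_measurable_walk_cdf [measurable]: "walk_cdf n \<in> borel_measurable borel"
  by (intro borel_measurable_mono monoI walk_cdf_mono)

lemma borel_measurable_sup_cdf [measurable]: "sup_cdf \<in> borel_measurable borel"
  by (intro borel_measurable_mono monoI sup_cdf_mono)

lemma countable_sup_cdf_discontinuities: "countable {a. \<not> isCont sup_cdf a}"
  by (intro mono_ctble_discont monoI sup_cdf_mono)

text \<open>
  Monotonicity in the radius upgrades convergence at a continuity point to convergence along moving
  radii, which is the form required by the exit times.
\<close>

lemma walk_cdf_tendsto:
  assumes n: "filterlim n at_top sequentially" and a: "a \<longlonglongrightarrow> a0" "0 < a0" and cont: "isCont sup_cdf a0"
  shows "(\<lambda>k. walk_cdf (n k) (a k)) \<longlonglongrightarrow> sup_cdf a0"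
proof (rule tendstoI)
  fix e :: real assume e: "0 < e"
  obtain d' where d': "0 < d'" "\<And>y. \<bar>y - a0\<bar> < d' \<Longrightarrow> \<bar>sup_cdf y - sup_cdf a0\<bar> < e / 2"
    using cont e unfolding continuous_at_eps_delta by (metis dist_real_def half_gt_zero)
  define d where "d = min (d' / 2) (a0 / 2)"
  have d: "0 < d" "d < d'" "d < a0" unfolding d_def using d' a by auto
  have "\<forall>\<^sub>F k in sequentially. walk_cdf (n k) (a0 + d / 2) \<le> sup_cdf (a0 + d) + e / 2"
    using d a e by (intro eventually_compose_filterlim[OF _ n] walk_cdf_le_sup_cdf) auto
  moreover have "\<forall>\<^sub>F k in sequentially. sup_cdf (a0 - d) - e / 2 \<le> walk_cdf (n k) (a0 - d / 2)"
    using d a e by (intro eventually_compose_filterlim[OF _ n] sup_cdf_le_walk_cdf) auto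
  moreover have "\<forall>\<^sub>F k in sequentially. a k \<in> {a0 - d / 2<..<a0 + d / 2}"
    using d by (intro topological_tendstoD[OF a(1)]) auto
  ultimately show "\<forall>\<^sub>F k in sequentially. dist (walk_cdf (n k) (a k)) (sup_cdf a0) < e"
  proof eventually_elim
    case (elim k)
    have "walk_cdf (n k) (a0 - d / 2) \<le> walk_cdf (n k) (a k)" "walk_cdf (n k) (a k) \<le> walk_cdf (n k) (a0 + d / 2)"
      using elim by (auto intro!: walk_cdf_mono)
    moreover have "\<bar>sup_cdf (a0 + d) - sup_cdf a0\<bar> < e / 2" "\<bar>sup_cdf (a0 - d) - sup_cdf a0\<bar> < e / 2"
      using d by (intro d'(2); simp)+
    ultimately show ?case using elim unfolding dist_real_def by linarith
  qed
qed

lemma scaled_brownian: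
  assumes "0 < c"
  shows "walk_and_brownian M \<omega> P (\<lambda>s x. (1 / sqrt c) *\<^sub>R W (c * s) x)"
proof -
  have walk: "simple_random_walk M \<omega>" and "brownian_motion P W ((1 / real CARD('n)) *\<^sub>R mat 1)"
    by unfold_locales
  from brownian_scaling[OF this(2) assms] show ?thesis
    by (rule walk_and_brownian.intro[OF walk])
qed

lemma sup_cdf_scaling:
  assumes c: "0 < c" and ab: "0 \<le> a" "a < b"
  shows "BM.prob {x\<in>space P. dyadic_sup (\<lambda>s x. (1 / sqrt c) *\<^sub>R W (c * s) x) x \<le> ennreal a} \<le> sup_cdf b"
    and "sup_cdf a \<le> BM.prob {x\<in>space P. dyadic_sup (\<lambda>s x. (1 / sqrt c) *\<^sub>R W (c * s) x) x \<le> ennreal b}"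
proof -
  have W: "walk_and_brownian M \<omega> P W" by unfold_locales
  note scaled = scaled_brownian[OF c]
  show "BM.prob {x\<in>space P. dyadic_sup (\<lambda>s x. (1 / sqrt c) *\<^sub>R W (c * s) x) x \<le> ennreal a} \<le> sup_cdf b"
    using sup_cdf_universal[OF scaled W ab] unfolding walk_and_brownian.sup_cdf_def[OF scaled] .
  show "sup_cdf a \<le> BM.prob {x\<in>space P. dyadic_sup (\<lambda>s x. (1 / sqrt c) *\<^sub>R W (c * s) x) x \<le> ennreal b}"
    using sup_cdf_universal[OF W scaled ab] unfolding walk_and_brownian.sup_cdf_def[OF scaled] .
qed

text \<open>
  Combined with \<open>walk_max_moment\<close> below, this turns the convergence of moments into the convergence of
  one-dimensional integrals.
\<close>

lemma process_max_moment:
  assumes p: "0 < p"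
  shows "(\<integral>\<^sup>+x. ennreal_powr (process_max W x) p \<partial>P) =
    (\<integral>\<^sup>+u. ennreal (p * u powr (p - 1) * indicator {0<..} u * (1 - sup_cdf u)) \<partial>lborel)"
proof -
  have "(\<integral>\<^sup>+x. ennreal_powr (process_max W x) p \<partial>P) = (\<integral>\<^sup>+x. ennreal_powr (dyadic_sup W x) p \<partial>P)"
    by (rule nn_integral_cong_AE)
      (use BM.continuous_paths in \<open>eventually_elim; simp add: continuous_path_sup_eq_dyadic_sup\<close>)
  also have "\<dots> = (\<integral>\<^sup>+u. ennreal (p * u powr (p - 1) * indicator {0<..} u * BM.prob {x\<in>space P. ennreal u < dyadic_sup W x}) \<partial>lborel)"
    by (rule BM.nn_integral_powr_layer_cake[OF dyadic_sup_measurable p])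
  also have "(\<lambda>u. BM.prob {x\<in>space P. ennreal u < dyadic_sup W x}) = (\<lambda>u. 1 - sup_cdf u)"
  proof
    fix u
    have "BM.prob (space P - {x\<in>space P. dyadic_sup W x \<le> ennreal u}) = 1 - sup_cdf u"
      unfolding sup_cdf_def by (rule BM.prob_compl) measurable
    also have "space P - {x\<in>space P. dyadic_sup W x \<le> ennreal u} = {x\<in>space P. ennreal u < dyadic_sup W x}"
      by auto
    finally show "BM.prob {x\<in>space P. ennreal u < dyadic_sup W x} = 1 - sup_cdf u" .
  qed
  finally show ?thesis .
qed

lemma walk_max_moment:
  assumes p: "0 < p" and t: "1 \<le> t"
  shows "(\<integral>\<^sup>+x. ennreal (walk_max \<omega> t x powr p) \<partial>M) / ennreal (real t powr (p / 2)) =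
    (\<integral>\<^sup>+u. ennreal (p * u powr (p - 1) * indicator {0<..} u * (1 - walk_cdf t u)) \<partial>lborel)"
proof -
  have [measurable]: "walk_max \<omega> t \<in> borel_measurable M"
    unfolding walk_max_def by (intro borel_measurable_Max) auto
  have nonneg: "0 \<le> walk_max \<omega> t x" for x
  proof -
    have "infnorm (walk \<omega> 1 x) \<le> walk_max \<omega> t x" unfolding walk_max_def using t by (intro Max_ge) auto
    then show ?thesis using infnorm_pos_le[of "walk \<omega> 1 x"] by linarith
  qed
  have le_iff: "walk_max \<omega> t x \<le> r \<longleftrightarrow> (\<forall>k\<in>{1..t}. infnorm (walk \<omega> k x) \<le> r)" for r x
    unfolding walk_max_def using t by (subst Max_le_iff) auto
  have sqrt_t: "0 < sqrt (real t)" using t by simp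
  have "(\<integral>\<^sup>+x. ennreal (walk_max \<omega> t x powr p) \<partial>M) / ennreal (real t powr (p / 2)) =
    (\<integral>\<^sup>+x. ennreal (walk_max \<omega> t x powr p) / ennreal (real t powr (p / 2)) \<partial>M)"
    by (rule nn_integral_divide[symmetric]) measurable
  also have "\<dots> = (\<integral>\<^sup>+x. ennreal_powr (ennreal (walk_max \<omega> t x) / ennreal (sqrt (real t))) p \<partial>M)"
    unfolding ennreal_powr_divide[OF sqrt_t]
    using nonneg t by (simp add: ennreal_powr_def powr_half_sqrt[symmetric] powr_powr)
  also have "\<dots> = (\<integral>\<^sup>+u. ennreal (p * u powr (p - 1) * indicator {0<..} u *
      prob {x\<in>space M. ennreal u < ennreal (walk_max \<omega> t x) / ennreal (sqrt (real t))}) \<partial>lborel)"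
    by (rule nn_integral_powr_layer_cake[OF _ p]) measurable
  also have "\<dots> = (\<integral>\<^sup>+u. ennreal (p * u powr (p - 1) * indicator {0<..} u * (1 - walk_cdf t u)) \<partial>lborel)"
  proof (rule nn_integral_cong)
    fix u :: real
    show "ennreal (p * u powr (p - 1) * indicator {0<..} u *
      prob {x\<in>space M. ennreal u < ennreal (walk_max \<omega> t x) / ennreal (sqrt (real t))}) =
      ennreal (p * u powr (p - 1) * indicator {0<..} u * (1 - walk_cdf t u))"
    proof (cases "0 < u")
      case True
      have "prob (space M - {x\<in>space M. \<forall>k\<in>{1..t}. infnorm (walk \<omega> k x) \<le> u * sqrt (real t)}) = 1 - walk_cdf t u"
        unfolding walk_cdf_def by (rule prob_compl[OF walk_events(1)])
      also have "space M - {x\<in>space M. \<forall>k\<in>{1..t}. infnorm (walk \<omega> k x) \<le> u * sqrt (real t)} =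
        {x\<in>space M. ennreal u < ennreal (walk_max \<omega> t x) / ennreal (sqrt (real t))}"
      proof -
        have "ennreal u < ennreal (walk_max \<omega> t x) / ennreal (sqrt (real t)) \<longleftrightarrow> \<not> walk_max \<omega> t x \<le> u * sqrt (real t)" for x
          using True nonneg sqrt_t by (simp add: divide_ennreal ennreal_less_iff pos_less_divide_eq not_le)
        then show ?thesis unfolding le_iff by blast
      qed
      finally show ?thesis by simp
    qed simp
  qed
  finally show ?thesis .
qed

lemma walk_cdf_tail:
  assumes t: "1 \<le> t" and u: "0 < u"
  shows "1 - walk_cdf t u \<le> 4 * real CARD('n) * exp 2 * exp (- 1 * u)"
proof -
  have "prob (space M - {x\<in>space M. \<forall>k\<in>{1..t}. infnorm (walk \<omega> k x) \<le> u * sqrt (real t)}) = 1 - walk_cdf t u"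
    unfolding walk_cdf_def by (rule prob_compl[OF walk_events(1)])
  also have "space M - {x\<in>space M. \<forall>k\<in>{1..t}. infnorm (walk \<omega> k x) \<le> u * sqrt (real t)} =
    {x\<in>space M. \<exists>k\<in>{1..t}. u * sqrt (real t) < infnorm (walk \<omega> k x)}" by (auto simp: not_le)
  finally have "1 - walk_cdf t u \<le> 4 * real CARD('n) * exp (- (u\<^sup>2 / 8))"
    using walk_max_tail[OF u t] by simp
  also have "exp (- (u\<^sup>2 / 8)) \<le> exp (2 + (- 1 * u))"
  proof -
    \<comment> \<open>This square shows \<open>u\<^sup>2 / 8 \<ge> u - 2\<close>, which trades the Gaussian tail for an exponential one.\<close>
    have "0 \<le> (u - 4)\<^sup>2" by simp
    then show ?thesis by (simp add: power2_eq_square algebra_simps)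
  qed
  then have "4 * real CARD('n) * exp (- (u\<^sup>2 / 8)) \<le> 4 * real CARD('n) * exp (2 + (- 1 * u))"
    by (intro mult_left_mono) auto
  finally show ?thesis by (simp only: exp_add mult.assoc)
qed

lemma AE_isCont_sup_cdf: "AE u in lborel. isCont sup_cdf u"
  using countable_imp_null_set_lborel[OF countable_sup_cdf_discontinuities] by (auto intro: AE_I'[rotated])

proposition max_moments_converge:
  assumes p: "0 < p"
  shows "(\<lambda>t. (\<integral>\<^sup>+x. ennreal (walk_max \<omega> t x powr p) \<partial>M) / ennreal (real t powr (p / 2)))
      \<longlonglongrightarrow> (\<integral>\<^sup>+x. ennreal_powr (process_max W x) p \<partial>P)"
    and "(\<integral>\<^sup>+x. ennreal_powr (process_max W x) p \<partial>P) < \<infinity>"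
proof -
  have dom: "\<forall>\<^sub>F t in sequentially. \<forall>u>0. 1 - walk_cdf t u \<le> 4 * real CARD('n) * exp 2 * exp (- 1 * u)"
    using eventually_ge_at_top[of 1] by eventually_elim (intro allI impI walk_cdf_tail)
  have lim: "AE u in lborel. 0 < u \<longrightarrow> (\<lambda>t. 1 - walk_cdf t u) \<longlonglongrightarrow> 1 - sup_cdf u"
    using AE_isCont_sup_cdf
    by eventually_elim (auto intro!: tendsto_diff walk_cdf_tendsto filterlim_ident)
  note conv = tail_integrals_converge[OF p zero_less_one _ _ dom lim]
  have "(\<lambda>t. \<integral>\<^sup>+u. ennreal (p * u powr (p - 1) * indicator {0<..} u * (1 - walk_cdf t u)) \<partial>lborel)
    \<longlonglongrightarrow> (\<integral>\<^sup>+x. ennreal_powr (process_max W x) p \<partial>P)"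
    unfolding process_max_moment[OF p] by (rule conv(1)) measurable
  then show "(\<lambda>t. (\<integral>\<^sup>+x. ennreal (walk_max \<omega> t x powr p) \<partial>M) / ennreal (real t powr (p / 2)))
      \<longlonglongrightarrow> (\<integral>\<^sup>+x. ennreal_powr (process_max W x) p \<partial>P)"
    by (rule Lim_transform_eventually)
      (use eventually_ge_at_top[of 1] in \<open>eventually_elim; simp add: walk_max_moment[OF p]\<close>)
  show "(\<integral>\<^sup>+x. ennreal_powr (process_max W x) p \<partial>P) < \<infinity>"
    unfolding process_max_moment[OF p] by (rule conv(2)) measurable
qed

end

section \<open>Exit times of the walk\<close>

lemma Inf_setcompr_eq_INF_if:
  fixes f :: "'c \<Rightarrow> 'd :: complete_lattice"
  shows "Inf {f t | t. Q t} = (INF t. if Q t then f t else top)"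
proof (rule antisym)
  show "Inf {f t | t. Q t} \<le> (INF t. if Q t then f t else top)"
    by (rule INF_greatest) (auto intro: Inf_lower)
  show "(INF t. if Q t then f t else top) \<le> Inf {f t | t. Q t}"
  proof (rule Inf_greatest)
    fix y assume "y \<in> {f t | t. Q t}"
    then obtain t where t: "y = f t" "Q t" by blast
    have "(INF t. if Q t then f t else top) \<le> (if Q t then f t else top)" by (rule INF_lower) simp
    then show "(INF t. if Q t then f t else top) \<le> y" using t by simp
  qed
qed

context simple_random_walk
begin

text \<open>
  Being a countable infimum over conditions on the norm, this is measurable.  It agrees almost surely with
  the exit time from the lattice ball, because the walk has integral coordinates.
\<close>

definition norm_exit_time :: "nat \<Rightarrow> 'a \<Rightarrow> ennreal" where
  "norm_exit_time r x = (INF t. if real r < infnorm (walk \<omega> t x) then of_nat t else top)"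

lemma norm_exit_time_measurable [measurable]: "norm_exit_time r \<in> borel_measurable M"
  unfolding norm_exit_time_def by measurable

lemma AE_walk_exit_time_eq: "AE x in M. \<forall>r. walk_exit_time \<omega> r x = norm_exit_time r x"
proof -
  have "AE x in M. \<forall>s. 1 \<le> s \<longrightarrow> \<omega> s x \<in> steps"
    unfolding AE_all_countable using AE_step by auto
  then show ?thesis
  proof eventually_elim
    case (elim x)
    have "\<omega> s x $ i \<in> \<int>" if "1 \<le> s" for s i
    proof -
      have "\<omega> s x \<in> steps" using elim that by blast
      then show ?thesis unfolding steps_def by (auto simp: axis_def)
    qed
    then have "walk \<omega> t x $ i \<in> \<int>" for t i
      unfolding walk_def sum_component by (intro Ints_sum) auto
    then have "walk \<omega> t x \<notin> lattice_ball r \<longleftrightarrow> real r < infnorm (walk \<omega> t x)" for t r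
      unfolding lattice_ball_def by auto
    then show ?case
      unfolding walk_exit_time_def norm_exit_time_def Inf_setcompr_eq_INF_if by simp
  qed
qed

text \<open>
  The time \<open>0\<close> is harmless because the walk starts inside every box.
\<close>

lemma less_norm_exit_time_iff:
  assumes v: "0 \<le> v"
  shows "ennreal v < norm_exit_time r x \<longleftrightarrow> (\<forall>t\<in>{1..nat \<lfloor>v\<rfloor>}. infnorm (walk \<omega> t x) \<le> real r)"
proof
  assume less: "ennreal v < norm_exit_time r x"
  show "\<forall>t\<in>{1..nat \<lfloor>v\<rfloor>}. infnorm (walk \<omega> t x) \<le> real r"
  proof (rule ballI, rule ccontr)
    fix t assume t: "t \<in> {1..nat \<lfloor>v\<rfloor>}" "\<not> infnorm (walk \<omega> t x) \<le> real r"
    have "norm_exit_time r x \<le> (if real r < infnorm (walk \<omega> t x) then of_nat t else top)"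
      unfolding norm_exit_time_def by (rule INF_lower) simp
    also have "\<dots> = ennreal (real t)" using t by (simp add: ennreal_of_nat_eq_real_of_nat)
    also have "\<dots> \<le> ennreal v"
    proof (rule ennreal_leI)
      have "int t \<le> \<lfloor>v\<rfloor>" using t v by auto
      then show "real t \<le> v" by (simp add: le_floor_iff)
    qed
    finally show False using less by simp
  qed
next
  assume inside: "\<forall>t\<in>{1..nat \<lfloor>v\<rfloor>}. infnorm (walk \<omega> t x) \<le> real r"
  have "ennreal v < ennreal (real (nat \<lfloor>v\<rfloor> + 1))"
  proof -
    have "v < real (nat \<lfloor>v\<rfloor> + 1)" using v by linarith
    then show ?thesis using v by (simp only: ennreal_less_iff)
  qed
  also have "\<dots> \<le> norm_exit_time r x"
    unfolding norm_exit_time_def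
  proof (rule INF_greatest)
    fix t
    show "ennreal (real (nat \<lfloor>v\<rfloor> + 1)) \<le> (if real r < infnorm (walk \<omega> t x) then of_nat t else top)"
    proof (cases "real r < infnorm (walk \<omega> t x)")
      case True
      have "t \<noteq> 0"
      proof
        assume "t = 0"
        then have "infnorm (walk \<omega> t x) = 0" by (simp add: walk_def infnorm_0)
        then show False using True by simp
      qed
      then have "nat \<lfloor>v\<rfloor> + 1 \<le> t" using inside True by (metis Suc_eq_plus1 Suc_leI atLeastAtMost_iff less_one linorder_not_le)
      then show ?thesis using True by (simp only: if_True ennreal_of_nat_eq_real_of_nat[symmetric] of_nat_le_iff)
    qed simp
  qed
  finally show "ennreal v < norm_exit_time r x" .
qed

text \<open>
  For \<open>\<lfloor>u * r\<^sup>2\<rfloor> = 0\<close> the radius on the right is a division by \<open>0\<close>, but then no time is left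
  in the definition of \<open>walk_cdf\<close>, whose value is \<open>1\<close> as it should be.
\<close>

lemma walk_exit_moment:
  assumes p: "0 < p" and r: "1 \<le> r"
  shows "(\<integral>\<^sup>+x. ennreal_powr (walk_exit_time \<omega> r x) p \<partial>M) / ennreal (real r powr (2 * p)) =
    (\<integral>\<^sup>+u. ennreal (p * u powr (p - 1) * indicator {0<..} u *
      walk_cdf (nat \<lfloor>u * (real r)\<^sup>2\<rfloor>) (real r / sqrt (real (nat \<lfloor>u * (real r)\<^sup>2\<rfloor>)))) \<partial>lborel)"
proof -
  have r2: "0 < (real r)\<^sup>2" using r by simp
  have powr_r2: "(real r)\<^sup>2 powr p = real r powr (2 * p)"
    using r by (simp add: powr_powr flip: powr_numeral)
  have "(\<integral>\<^sup>+x. ennreal_powr (walk_exit_time \<omega> r x) p \<partial>M) = (\<integral>\<^sup>+x. ennreal_powr (norm_exit_time r x) p \<partial>M)"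
    by (rule nn_integral_cong_AE) (use AE_walk_exit_time_eq in \<open>eventually_elim; simp\<close>)
  also have "\<dots> / ennreal (real r powr (2 * p)) = (\<integral>\<^sup>+x. ennreal_powr (norm_exit_time r x) p / ennreal (real r powr (2 * p)) \<partial>M)"
    unfolding ennreal_powr_def by (rule nn_integral_divide[symmetric]) measurable
  also have "\<dots> = (\<integral>\<^sup>+x. ennreal_powr (norm_exit_time r x / ennreal ((real r)\<^sup>2)) p \<partial>M)"
    unfolding ennreal_powr_divide[OF r2] powr_r2 ..
  also have "\<dots> = (\<integral>\<^sup>+u. ennreal (p * u powr (p - 1) * indicator {0<..} u *
      prob {x\<in>space M. ennreal u < norm_exit_time r x / ennreal ((real r)\<^sup>2)}) \<partial>lborel)"
    by (rule nn_integral_powr_layer_cake[OF _ p]) measurable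
  also have "\<dots> = (\<integral>\<^sup>+u. ennreal (p * u powr (p - 1) * indicator {0<..} u *
      walk_cdf (nat \<lfloor>u * (real r)\<^sup>2\<rfloor>) (real r / sqrt (real (nat \<lfloor>u * (real r)\<^sup>2\<rfloor>)))) \<partial>lborel)"
  proof (rule nn_integral_cong)
    fix u :: real
    let ?n = "nat \<lfloor>u * (real r)\<^sup>2\<rfloor>"
    show "ennreal (p * u powr (p - 1) * indicator {0<..} u *
      prob {x\<in>space M. ennreal u < norm_exit_time r x / ennreal ((real r)\<^sup>2)}) =
      ennreal (p * u powr (p - 1) * indicator {0<..} u * walk_cdf ?n (real r / sqrt (real ?n)))"
    proof (cases "0 < u")
      case True
      have "ennreal u < norm_exit_time r x / ennreal ((real r)\<^sup>2) \<longleftrightarrow> ennreal (u * (real r)\<^sup>2) < norm_exit_time r x" for x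
      proof (cases "norm_exit_time r x")
        case (real y)
        then show ?thesis using True r2 by (simp add: divide_ennreal ennreal_less_iff pos_less_divide_eq)
      next
        case top
        then show ?thesis by (simp add: ennreal_top_divide)
      qed
      then have "prob {x\<in>space M. ennreal u < norm_exit_time r x / ennreal ((real r)\<^sup>2)} =
          prob {x\<in>space M. \<forall>t\<in>{1..?n}. infnorm (walk \<omega> t x) \<le> real r}"
        using True by (simp add: less_norm_exit_time_iff)
      also have "\<dots> = walk_cdf ?n (real r / sqrt (real ?n))"
      proof (cases "?n = 0")
        case False
        then show ?thesis unfolding walk_cdf_def by simp
      next
        case True
        show ?thesis unfolding walk_cdf_def True by simp
      qed
      finally show ?thesis by simp
    qed simp
  qed
  finally show ?thesis .
qed

text \<open>
  Two points in the box of radius \<open>r\<close> differ by at most \<open>2 * r\<close>, and the increments over disjoint blocks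
  are independent.
\<close>

lemma prob_confined_le_power:
  assumes block: "\<And>l. prob {x\<in>space M. infnorm (walk \<omega> (Suc l * L) x - walk \<omega> (l * L) x) \<le> 2 * r} \<le> \<rho>"
    and J: "J * L \<le> n" and r: "0 \<le> r" and \<rho>: "0 \<le> \<rho>"
  shows "prob {x\<in>space M. \<forall>k\<in>{1..n}. infnorm (walk \<omega> k x) \<le> r} \<le> \<rho> ^ J"
proof (cases "J = 0")
  case False
  let ?D = "\<lambda>l x. 1 *\<^sub>R walk \<omega> (Suc l * L) x - 1 *\<^sub>R walk \<omega> (l * L) x"
  let ?A = "{y :: real ^ 'n. infnorm y \<le> 2 * r}"
  have A: "?A \<in> sets borel" by measurable
  have indep: "indep_vars (\<lambda>_. borel) ?D {..<J}" by (rule indep_block_increments)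
  have [measurable]: "(\<lambda>x. ?D l x) \<in> borel_measurable M" for l by measurable
  have "prob {x\<in>space M. \<forall>k\<in>{1..n}. infnorm (walk \<omega> k x) \<le> r} \<le> prob (\<Inter>l\<in>{..<J}. ?D l -` ?A \<inter> space M)"
  proof (rule finite_measure_mono)
    show "{x\<in>space M. \<forall>k\<in>{1..n}. infnorm (walk \<omega> k x) \<le> r} \<subseteq> (\<Inter>l\<in>{..<J}. ?D l -` ?A \<inter> space M)"
    proof (rule subsetI, rule INT_I)
      fix x l assume "x \<in> {x\<in>space M. \<forall>k\<in>{1..n}. infnorm (walk \<omega> k x) \<le> r}" and l: "l \<in> {..<J}"
      then have x: "x \<in> space M" "\<forall>k\<in>{1..n}. infnorm (walk \<omega> k x) \<le> r" by auto
      have inside: "infnorm (walk \<omega> (j * L) x) \<le> r" if "j \<le> J" for j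
      proof (cases "j * L = 0")
        case True
        have "infnorm (walk \<omega> 0 x) = 0" by (simp add: walk_def infnorm_0)
        then show ?thesis using r unfolding True by simp
      next
        case False
        have "j * L \<le> J * L" using that by simp
        then have "j * L \<le> n" using J by (rule order_trans)
        then show ?thesis using x False by auto
      qed
      have "infnorm (walk \<omega> (Suc l * L) x - walk \<omega> (l * L) x) \<le> infnorm (walk \<omega> (Suc l * L) x) + infnorm (walk \<omega> (l * L) x)"
        using infnorm_triangle[of "walk \<omega> (Suc l * L) x" "- walk \<omega> (l * L) x"] by (simp add: infnorm_neg)
      then have "infnorm (walk \<omega> (Suc l * L) x - walk \<omega> (l * L) x) \<le> 2 * r"
        using inside[of "Suc l"] inside[of l] l by simp
      then show "x \<in> ?D l -` ?A \<inter> space M" using x by simp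
    qed
    show "(\<Inter>l\<in>{..<J}. ?D l -` ?A \<inter> space M) \<in> events"
      using False A by (intro sets.finite_INT) (auto intro!: measurable_sets)
  qed
  also have "\<dots> = (\<Prod>l<J. prob (?D l -` ?A \<inter> space M))"
    using False A by (intro indep_varsD[OF indep]) auto
  also have "\<dots> \<le> (\<Prod>l<J. \<rho>)"
  proof (rule prod_mono, intro conjI)
    fix l
    have "?D l -` ?A \<inter> space M = {x\<in>space M. infnorm (walk \<omega> (Suc l * L) x - walk \<omega> (l * L) x) \<le> 2 * r}"
      by auto
    then show "prob (?D l -` ?A \<inter> space M) \<le> \<rho>" using block[of l] by simp
  qed simp
  finally show ?thesis by simp
qed simp

lemma walk_confinement_tail:
  assumes block: "\<And>l. prob {x\<in>space M. infnorm (walk \<omega> (Suc l * (c * r\<^sup>2)) x - walk \<omega> (l * (c * r\<^sup>2)) x) \<le> 2 * real r} \<le> \<rho>"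
    and c: "1 \<le> c" and r: "1 \<le> r" and \<rho>: "0 < \<rho>" "\<rho> < 1" and u: "0 < u"
  shows "walk_cdf (nat \<lfloor>u * (real r)\<^sup>2\<rfloor>) (real r / sqrt (real (nat \<lfloor>u * (real r)\<^sup>2\<rfloor>))) \<le>
     (1 / \<rho>\<^sup>2) * exp (- (- ln \<rho> / real c) * u)"
proof -
  define n where "n = nat \<lfloor>u * (real r)\<^sup>2\<rfloor>"
  define L where "L = c * r\<^sup>2"
  define J where "J = n div L"
  have L: "1 * 1 \<le> L" unfolding L_def using c r by (intro mult_le_mono) auto
  \<comment> \<open>Rounding \<open>u * r\<^sup>2\<close> down to \<open>n\<close> and then \<open>n / L\<close> down to \<open>J\<close> loses at most \<open>2\<close> blocks.\<close>
  have J_lower: "u / real c - 2 \<le> real J"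
  proof -
    have "u * (real r)\<^sup>2 < real n + 1" unfolding n_def using u by (simp add: of_nat_nat)
    moreover have "n < L * (J + 1)" unfolding J_def using L by (simp add: dividend_less_times_div)
    then have "n + 1 \<le> L * (J + 1)" by simp
    then have "real n + 1 \<le> real L * (real J + 1)" by (metis of_nat_le_iff of_nat_mult of_nat_add of_nat_1)
    ultimately have "u * (real r)\<^sup>2 \<le> (real c * (real J + 1)) * (real r)\<^sup>2" unfolding L_def by (simp add: algebra_simps)
    then have "u \<le> real c * (real J + 1)" using r by (simp only: mult_le_cancel_right) auto
    then show ?thesis using c by (simp add: field_simps)
  qed
  have "walk_cdf n (real r / sqrt (real n)) = prob {x\<in>space M. \<forall>t\<in>{1..n}. infnorm (walk \<omega> t x) \<le> real r}"
  proof (cases "n = 0")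
    case False
    then show ?thesis unfolding walk_cdf_def by simp
  next
    case True
    show ?thesis unfolding walk_cdf_def True by simp
  qed
  also have "\<dots> \<le> \<rho> ^ J"
    using block[folded L_def] \<rho> by (intro prob_confined_le_power[where L = L]) (auto simp: J_def)
  also have "\<dots> = exp (real J * ln \<rho>)" using \<rho> by (simp add: exp_of_nat_mult)
  also have "\<dots> \<le> exp ((u / real c - 2) * ln \<rho>)"
    using J_lower \<rho> by (auto intro!: mult_right_mono_neg)
  also have "\<dots> = (1 / \<rho>\<^sup>2) * exp (- (- ln \<rho> / real c) * u)"
  proof -
    have "exp (2 * ln \<rho>) = \<rho>\<^sup>2" using \<rho> by (simp add: exp_double)
    moreover have "(u / real c - 2) * ln \<rho> = - (- ln \<rho> / real c) * u - 2 * ln \<rho>" by (simp add: algebra_simps)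
    ultimately show ?thesis by (simp only: exp_diff) simp
  qed
  finally show ?thesis unfolding n_def .
qed

end

section \<open>Exit times of Brownian motion\<close>

text \<open>
  The complement of the closed box is open, so a continuous path that has left the box at time \<open>s\<close> is
  still outside at rational times slightly later than \<open>s\<close>.
\<close>

lemma process_exit_time_eq_rational:
  fixes W :: "real \<Rightarrow> 'b \<Rightarrow> real ^ 'n"
  assumes cont: "continuous_on {0..} (\<lambda>s. W s x)"
  shows "process_exit_time W x = (INF q\<in>{0..} \<inter> \<rat>. if W q x \<notin> unit_box then ennreal q else top)"
proof (rule antisym)
  show "process_exit_time W x \<le> (INF q\<in>{0..} \<inter> \<rat>. if W q x \<notin> unit_box then ennreal q else top)"
    unfolding process_exit_time_def by (rule INF_greatest) (auto intro: Inf_lower)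
  show "(INF q\<in>{0..} \<inter> \<rat>. if W q x \<notin> unit_box then ennreal q else top) \<le> process_exit_time W x"
    unfolding process_exit_time_def
  proof (rule Inf_greatest)
    fix y assume "y \<in> {ennreal s |s. 0 \<le> s \<and> W s x \<notin> unit_box}"
    then obtain s where s: "y = ennreal s" "0 \<le> s" "1 < infnorm (W s x)" by (auto simp: unit_box_def)
    show "(INF q\<in>{0..} \<inter> \<rat>. if W q x \<notin> unit_box then ennreal q else top) \<le> y"
      unfolding s(1)
    proof (rule ennreal_le_epsilon)
      fix e :: real assume e: "0 < e"
      have "continuous_on {0..} (\<lambda>s. infnorm (W s x))" using cont by (rule continuous_on_infnorm)
      then obtain d where d: "0 < d" "\<And>t. 0 \<le> t \<Longrightarrow> dist t s < d \<Longrightarrow> dist (infnorm (W t x)) (infnorm (W s x)) < infnorm (W s x) - 1"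
        using s unfolding continuous_on_iff by (metis atLeast_iff diff_gt_0_iff_gt)
      obtain q where q: "q \<in> \<rat>" "s < q" "q < s + min d e"
        using Rats_dense_in_real[of s "s + min d e"] d(1) e by auto
      have "dist (infnorm (W q x)) (infnorm (W s x)) < infnorm (W s x) - 1"
        using q s by (intro d(2)) (auto simp: dist_real_def)
      then have "W q x \<notin> unit_box" unfolding unit_box_def dist_real_def by auto
      then have "(INF q\<in>{0..} \<inter> \<rat>. if W q x \<notin> unit_box then ennreal q else top) \<le> ennreal q"
        using q s by (intro INF_lower2[of q]) auto
      also have "\<dots> \<le> ennreal s + ennreal e"
        using q s e by (simp add: ennreal_plus[symmetric] ennreal_leI del: ennreal_plus)
      finally show "(INF q\<in>{0..} \<inter> \<rat>. if W q x \<notin> unit_box then ennreal q else top) \<le> ennreal s + ennreal e" .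
    qed
  qed
qed

context walk_and_brownian
begin

definition rational_exit_time :: "'b \<Rightarrow> ennreal" where
  "rational_exit_time x = (INF q\<in>{0..} \<inter> \<rat>. if W q x \<notin> unit_box then ennreal q else top)"

lemma rational_exit_time_measurable [measurable]: "rational_exit_time \<in> borel_measurable P"
  unfolding rational_exit_time_def
proof (rule borel_measurable_INF)
  show "countable ({0..} \<inter> \<rat> :: real set)" using countable_rat by blast
  fix q :: real assume "q \<in> {0..} \<inter> \<rat>"
  then have [measurable]: "W q \<in> borel_measurable P" by simp
  have [measurable]: "unit_box \<in> sets (borel :: (real ^ 'n) measure)" unfolding unit_box_def by measurable
  show "(\<lambda>x. if W q x \<notin> unit_box then ennreal q else top) \<in> borel_measurable P" by measurable
qed

lemma AE_process_exit_time_eq: "AE x in P. process_exit_time W x = rational_exit_time x"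
  using BM.continuous_paths
  by eventually_elim (simp add: process_exit_time_eq_rational rational_exit_time_def)

text \<open>
  A path that leaves the unit box only after time \<open>u\<close> stays in the box until time \<open>u\<close>.  After Brownian
  scaling by \<open>u\<close> this is a statement about the maximum over the unit interval.
\<close>

lemma exit_prob_le:
  assumes u: "0 < u" and b: "1 / sqrt u < b"
  shows "BM.prob {x\<in>space P. ennreal u < rational_exit_time x} \<le> sup_cdf b"
proof -
  let ?V = "\<lambda>s x. (1 / sqrt u) *\<^sub>R W (u * s) x"
  have [measurable]: "dyadic_sup ?V \<in> borel_measurable P"
    by (rule walk_and_brownian.dyadic_sup_measurable[OF scaled_brownian[OF u]])
  have "BM.prob {x\<in>space P. ennreal u < rational_exit_time x} \<le> BM.prob {x\<in>space P. dyadic_sup ?V x \<le> ennreal (1 / sqrt u)}"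
  proof (rule BM.finite_measure_mono_AE)
    show "AE x in P. x \<in> {x\<in>space P. ennreal u < rational_exit_time x} \<longrightarrow> x \<in> {x\<in>space P. dyadic_sup ?V x \<le> ennreal (1 / sqrt u)}"
      using AE_process_exit_time_eq
    proof eventually_elim
      case (elim x)
      have "dyadic_sup ?V x \<le> ennreal (1 / sqrt u)" if late: "ennreal u < rational_exit_time x"
      proof -
        have "infnorm (?V (real j / 2 ^ q) x) \<le> 1 / sqrt u" if j: "j \<le> 2 ^ q" for j q
        proof -
          define s where "s = u * (real j / 2 ^ q)"
          have "real j \<le> 2 ^ q" using j by (metis of_nat_le_iff of_nat_numeral of_nat_power)
          then have "real j / 2 ^ q \<le> 1" by simp
          then have "u * (real j / 2 ^ q) \<le> u * 1" using u by (intro mult_left_mono) auto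
          then have s: "0 \<le> s" "s \<le> u" unfolding s_def using u by auto
          have "W s x \<in> unit_box"
          proof (rule ccontr)
            assume "W s x \<notin> unit_box"
            then have "process_exit_time W x \<le> ennreal s"
              unfolding process_exit_time_def using s by (intro Inf_lower) auto
            also have "\<dots> \<le> ennreal u" using s by (intro ennreal_leI)
            finally show False using late elim by simp
          qed
          then show ?thesis using u unfolding s_def unit_box_def by (simp add: infnorm_mul divide_right_mono)
        qed
        then show ?thesis using u by (subst dyadic_sup_le_iff) auto
      qed
      then show ?case by auto
    qed
    show "{x\<in>space P. dyadic_sup ?V x \<le> ennreal (1 / sqrt u)} \<in> BM.events" by measurable
  qed
  also have "\<dots> \<le> sup_cdf b" using u b by (intro sup_cdf_scaling(1)) auto
  finally show ?thesis .
qed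

text \<open>
  Staying in the box until time \<open>v\<close> only gives an exit time of at least \<open>v\<close>; to obtain a strict
  inequality, a time \<open>v\<close> slightly larger than \<open>u\<close> is used.
\<close>

lemma exit_prob_ge:
  assumes u: "0 < u" and a: "0 \<le> a" "a < 1 / sqrt u"
  shows "sup_cdf a \<le> BM.prob {x\<in>space P. ennreal u < rational_exit_time x}"
proof -
  obtain v where v: "u < v" "a < 1 / sqrt v"
  proof -
    have "isCont (\<lambda>v. 1 / sqrt v) u" using u by (intro continuous_intros) auto
    then have "((\<lambda>v. 1 / sqrt v) \<longlongrightarrow> 1 / sqrt u) (at_right u)"
      unfolding isCont_def by (rule tendsto_within_subset) simp
    then have "\<forall>\<^sub>F v in at_right u. a < 1 / sqrt v" using a by (intro order_tendstoD)
    then have "\<forall>\<^sub>F v in at_right u. u < v \<and> a < 1 / sqrt v"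
      using eventually_at_right_less by eventually_elim simp
    then show ?thesis using that eventually_happens'[OF trivial_limit_at_right_real] by blast
  qed
  then have v0: "0 < v" using u by simp
  let ?V = "\<lambda>s x. (1 / sqrt v) *\<^sub>R W (v * s) x"
  have "sup_cdf a \<le> BM.prob {x\<in>space P. dyadic_sup ?V x \<le> ennreal (1 / sqrt v)}"
    using v v0 a by (intro sup_cdf_scaling(2)) auto
  also have "\<dots> \<le> BM.prob {x\<in>space P. ennreal u < rational_exit_time x}"
  proof (rule BM.finite_measure_mono_AE)
    show "AE x in P. x \<in> {x\<in>space P. dyadic_sup ?V x \<le> ennreal (1 / sqrt v)} \<longrightarrow> x \<in> {x\<in>space P. ennreal u < rational_exit_time x}"
      using AE_process_exit_time_eq BM.continuous_paths
    proof eventually_elim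
      case (elim x)
      have "ennreal u < rational_exit_time x" if small: "dyadic_sup ?V x \<le> ennreal (1 / sqrt v)"
      proof -
        have bound: "infnorm (?V (real j / 2 ^ q) x) \<le> 1 / sqrt v" if "j \<le> 2 ^ q" for j q
          using small that v0 by (subst (asm) dyadic_sup_le_iff) auto
        have "continuous_on {0..1} ((\<lambda>s. W s x) \<circ> (\<lambda>s. v * s))"
          using v0 by (intro continuous_on_compose continuous_intros continuous_on_subset[OF elim(2)]) auto
        then have cont: "continuous_on {0..1} (\<lambda>s. infnorm (?V s x))"
          by (auto simp: comp_def intro!: continuous_on_infnorm continuous_intros)
        have inside: "W s x \<in> unit_box" if s: "0 \<le> s" "s \<le> v" for s
        proof -
          have "infnorm (?V (s / v) x) \<le> 1 / sqrt v"
            using s v0 by (intro dyadic_bound_imp_bound[OF cont bound]) auto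
          then show ?thesis using v0 unfolding unit_box_def by (simp add: infnorm_mul divide_le_cancel)
        qed
        have "ennreal v \<le> process_exit_time W x"
          unfolding process_exit_time_def
        proof (rule Inf_greatest)
          fix y assume "y \<in> {ennreal s |s. 0 \<le> s \<and> W s x \<notin> unit_box}"
          then obtain s where "y = ennreal s" "0 \<le> s" "W s x \<notin> unit_box" by blast
          then show "ennreal v \<le> y" using inside[of s] by (cases "s \<le> v") (auto intro: ennreal_leI)
        qed
        moreover have "ennreal u < ennreal v" using u v by (simp add: ennreal_less_iff)
        ultimately show ?thesis using elim by simp
      qed
      then show ?case by auto
    qed
  qed measurable
  finally show ?thesis .
qed

lemma exit_prob_eq:
  assumes u: "0 < u" and cont: "isCont sup_cdf (1 / sqrt u)"
  shows "BM.prob {x\<in>space P. ennreal u < rational_exit_time x} = sup_cdf (1 / sqrt u)"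
proof (rule antisym)
  have a: "0 < 1 / sqrt u" using u by simp
  have "(sup_cdf \<longlongrightarrow> sup_cdf (1 / sqrt u)) (at_right (1 / sqrt u))"
    using cont unfolding isCont_def by (rule tendsto_within_subset) simp
  then show "BM.prob {x\<in>space P. ennreal u < rational_exit_time x} \<le> sup_cdf (1 / sqrt u)"
  proof (rule tendsto_lowerbound)
    show "\<forall>\<^sub>F b in at_right (1 / sqrt u). BM.prob {x\<in>space P. ennreal u < rational_exit_time x} \<le> sup_cdf b"
      using eventually_at_right_less by eventually_elim (rule exit_prob_le[OF u])
  qed simp
  have "(sup_cdf \<longlongrightarrow> sup_cdf (1 / sqrt u)) (at_left (1 / sqrt u))"
    using cont unfolding isCont_def by (rule tendsto_within_subset) simp
  then show "sup_cdf (1 / sqrt u) \<le> BM.prob {x\<in>space P. ennreal u < rational_exit_time x}"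
  proof (rule tendsto_upperbound)
    show "\<forall>\<^sub>F b in at_left (1 / sqrt u). sup_cdf b \<le> BM.prob {x\<in>space P. ennreal u < rational_exit_time x}"
      using eventually_at_left_real[OF a] by eventually_elim (rule exit_prob_ge[OF u]; simp)
  qed simp
qed

text \<open>
  The exceptional \<open>u\<close> are the images of the countably many jumps of \<open>sup_cdf\<close> under \<open>a \<mapsto> 1 / a\<^sup>2\<close>.
\<close>

lemma AE_isCont_inverse_sqrt: "AE u in lborel. 0 < u \<longrightarrow> isCont sup_cdf (1 / sqrt u)"
proof -
  have "{u. 0 < u \<and> \<not> isCont sup_cdf (1 / sqrt u)} \<subseteq> (\<lambda>a. 1 / a\<^sup>2) ` {a. \<not> isCont sup_cdf a}"
  proof
    fix u assume "u \<in> {u. 0 < u \<and> \<not> isCont sup_cdf (1 / sqrt u)}"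
    then show "u \<in> (\<lambda>a. 1 / a\<^sup>2) ` {a. \<not> isCont sup_cdf a}"
      by (intro image_eqI[of _ _ "1 / sqrt u"]) (auto simp: power_divide)
  qed
  then have "countable {u. 0 < u \<and> \<not> isCont sup_cdf (1 / sqrt u)}"
    by (rule countable_subset[OF _ countable_image[OF countable_sup_cdf_discontinuities]])
  from countable_imp_null_set_lborel[OF this] show ?thesis by (rule AE_I') auto
qed

lemma process_exit_moment:
  assumes p: "0 < p"
  shows "(\<integral>\<^sup>+x. ennreal_powr (process_exit_time W x) p \<partial>P) =
    (\<integral>\<^sup>+u. ennreal (p * u powr (p - 1) * indicator {0<..} u * sup_cdf (1 / sqrt u)) \<partial>lborel)"
proof -
  have "(\<integral>\<^sup>+x. ennreal_powr (process_exit_time W x) p \<partial>P) = (\<integral>\<^sup>+x. ennreal_powr (rational_exit_time x) p \<partial>P)"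
    by (rule nn_integral_cong_AE) (use AE_process_exit_time_eq in \<open>eventually_elim; simp\<close>)
  also have "\<dots> = (\<integral>\<^sup>+u. ennreal (p * u powr (p - 1) * indicator {0<..} u * BM.prob {x\<in>space P. ennreal u < rational_exit_time x}) \<partial>lborel)"
    by (rule BM.nn_integral_powr_layer_cake[OF rational_exit_time_measurable p])
  also have "\<dots> = (\<integral>\<^sup>+u. ennreal (p * u powr (p - 1) * indicator {0<..} u * sup_cdf (1 / sqrt u)) \<partial>lborel)"
  proof (rule nn_integral_cong_AE)
    show "AE u in lborel. ennreal (p * u powr (p - 1) * indicator {0<..} u * BM.prob {x\<in>space P. ennreal u < rational_exit_time x}) =
      ennreal (p * u powr (p - 1) * indicator {0<..} u * sup_cdf (1 / sqrt u))"
      using AE_isCont_inverse_sqrt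
    proof eventually_elim
      case (elim u)
      then show ?case by (cases "0 < u") (simp_all add: exit_prob_eq)
    qed
  qed
  finally show ?thesis .
qed

lemma walk_exit_prob_tendsto:
  assumes u: "0 < u" and cont: "isCont sup_cdf (1 / sqrt u)"
  shows "(\<lambda>r. walk_cdf (nat \<lfloor>u * (real r)\<^sup>2\<rfloor>) (real r / sqrt (real (nat \<lfloor>u * (real r)\<^sup>2\<rfloor>)))) \<longlonglongrightarrow> sup_cdf (1 / sqrt u)"
proof -
  define n where "n r = nat \<lfloor>u * (real r)\<^sup>2\<rfloor>" for r :: nat
  have n: "real (n r) \<le> u * (real r)\<^sup>2" "u * (real r)\<^sup>2 < real (n r) + 1" for r
    unfolding n_def using u by (auto simp: of_nat_nat)
  have inv: "(\<lambda>r. inverse (real r)) \<longlonglongrightarrow> 0" by (rule lim_inverse_n)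
  have ratio: "(\<lambda>r. real (n r) / (real r)\<^sup>2) \<longlonglongrightarrow> u"
  proof (rule tendsto_sandwich)
    have "(\<lambda>r. u - (inverse (real r))\<^sup>2) \<longlonglongrightarrow> u - 0\<^sup>2"
      by (intro tendsto_diff tendsto_const tendsto_power inv)
    then show "(\<lambda>r. u - (inverse (real r))\<^sup>2) \<longlonglongrightarrow> u" by simp
    show "\<forall>\<^sub>F r in sequentially. u - (inverse (real r))\<^sup>2 \<le> real (n r) / (real r)\<^sup>2"
      using eventually_gt_at_top[of 0]
    proof eventually_elim
      case (elim r)
      have "u - (inverse (real r))\<^sup>2 = (u * (real r)\<^sup>2 - 1) / (real r)\<^sup>2"
        using elim by (simp add: diff_divide_distrib inverse_eq_divide power_divide)
      also have "\<dots> \<le> real (n r) / (real r)\<^sup>2"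
        using n(2)[of r] by (intro divide_right_mono) auto
      finally show ?case .
    qed
    show "\<forall>\<^sub>F r in sequentially. real (n r) / (real r)\<^sup>2 \<le> u"
      using eventually_gt_at_top[of 0] by eventually_elim (use n(1) in \<open>simp add: pos_divide_le_eq\<close>)
  qed simp
  have "(\<lambda>r. 1 / sqrt (real (n r) / (real r)\<^sup>2)) \<longlonglongrightarrow> 1 / sqrt u"
    using u by (intro tendsto_intros ratio) auto
  then have "(\<lambda>r. real r / sqrt (real (n r))) \<longlonglongrightarrow> 1 / sqrt u"
    by (simp add: real_sqrt_divide)
  moreover have "filterlim n at_top sequentially"
  proof -
    have square: "filterlim (\<lambda>r. u * (real r)\<^sup>2) at_top sequentially"
      by (intro filterlim_tendsto_pos_mult_at_top[OF tendsto_const u] filterlim_pow_at_top filterlim_real_sequentially) simp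
    show ?thesis
      unfolding filterlim_at_top
    proof
      fix k :: nat
      have "\<forall>\<^sub>F r in sequentially. real k + 1 \<le> u * (real r)\<^sup>2"
        using square unfolding filterlim_at_top by blast
      then show "\<forall>\<^sub>F r in sequentially. k \<le> n r"
      proof eventually_elim
        case (elim r)
        then have "real k < real (n r) + 0 + 1" using n(2)[of r] by linarith
        then show ?case by linarith
      qed
    qed
  qed
  ultimately show ?thesis
    using u cont unfolding n_def[symmetric] by (intro walk_cdf_tendsto) auto
qed

end

section \<open>Geometric tails of the exit times\<close>

context walk_and_brownian
begin

text \<open>
  If the increment were almost surely bounded by \<open>b\<close>, then the variance \<open>c / CARD('n)\<close> of each
  coordinate could not exceed \<open>b\<^sup>2\<close>.
\<close>

lemma brownian_increment_not_confined:
  assumes c: "0 \<le> c" and b: "0 \<le> b" "b\<^sup>2 < c / real CARD('n)"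
  shows "BM.prob {x\<in>space P. infnorm (W c x - W 0 x) \<le> b} < 1"
proof (rule ccontr)
  assume "\<not> BM.prob {x\<in>space P. infnorm (W c x - W 0 x) \<le> b} < 1"
  then have one: "BM.prob {x\<in>space P. infnorm (W c x - W 0 x) \<le> b} = 1"
    using BM.prob_le_1[of "{x\<in>space P. infnorm (W c x - W 0 x) \<le> b}"] by linarith
  have [measurable]: "W c \<in> borel_measurable P" "W 0 \<in> borel_measurable P" using c by auto
  have "{x\<in>space P. infnorm (W c x - W 0 x) \<le> b} \<in> BM.events" by measurable
  then have AE: "AE x in P. x \<in> {x\<in>space P. infnorm (W c x - W 0 x) \<le> b}"
    using one BM.AE_in_set_eq_1 by blast
  fix i :: 'n
  have "BM.centered_gaussian_vector (\<lambda>x. W (0 + c) x - W 0 x) (c *\<^sub>R ((1 / real CARD('n)) *\<^sub>R mat 1))"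
    by (rule BM.gaussian_increments) (use c in auto)
  then have "BM.expectation (\<lambda>x. (W c x - W 0 x) $ i * (W c x - W 0 x) $ i) = (c *\<^sub>R ((1 / real CARD('n)) *\<^sub>R mat 1) :: real ^ 'n ^ 'n) $ i $ i"
    unfolding BM.centered_gaussian_vector_def by simp
  then have "c / real CARD('n) = BM.expectation (\<lambda>x. ((W c x - W 0 x) $ i)\<^sup>2)"
    by (simp add: mat_def power2_eq_square)
  also have "\<dots> \<le> BM.expectation (\<lambda>x. b\<^sup>2)"
  proof (rule integral_mono_AE)
    have bound: "AE x in P. ((W c x - W 0 x) $ i)\<^sup>2 \<le> b\<^sup>2"
      using AE
    proof eventually_elim
      case (elim x)
      then have "\<bar>(W c x - W 0 x) $ i\<bar> \<le> b" by (simp add: infnorm_le_iff_components)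
      then show ?case by (rule abs_le_square_iff[THEN iffD1, of _ b, simplified abs_of_nonneg[OF b(1)]])
    qed
    then show "AE x in P. ((W c x - W 0 x) $ i)\<^sup>2 \<le> b\<^sup>2" .
    show "integrable P (\<lambda>x. ((W c x - W 0 x) $ i)\<^sup>2)"
      using bound by (intro BM.integrable_const_bound[where B = "b\<^sup>2"]) auto
  qed simp
  finally show False using b by (simp add: BM.prob_space)
qed

text \<open>
  The block number \<open>l r\<close> may depend arbitrarily on \<open>r\<close>, since the characteristic function of a block
  increment does not see the position of the block.
\<close>

lemma block_increments_converge:
  fixes l :: "nat \<Rightarrow> nat" and c :: nat
  shows "converging_char_functions M P {1 :: nat}
    (\<lambda>r j x. (1 / real r) *\<^sub>R (walk \<omega> (Suc (l r) * (c * r\<^sup>2)) x - walk \<omega> (l r * (c * r\<^sup>2)) x)) (\<lambda>j x. W (real c) x - W 0 x)"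
proof unfold_locales
  have [measurable]: "W (real c) \<in> borel_measurable P" "W 0 \<in> borel_measurable P" by auto
  show "(\<lambda>x. W (real c) x - W 0 x) \<in> borel_measurable P" by measurable
  fix \<theta> :: "nat \<Rightarrow> real ^ 'n"
  let ?\<eta> = "\<theta> 1"
  have "BM.centered_gaussian_vector (\<lambda>x. W (0 + real c) x - W 0 x) (real c *\<^sub>R ((1 / real CARD('n)) *\<^sub>R mat 1))"
    by (rule BM.gaussian_increments) auto
  then have "BM.centered_gaussian_vector (\<lambda>x. W (real c) x - W 0 x) ((real c * (1 / real CARD('n))) *\<^sub>R mat 1)" by simp
  from BM.char_centered_gaussian_vector[OF this, of ?\<eta>]
  have P: "(\<integral>x. iexp (\<Sum>j\<in>{1}. \<theta> j \<bullet> (W (real c) x - W 0 x)) \<partial>P) =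
    complex_of_real (exp (- (real c * (?\<eta> \<bullet> ?\<eta>) / (2 * real CARD('n)))))"
    by (simp add: mult_ac)
  have M: "(\<integral>x. iexp (\<Sum>j\<in>{1}. \<theta> j \<bullet> ((1 / real r) *\<^sub>R (walk \<omega> (Suc (l r) * (c * r\<^sup>2)) x - walk \<omega> (l r * (c * r\<^sup>2)) x))) \<partial>M) =
    complex_of_real (((\<Sum>i\<in>UNIV. cos (?\<eta> $ i / sqrt (real (r\<^sup>2)))) / real CARD('n)) ^ (c * r\<^sup>2))" for r
  proof -
    have "(\<integral>x. iexp (((1 / real r) *\<^sub>R ?\<eta>) \<bullet> (walk \<omega> (Suc (l r) * (c * r\<^sup>2)) x - walk \<omega> (l r * (c * r\<^sup>2)) x)) \<partial>M) =
      complex_of_real (((\<Sum>i\<in>UNIV. cos (((1 / real r) *\<^sub>R ?\<eta>) $ i)) / real CARD('n)) ^ (Suc (l r) * (c * r\<^sup>2) - l r * (c * r\<^sup>2)))"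
      by (rule char_walk_increment) simp
    then show ?thesis by simp
  qed
  have "(\<lambda>n. real (c * n) / real n) \<longlonglongrightarrow> real c"
    by (rule Lim_transform_eventually[OF tendsto_const]) (use eventually_gt_at_top[of 0] in \<open>eventually_elim; simp\<close>)
  then have "(\<lambda>n. ((\<Sum>i\<in>UNIV. cos (?\<eta> $ i / sqrt (real n))) / real CARD('n)) ^ (c * n)) \<longlonglongrightarrow>
    exp (- (real c * (?\<eta> \<bullet> ?\<eta>) / (2 * real CARD('n))))"
    by (rule cos_average_power_tendsto)
  then have "(\<lambda>r. ((\<Sum>i\<in>UNIV. cos (?\<eta> $ i / sqrt (real (r\<^sup>2)))) / real CARD('n)) ^ (c * r\<^sup>2)) \<longlonglongrightarrow>
    exp (- (real c * (?\<eta> \<bullet> ?\<eta>) / (2 * real CARD('n))))"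
  proof (rule filterlim_compose)
    show "filterlim (\<lambda>r :: nat. r\<^sup>2) sequentially sequentially"
    proof (rule filterlim_at_top_mono[OF filterlim_ident])
      show "\<forall>\<^sub>F r :: nat in sequentially. r \<le> r\<^sup>2"
        by (intro always_eventually allI) (simp add: power2_eq_square)
    qed
  qed
  then show "(\<lambda>r. \<integral>x. iexp (\<Sum>j\<in>{1}. \<theta> j \<bullet> ((1 / real r) *\<^sub>R (walk \<omega> (Suc (l r) * (c * r\<^sup>2)) x - walk \<omega> (l r * (c * r\<^sup>2)) x))) \<partial>M)
    \<longlonglongrightarrow> (\<integral>x. iexp (\<Sum>j\<in>{1}. \<theta> j \<bullet> (W (real c) x - W 0 x)) \<partial>P)"
    unfolding M P by (rule tendsto_of_real)
qed auto

lemma block_increments_tight: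
  fixes l :: "nat \<Rightarrow> nat" and c :: nat
  assumes d: "0 < d" and c: "1 \<le> c"
  shows "\<exists>K. \<forall>\<^sub>F r in sequentially. prob {x\<in>space M. \<exists>j\<in>{1 :: nat}.
    K < infnorm ((1 / real r) *\<^sub>R (walk \<omega> (Suc (l r) * (c * r\<^sup>2)) x - walk \<omega> (l r * (c * r\<^sup>2)) x))} \<le> d"
proof -
  obtain K :: real where K: "0 < K" "4 * real CARD('n) * exp (- (K\<^sup>2 / (8 * real c))) < d"
    using gaussian_tail_small[OF _ _ d, of "4 * real CARD('n)" "8 * real c"] c by auto
  have "\<forall>\<^sub>F r in sequentially. prob {x\<in>space M. \<exists>j\<in>{1 :: nat}.
    K < infnorm ((1 / real r) *\<^sub>R (walk \<omega> (Suc (l r) * (c * r\<^sup>2)) x - walk \<omega> (l r * (c * r\<^sup>2)) x))} \<le> d"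
    using eventually_ge_at_top[of 1]
  proof eventually_elim
    case (elim r)
    let ?L = "c * r\<^sup>2"
    let ?E = "{x\<in>space M. \<exists>j\<in>{l r * ?L<..Suc (l r) * ?L}. 2 * (K * real r / 2) < infnorm (walk \<omega> j x - walk \<omega> (l r * ?L) x)}"
    have "prob {x\<in>space M. \<exists>j\<in>{1 :: nat}.
        K < infnorm ((1 / real r) *\<^sub>R (walk \<omega> (Suc (l r) * ?L) x - walk \<omega> (l r * ?L) x))} \<le> prob ?E"
    proof (rule finite_measure_mono)
      show "?E \<in> events" by (auto intro!: sets.sets_Collect_finite_Ex)
      show "{x\<in>space M. \<exists>j\<in>{1 :: nat}. K < infnorm ((1 / real r) *\<^sub>R (walk \<omega> (Suc (l r) * ?L) x - walk \<omega> (l r * ?L) x))} \<subseteq> ?E"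
      proof (rule subsetI)
        fix x assume "x \<in> {x\<in>space M. \<exists>j\<in>{1 :: nat}. K < infnorm ((1 / real r) *\<^sub>R (walk \<omega> (Suc (l r) * ?L) x - walk \<omega> (l r * ?L) x))}"
        then have x: "x \<in> space M" "K < infnorm ((1 / real r) *\<^sub>R (walk \<omega> (Suc (l r) * ?L) x - walk \<omega> (l r * ?L) x))" by auto
        then have "2 * (K * real r / 2) < infnorm (walk \<omega> (Suc (l r) * ?L) x - walk \<omega> (l r * ?L) x)"
          using elim by (simp add: infnorm_mul pos_less_divide_eq)
        moreover have "Suc (l r) * ?L \<in> {l r * ?L<..Suc (l r) * ?L}" using c elim by simp
        ultimately show "x \<in> ?E" using x(1) by blast
      qed
    qed
    also have "\<dots> \<le> 4 * real CARD('n) * exp (- ((K * real r / 2)\<^sup>2 / (2 * real ?L)))"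
      using K elim by (intro walk_max_increment_tail) auto
    also have "(K * real r / 2)\<^sup>2 / (2 * real ?L) = K\<^sup>2 / (8 * real c)"
      using elim c by (simp add: power_mult_distrib power_divide field_simps)
    finally show ?case using K(2) by linarith
  qed
  then show ?thesis by blast
qed

text \<open>
  The bound has to be uniform in the block number \<open>l\<close>.  For every \<open>r\<close> a block that violates the
  bound is selected if there is one, and the limit theorem is applied to the sequence of these blocks.
\<close>

lemma walk_leaves_box_in_each_block:
  fixes c :: nat
  assumes c: "5 * CARD('n) \<le> c"
  obtains \<rho> where "0 < \<rho>" "\<rho> < 1" "\<forall>\<^sub>F r in sequentially. \<forall>l.
    prob {x\<in>space M. infnorm (walk \<omega> (Suc l * (c * r\<^sup>2)) x - walk \<omega> (l * (c * r\<^sup>2)) x) \<le> 2 * real r} \<le> \<rho>"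
proof -
  \<comment> \<open>Over a time \<open>c \<ge> 5 * CARD('n)\<close> the variance of a coordinate is at least \<open>5\<close>, which exceeds \<open>(21 / 10)\<^sup>2\<close>; the radius \<open>21 / 10\<close> leaves a gap above \<open>2\<close>.\<close>
  let ?q = "BM.prob {x\<in>space P. infnorm (W (real c) x - W 0 x) \<le> 21 / 10}"
  let ?A = "\<lambda>r l. {x\<in>space M. infnorm (walk \<omega> (Suc l * (c * r\<^sup>2)) x - walk \<omega> (l * (c * r\<^sup>2)) x) \<le> 2 * real r}"
  have c1: "1 \<le> c" using c zero_less_card_finite[where 'a = 'n] by linarith
  have "(21 / 10)\<^sup>2 * real CARD('n) < 5 * real CARD('n)"
    by (rule mult_strict_right_mono) (simp_all add: power2_eq_square)
  also have "\<dots> \<le> real c" using c by (metis of_nat_le_iff of_nat_mult of_nat_numeral)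
  finally have "(21 / 10)\<^sup>2 * real CARD('n) < real c" .
  then have "(21 / 10)\<^sup>2 < real c / real CARD('n)" by (simp add: pos_less_divide_eq)
  then have q: "?q < 1" by (intro brownian_increment_not_confined) auto
  define \<rho> where "\<rho> = (?q + 1) / 2"
  have \<rho>: "0 < \<rho>" "\<rho> < 1" "\<rho> = ?q + (1 - ?q) / 2"
    unfolding \<rho>_def using q by (auto simp: field_simps add_pos_nonneg)
  \<comment> \<open>If no block violates the bound \<open>\<rho>\<close>, then the choice of \<open>l r\<close> is irrelevant.\<close>
  define l where "l r = (SOME l. \<rho> < prob (?A r l))" for r
  interpret C: converging_char_functions M P "{1 :: nat}"
    "\<lambda>r j x. (1 / real r) *\<^sub>R (walk \<omega> (Suc (l r) * (c * r\<^sup>2)) x - walk \<omega> (l r * (c * r\<^sup>2)) x)" "\<lambda>j x. W (real c) x - W 0 x"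
    by (rule block_increments_converge)
  have "\<forall>\<^sub>F r in sequentially. prob {x\<in>space M. \<forall>j\<in>{1 :: nat}.
      infnorm ((1 / real r) *\<^sub>R (walk \<omega> (Suc (l r) * (c * r\<^sup>2)) x - walk \<omega> (l r * (c * r\<^sup>2)) x)) \<le> 2}
    \<le> BM.prob {x\<in>space P. \<forall>j\<in>{1 :: nat}. infnorm (W (real c) x - W 0 x) \<le> 21 / 10} + (1 - ?q) / 2"
    using q c1 by (intro C.box_prob_sandwich(1) block_increments_tight) auto
  then have "\<forall>\<^sub>F r in sequentially. \<forall>l. prob (?A r l) \<le> \<rho>"
    using eventually_ge_at_top[of 1]
  proof eventually_elim
    case (elim r)
    have "{x\<in>space M. \<forall>j\<in>{1 :: nat}. infnorm ((1 / real r) *\<^sub>R (walk \<omega> (Suc (l r) * (c * r\<^sup>2)) x - walk \<omega> (l r * (c * r\<^sup>2)) x)) \<le> 2} = ?A r (l r)"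
      using elim(2) by (simp add: infnorm_mul pos_divide_le_eq)
    then have "prob (?A r (l r)) \<le> \<rho>" using elim(1) \<rho>(3) by simp
    show ?case
    proof (rule allI, rule ccontr)
      fix l' assume "\<not> prob (?A r l') \<le> \<rho>"
      then have "\<rho> < prob (?A r l')" by simp
      then have "\<rho> < prob (?A r (l r))" unfolding l_def by (rule someI)
      then show False using \<open>prob (?A r (l r)) \<le> \<rho>\<close> by simp
    qed
  qed
  then show ?thesis using that \<rho> by blast
qed

proposition exit_moments_converge:
  assumes p: "0 < p"
  shows "(\<lambda>r. (\<integral>\<^sup>+x. ennreal_powr (walk_exit_time \<omega> r x) p \<partial>M) / ennreal (real r powr (2 * p)))
      \<longlonglongrightarrow> (\<integral>\<^sup>+x. ennreal_powr (process_exit_time W x) p \<partial>P)"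
    and "(\<integral>\<^sup>+x. ennreal_powr (process_exit_time W x) p \<partial>P) < \<infinity>"
proof -
  define c where "c = 5 * CARD('n)"
  have c: "1 \<le> c" unfolding c_def using zero_less_card_finite[where 'a = 'n] by linarith
  obtain \<rho> where \<rho>: "0 < \<rho>" "\<rho> < 1" and block: "\<forall>\<^sub>F r in sequentially. \<forall>l.
    prob {x\<in>space M. infnorm (walk \<omega> (Suc l * (c * r\<^sup>2)) x - walk \<omega> (l * (c * r\<^sup>2)) x) \<le> 2 * real r} \<le> \<rho>"
    using walk_leaves_box_in_each_block[of c] unfolding c_def by blast
  let ?b = "- ln \<rho> / real c"
  let ?g = "\<lambda>r u. walk_cdf (nat \<lfloor>u * (real r)\<^sup>2\<rfloor>) (real r / sqrt (real (nat \<lfloor>u * (real r)\<^sup>2\<rfloor>)))"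
  have b: "0 < ?b" using \<rho> c by (simp add: divide_neg_pos ln_less_zero)
  have dom: "\<forall>\<^sub>F r in sequentially. \<forall>u>0. ?g r u \<le> (1 / \<rho>\<^sup>2) * exp (- ?b * u)"
    using block eventually_ge_at_top[of 1]
  proof eventually_elim
    case (elim r)
    then show ?case by (intro allI impI walk_confinement_tail c \<rho>) auto
  qed
  have lim: "AE u in lborel. 0 < u \<longrightarrow> (\<lambda>r. ?g r u) \<longlonglongrightarrow> sup_cdf (1 / sqrt u)"
    using AE_isCont_inverse_sqrt by eventually_elim (intro impI walk_exit_prob_tendsto; blast)
  have meas: "?g r \<in> borel_measurable borel" for r
  proof -
    have "(\<lambda>u. (\<lambda>k. walk_cdf k (real r / sqrt (real k))) (nat \<lfloor>u * (real r)\<^sup>2\<rfloor>)) \<in> borel_measurable borel"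
      by measurable
    then show ?thesis by simp
  qed
  note conv = tail_integrals_converge[OF p b meas _ dom lim]
  have "(\<lambda>r. \<integral>\<^sup>+u. ennreal (p * u powr (p - 1) * indicator {0<..} u * ?g r u) \<partial>lborel)
    \<longlonglongrightarrow> (\<integral>\<^sup>+x. ennreal_powr (process_exit_time W x) p \<partial>P)"
    unfolding process_exit_moment[OF p] by (rule conv(1)) measurable
  then show "(\<lambda>r. (\<integral>\<^sup>+x. ennreal_powr (walk_exit_time \<omega> r x) p \<partial>M) / ennreal (real r powr (2 * p)))
      \<longlonglongrightarrow> (\<integral>\<^sup>+x. ennreal_powr (process_exit_time W x) p \<partial>P)"
  proof (rule Lim_transform_eventually)
    show "\<forall>\<^sub>F r in sequentially. (\<integral>\<^sup>+u. ennreal (p * u powr (p - 1) * indicator {0<..} u * ?g r u) \<partial>lborel) =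
      (\<integral>\<^sup>+x. ennreal_powr (walk_exit_time \<omega> r x) p \<partial>M) / ennreal (real r powr (2 * p))"
      using eventually_ge_at_top[of 1] by eventually_elim (rule walk_exit_moment[OF p, symmetric])
  qed
  show "(\<integral>\<^sup>+x. ennreal_powr (process_exit_time W x) p \<partial>P) < \<infinity>"
    unfolding process_exit_moment[OF p] by (rule conv(2)) measurable
qed

end

theorem theorem2:
  fixes M :: "'a measure" and \<omega> :: "nat \<Rightarrow> 'a \<Rightarrow> real ^ 'n"
    and P :: "'b measure" and W :: "real \<Rightarrow> 'b \<Rightarrow> real ^ 'n"
    and p :: real
  assumes "1 \<le> p"
    and "simple_random_walk M \<omega>"
    and "brownian_motion P W ((1 / real CARD('n)) *\<^sub>R mat 1)"
  shows "(\<integral>\<^sup>+x. ennreal_powr (process_exit_time W x) p \<partial>P) < \<infinity> \<and>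
    (\<lambda>r. (\<integral>\<^sup>+x. ennreal_powr (walk_exit_time \<omega> r x) p \<partial>M) / ennreal (real r powr (2 * p)))
      \<longlonglongrightarrow> (\<integral>\<^sup>+x. ennreal_powr (process_exit_time W x) p \<partial>P) \<and>
    (\<integral>\<^sup>+x. ennreal_powr (process_max W x) p \<partial>P) < \<infinity> \<and>
    (\<lambda>t. (\<integral>\<^sup>+x. ennreal (walk_max \<omega> t x powr p) \<partial>M) / ennreal (real t powr (p / 2)))
      \<longlonglongrightarrow> (\<integral>\<^sup>+x. ennreal_powr (process_max W x) p \<partial>P)"
proof -
  interpret walk_and_brownian M \<omega> P W
    using assms(2,3) by (rule walk_and_brownian.intro)
  show ?thesis
    using assms(1) exit_moments_converge[of p] max_moments_converge[of p] by simp
qed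

end
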